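(* Suppose that $H$ and $T$ are fixed graphs and assume that $T$ is $2$-balanced and that $m_2(H) \le m_2(T)$. Let $F_1, \dotsc, F_k$ be the $T$-resolution of $H$ and let $p_0, p_1, \dotsc, p_k$ be the associated threshold sequence. Then the following hold for every $i \in [k]$: (i) If $p_0 \ll p \ll p_i$, then w.h.p.\ \[ \mathrm{ex}\big(G(n,p),T,H\big) \ge \left( \mathrm{ex}^*\big(n,T,\{F_1, \dotsc, F_{i-1}\}\big) + o\big(n^{v_T}\big)\right) p^{e_T}. \] (ii) If $ p\gg p_i$, then w.h.p.\ \[ \mathrm{ex}\big(G(n,p),T,H\big) \le \left( \mathrm{ex}^*\big(n,T,\{F_1, \dotsc, F_i\}\big) + o\big(n^{v_T}\big)\right) p^{e_T}. \]
   Context: $G(n,p)$ is the binomial random graph; w.h.p.\ means with probability tending to one as $n\to\infty$. $\mathrm{ex}(G(n,p),T,H)$ is the maximum number of copies of $T$ in an $H$-free subgraph of $G(n,p)$. $m_2(H)=\max\{(e_{H'}-1)/(v_{H'}-2): H'\subseteq H,\ e_{H'}\ge 2\}$; $T$ is $2$-balanced if $m_2(T)=(e_T-1)/(v_T-2)$. A $T$-covering of $H$ is a minimal collection of pairwise edge-disjoint copies of $T$ (in a large complete graph) whose union contains a copy of $H$ (minimal: removing any member destroys all copies of $H$ in the union); its type is its isomorphism class (finitely many types). For a collection $F'$ of copies of $T$, $U(F')$ is the union graph, and the $T$-density of a $T$-covering $F$ is $m_T(F)=\max\{(e_{U(F')}-e_T)/(v_{U(F')}-v_T): F'\subseteq F,\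 |F'|\ge 2\}$. $F^e_{T,H}$ is the covering of $H$ by $e_H$ copies of $T$, each meeting $H$ in a single edge and otherwise vertex-disjoint from the others. The $T$-resolution of $H$ is the sequence $F_1,\dots,F_k$ of all types of $T$-coverings of $H$ with $T$-density at most $m_T(F^e_{T,H})$, ordered by $T$-density (ties arbitrary); the associated threshold sequence is $p_0=n^{-v_T/e_T}$ and $p_i=n^{-1/m_T(F_i)}$ for $i\in[k]$. For a family $\mathcal{F}$ of $T$-coverings of $H$, $\mathrm{ex}^*(n,T,\mathcal{F})$ is the maximum size of a collection of copies of $T$ in $K_n$ that contains no member of $\mathcal{F}$ (no sub-collection isomorphic to a member of $\mathcal{F}$). *)

theory Defs
  imports
    "HOL-Probability.Probability"
    "HOL-Probability.Product_PMF"
    "HOL-Library.Landau_Symbols"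
begin

datatype 'a ugraph = UGraph (verts: "'a set") (edges: "'a set set")

definition simple_graph :: "'a ugraph \<Rightarrow> bool" where
  "simple_graph G \<longleftrightarrow> finite (verts G) \<and> (\<forall>e\<in>edges G. e \<subseteq> verts G \<and> card e = 2)"

definition subgraph :: "'a ugraph \<Rightarrow> 'a ugraph \<Rightarrow> bool" where
  "subgraph G' G \<longleftrightarrow> verts G' \<subseteq> verts G \<and> edges G' \<subseteq> edges G"

definition graph_image :: "('a \<Rightarrow> 'b) \<Rightarrow> 'a ugraph \<Rightarrow> 'b ugraph" where
  "graph_image f G = UGraph (f ` verts G) ((\<lambda>e. f ` e) ` edges G)"

definition graph_iso :: "'a ugraph \<Rightarrow> 'b ugraph \<Rightarrow> bool" where
  "graph_iso G G' \<longleftrightarrow> (\<exists>f. inj_on f (verts G) \<and> G' = graph_image f G)"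

definition copies :: "'a ugraph \<Rightarrow> 'b ugraph \<Rightarrow> 'b ugraph set" where
  "copies T G = {T'. subgraph T' G \<and> graph_iso T T'}"

definition H_free :: "'a ugraph \<Rightarrow> 'b ugraph \<Rightarrow> bool" where
  "H_free H G \<longleftrightarrow> copies H G = {}"

definition complete_graph :: "nat \<Rightarrow> nat ugraph" where
  "complete_graph n = UGraph {..<n} {e. e \<subseteq> {..<n} \<and> card e = 2}"

text \<open>Only meaningful for graphs with at least two edges.\<close>

definition m2 :: "'a ugraph \<Rightarrow> real" where
  "m2 H = Max {(real (card (edges H')) - 1) / (real (card (verts H')) - 2) | H'.
      simple_graph H' \<and> subgraph H' H \<and> 2 \<le> card (edges H')}"

definition two_balanced :: "'a ugraph \<Rightarrow> bool" where
  "two_balanced T \<longleftrightarrow> 2 \<le> card (edges T) \<and>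
     m2 T = (real (card (edges T)) - 1) / (real (card (verts T)) - 2)"

text \<open>
  Subgraphs are taken spanning. This makes a difference only if \<open>H\<close> has isolated vertices:
  it excludes subgraphs that are \<open>H\<close>-free merely for having fewer vertices than \<open>H\<close>.
\<close>

definition ex_sub :: "'a ugraph \<Rightarrow> 'b ugraph \<Rightarrow> 'c ugraph \<Rightarrow> nat" where
  "ex_sub G T H = Max {card (copies T G') | G'.
      subgraph G' G \<and> verts G' = verts G \<and> H_free H G'}"

definition random_graph :: "nat \<Rightarrow> real \<Rightarrow> nat ugraph pmf" where
  "random_graph n p =
     map_pmf (\<lambda>f. UGraph {..<n} {e \<in> edges (complete_graph n). f e})
       (Pi_pmf (edges (complete_graph n)) False (\<lambda>_. bernoulli_pmf p))"

definition union_graph :: "'a ugraph set \<Rightarrow> 'a ugraph" where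
  "union_graph F = UGraph (\<Union>T\<in>F. verts T) (\<Union>T\<in>F. edges T)"

text \<open>
  The large complete graph is the one on all natural numbers. Copies of \<open>H\<close> are sought in that
  host: their edges must belong to the union of the collection, whereas isolated vertices
  of \<open>H\<close> (if there are any) may be placed anywhere.
\<close>

definition union_contains :: "'a ugraph \<Rightarrow> nat ugraph set \<Rightarrow> bool" where
  "union_contains H F \<longleftrightarrow> copies H (UGraph UNIV (edges (union_graph F))) \<noteq> {}"

definition T_covering :: "'a ugraph \<Rightarrow> 'b ugraph \<Rightarrow> nat ugraph set \<Rightarrow> bool" where
  "T_covering T H F \<longleftrightarrow>
     finite F \<and> (\<forall>T'\<in>F. graph_iso T T') \<and>
     (\<forall>T'\<in>F. \<forall>T''\<in>F. T' \<noteq> T'' \<longrightarrow> edges T' \<inter> edges T'' = {}) \<and>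
     union_contains H F \<and>
     (\<forall>T'\<in>F. \<not> union_contains H (F - {T'}))"

definition collection_iso :: "'a ugraph set \<Rightarrow> 'b ugraph set \<Rightarrow> bool" where
  "collection_iso F F' \<longleftrightarrow>
     (\<exists>f. inj_on f (verts (union_graph F)) \<and> F' = graph_image f ` F)"

text \<open>
  The maximum is taken in the extended nonnegative reals, where \<open>x / 0 = \<infinity>\<close> for \<open>x \<noteq> 0\<close>; this is
  the density contributed by edge-disjoint copies of \<open>T\<close> on one common vertex set.
  The supremum ranges over a finite set. It is empty only if \<open>F\<close> has at most one member,
  in which case the density is 0. A one-member covering occurs only if \<open>H\<close> (up to isolated
  vertices) is a subgraph of \<open>T\<close>, and then it is the only type of covering.
  The subtraction on \<open>nat\<close> does not truncate, as every union contains a copy of \<open>T\<close>.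
\<close>

definition T_density :: "'a ugraph \<Rightarrow> nat ugraph set \<Rightarrow> ennreal" where
  "T_density T F = Sup {of_nat (card (edges (union_graph F')) - card (edges T)) /
                        of_nat (card (verts (union_graph F')) - card (verts T)) | F'.
                        F' \<subseteq> F \<and> 2 \<le> card F'}"

text \<open>
  \<open>H0\<close> is the covered copy of \<open>H\<close>, and \<open>c e\<close> is the copy of \<open>T\<close> that meets it in the edge \<open>e\<close>.
  Different choices of the edge of \<open>T\<close> that is placed on \<open>e\<close> may give non-isomorphic
  collections, but all of them have the same \<open>T\<close>-density.
\<close>

definition edgewise_covering :: "'a ugraph \<Rightarrow> 'b ugraph \<Rightarrow> nat ugraph set \<Rightarrow> bool" where
  "edgewise_covering T H F \<longleftrightarrow>
     (\<exists>H0 c. graph_iso H H0 \<and> bij_betw c (edges H0) F \<and>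
        (\<forall>e\<in>edges H0. graph_iso T (c e) \<and> e \<in> edges (c e) \<and> verts (c e) \<inter> verts H0 = e) \<and>
        (\<forall>e\<in>edges H0. \<forall>e'\<in>edges H0. e \<noteq> e' \<longrightarrow> verts (c e) \<inter> verts (c e') = e \<inter> e'))"

text \<open>
  \<open>Fs\<close> lists one representative of each type; \<open>Fe\<close> is the edgewise covering whose density
  is the cut-off.
\<close>

definition T_resolution ::
    "'a ugraph \<Rightarrow> 'b ugraph \<Rightarrow> nat ugraph set \<Rightarrow> nat ugraph set list \<Rightarrow> bool" where
  "T_resolution T H Fe Fs \<longleftrightarrow>
     (\<forall>F\<in>set Fs. T_covering T H F \<and> T_density T F \<le> T_density T Fe) \<and>
     (\<forall>F. T_covering T H F \<and> T_density T F \<le> T_density T Fe \<longrightarrow>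
        (\<exists>!j. j < length Fs \<and> collection_iso F (Fs ! j))) \<and>
     sorted (map (T_density T) Fs)"

definition threshold0 :: "'a ugraph \<Rightarrow> nat \<Rightarrow> real" where
  "threshold0 T n = real n powr (- (real (card (verts T)) / real (card (edges T))))"

text \<open>
  This is \<open>n\<close> to the power \<open>- 1 / m\<close>, where \<open>m\<close> is the density. For \<open>m = 0\<close> the exponent
  is \<open>-\<infinity>\<close> and the threshold is 0.
\<close>

definition threshold :: "'a ugraph \<Rightarrow> nat ugraph set \<Rightarrow> nat \<Rightarrow> real" where
  "threshold T F n =
     (if T_density T F = 0 then 0 else real n powr (- (1 / enn2real (T_density T F))))"

definition ex_star :: "nat \<Rightarrow> 'a ugraph \<Rightarrow> nat ugraph set set \<Rightarrow> nat" where
  "ex_star n T \<F> = Max {card C | C. C \<subseteq> copies T (complete_graph n) \<and>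
      \<not> (\<exists>D F. D \<subseteq> C \<and> F \<in> \<F> \<and> collection_iso F D)}"

end

theory Submission
  imports Defs "HOL-Real_Asymp.Real_Asymp"
begin

text \<open>
  Put \<open>\<tau> = n powr (- e(T) / m)\<close>, where \<open>m\<close> is the \<open>T\<close>-density of \<open>F_i\<close>. Since \<open>T\<close> is \<open>2\<close>-balanced and
  \<open>m2 H \<le> m2 T\<close>, we have \<open>m \<le> m2 T\<close>.

  For the upper bound, the copies of \<open>T\<close> in an \<open>H\<close>-free graph form a collection free of
  \<open>F_1, \<dots>, F_i\<close>. The bound \<open>m\<close> on the \<open>T\<close>-densities says precisely that the hypergraphs of copies of
  the \<open>F_j\<close>, whose vertices are the copies of \<open>T\<close> in \<open>K_n\<close>, satisfy the degree condition of the
  container lemma with \<open>\<tau>\<close>. Together with supersaturation this puts every free collection into a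
  container of size at most \<open>ex* + o(n^v(T))\<close> that is determined by a fingerprint of
  \<open>O(\<tau> n^v(T))\<close> copies. A free collection that is too large forces the number of copies of \<open>T\<close> in
  the random graph that lie outside of its container to be too small. By Janson's inequality this has
  probability \<open>exp (- \<Omega>(\<omega> \<tau> n^v(T)))\<close> with \<open>\<omega> = p n^(1/m)\<close>, which beats the sum over all
  fingerprints, as long as only fingerprints are counted whose union does not contain abnormally
  many copies of a subgraph of \<open>T\<close>.

  For the lower bound, take the copies of \<open>T\<close> from an extremal collection that appear in the random
  graph and delete one copy from each cluster of copies whose density is at least \<open>m\<close>, in particular
  from each pair of copies sharing an edge. As \<open>p n^(1/m)\<close> tends to \<open>0\<close>, few copies are lost, and a
  copy of \<open>H\<close> in the union of the rest would give a covering of smaller density.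
\<close>

section \<open>Product Bernoulli expectations and Janson's inequality\<close>

text \<open>The exponent 1 / m makes two quantities comparable. For p = \<omega> n powr (- 1 / m)
  put \<sigma> = n powr (v(T) - e(T) / m). As m \<le> m2 T, each subgraph of T with an edge has
  expected number of copies at least of order \<omega> \<sigma>, so Janson's exponent is of order
  \<omega> \<sigma>. Fingerprints have O(\<sigma>) members, and their probabilities sum to exp
  (O(\<sigma> log \<omega>)): the contest is between log \<omega> and \<omega>. Edge-disjointness
  within a covering gives m \<ge> e(T) / v(T), that is \<sigma> \<ge> 1.

  The obstacle in the union bound is that the copies in a fingerprint may share edges, so that it
  may appear with probability far above p to the power e(T) per copy. Copies are therefore added one
  at a time. For each edge set J of T, typicality bounds the number of ways in which J can land in
  the edges already present, and then overlaps cost only a constant factor per copy. Typicality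
  passes to subsets, hence from the random graph to the edges of a fingerprint.

  Both bounds are proved with a fixed slack \<epsilon> n^v(T); the error term arises by letting
  \<epsilon> tend to 0 slowly.\<close>

definition bexp :: "'x set \<Rightarrow> real \<Rightarrow> ('x set \<Rightarrow> real) \<Rightarrow> real" where
  "bexp A p F = (\<Sum>R\<in>Pow A. p ^ card R * (1 - p) ^ card (A - R) * F R)"

definition bprob :: "'x set \<Rightarrow> real \<Rightarrow> ('x set \<Rightarrow> bool) \<Rightarrow> real" where
  "bprob A p P = bexp A p (\<lambda>R. of_bool (P R))"

lemma bexp_cong:
  assumes "\<And>R. R \<subseteq> A \<Longrightarrow> F R = G R"
  shows "bexp A p F = bexp A p G"
  unfolding bexp_def by (rule sum.cong) (auto simp: assms)

lemma bexp_mono: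
  assumes "0 \<le> p" "p \<le> 1" and "\<And>R. R \<subseteq> A \<Longrightarrow> F R \<le> G R"
  shows "bexp A p F \<le> bexp A p G"
  unfolding bexp_def by (rule sum_mono) (use assms in \<open>auto intro!: mult_left_mono\<close>)

lemma bexp_add: "bexp A p (\<lambda>R. F R + G R) = bexp A p F + bexp A p G"
  by (simp add: bexp_def algebra_simps sum.distrib)

lemma bexp_diff: "bexp A p (\<lambda>R. F R - G R) = bexp A p F - bexp A p G"
  by (simp add: bexp_def algebra_simps sum_subtractf)

lemma bexp_cmult: "bexp A p (\<lambda>R. c * F R) = c * bexp A p F"
  by (simp add: bexp_def sum_distrib_left mult_ac)

lemma bexp_sum: "bexp A p (\<lambda>R. \<Sum>i\<in>I. F i R) = (\<Sum>i\<in>I. bexp A p (F i))"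
  unfolding bexp_def by (simp add: sum_distrib_left sum.swap[of _ I])

lemma bexp_empty [simp]: "bexp {} p F = F {}"
  by (simp add: bexp_def)

text \<open>Splits off the coin of one element. Expectations are finite sums over
  \<open>Pow A\<close> so that facts about them can be proved by induction on \<open>A\<close> in
  this way.\<close>

lemma bexp_insert:
  assumes "finite A" "x \<notin> A"
  shows "bexp (insert x A) p F = (1 - p) * bexp A p F + p * bexp A p (\<lambda>R. F (insert x R))"
proof -
  have inj: "inj_on (insert x) (Pow A)"
    using assms(2) by (auto simp: inj_on_def)
  have "bexp (insert x A) p F
      = (\<Sum>R\<in>Pow A. p ^ card R * (1 - p) ^ card (insert x A - R) * F R)
      + (\<Sum>R\<in>insert x ` Pow A. p ^ card R * (1 - p) ^ card (insert x A - R) * F R)"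
    unfolding bexp_def Pow_insert
    by (rule sum.union_disjoint) (use assms in auto)
  also have "(\<Sum>R\<in>insert x ` Pow A. p ^ card R * (1 - p) ^ card (insert x A - R) * F R)
      = p * bexp A p (\<lambda>R. F (insert x R))"
    unfolding sum.reindex[OF inj] bexp_def sum_distrib_left o_def
  proof (rule sum.cong[OF refl])
    fix R assume R: "R \<in> Pow A"
    have "insert x A - insert x R = A - R" using assms R by auto
    moreover have "card (insert x R) = Suc (card R)"
      using R assms by (subst card_insert_disjoint) (auto intro: finite_subset)
    ultimately show "p ^ card (insert x R) * (1 - p) ^ card (insert x A - insert x R) * F (insert x R)
      = p * (p ^ card R * (1 - p) ^ card (A - R) * F (insert x R))" by simp
  qed
  also have "(\<Sum>R\<in>Pow A. p ^ card R * (1 - p) ^ card (insert x A - R) * F R) = (1 - p) * bexp A p F"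
    unfolding bexp_def sum_distrib_left
  proof (rule sum.cong[OF refl])
    fix R assume R: "R \<in> Pow A"
    have "insert x A - R = insert x (A - R)" using assms R by auto
    then have "card (insert x A - R) = Suc (card (A - R))"
      using assms by simp
    then show "p ^ card R * (1 - p) ^ card (insert x A - R) * F R
      = (1 - p) * (p ^ card R * (1 - p) ^ card (A - R) * F R)" by simp
  qed
  finally show ?thesis by simp
qed

lemma bexp_const:
  assumes "finite A"
  shows "bexp A p (\<lambda>R. c) = c"
  using assms by (induction A) (auto simp: bexp_insert algebra_simps)

text \<open>Given that \<open>B\<close> is contained in \<open>R\<close>, the rest of
  \<open>R\<close> is still a binomial random subset, so \<open>F\<close> may be evaluated after
  adding \<open>B\<close>. This is the form in which independence is used below.\<close>

lemma bexp_superset: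
  assumes "finite A" "B \<subseteq> A"
  shows "bexp A p (\<lambda>R. of_bool (B \<subseteq> R) * F R) = p ^ card B * bexp A p (\<lambda>R. F (R \<union> B))"
  using assms
proof (induction A arbitrary: B F)
  case empty
  then show ?case by simp
next
  case (insert x A)
  show ?case
  proof (cases "x \<in> B")
    case True
    define B' where "B' = B - {x}"
    have B': "B = insert x B'" "x \<notin> B'" "B' \<subseteq> A" using True insert.prems by (auto simp: B'_def)
    then have fin: "finite B'" using insert.hyps(1) finite_subset by blast
    have "bexp A p (\<lambda>R. of_bool (B \<subseteq> R) * F R) = bexp A p (\<lambda>R. 0)"
      by (rule bexp_cong) (use insert.hyps(2) True in auto)
    moreover have "bexp A p (\<lambda>R. of_bool (B \<subseteq> insert x R) * F (insert x R))
        = bexp A p (\<lambda>R. of_bool (B' \<subseteq> R) * F (insert x R))"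
      by (rule bexp_cong) (use B' insert.hyps(2) in \<open>auto simp: of_bool_def\<close>)
    moreover have "\<dots> = p ^ card B' * bexp A p (\<lambda>R. F (insert x (R \<union> B')))"
      by (rule insert.IH[OF B'(3)])
    moreover have "insert x R \<union> insert x B' = R \<union> insert x B'" for R by blast
    ultimately show ?thesis
      using insert.hyps fin B'
      by (simp add: bexp_insert bexp_const algebra_simps)
  next
    case False
    then have B: "B \<subseteq> A" using insert.prems by auto
    have "bexp A p (\<lambda>R. of_bool (B \<subseteq> insert x R) * F (insert x R))
        = bexp A p (\<lambda>R. of_bool (B \<subseteq> R) * F (insert x R))"
      by (rule bexp_cong) (use False in \<open>auto simp: of_bool_def\<close>)
    then show ?thesis
      using insert.hyps insert.IH[OF B, of F] insert.IH[OF B, of "\<lambda>R. F (insert x R)"]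
      by (simp add: bexp_insert algebra_simps)
  qed
qed

lemma bexp_nonneg:
  assumes "0 \<le> p" "p \<le> 1" and "\<And>R. R \<subseteq> A \<Longrightarrow> 0 \<le> F R"
  shows "0 \<le> bexp A p F"
  unfolding bexp_def by (rule sum_nonneg) (use assms in auto)

lemma bprob_superset:
  assumes "finite A" "B \<subseteq> A"
  shows "bprob A p (\<lambda>R. B \<subseteq> R) = p ^ card B"
  using bexp_superset[OF assms, of p "\<lambda>_. 1"] assms(1) by (simp add: bprob_def bexp_const)

lemma bprob_mono:
  assumes "0 \<le> p" "p \<le> 1" and "\<And>R. R \<subseteq> A \<Longrightarrow> P R \<Longrightarrow> Q R"
  shows "bprob A p P \<le> bprob A p Q"
  unfolding bprob_def by (rule bexp_mono) (use assms in auto)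

lemma bprob_disj:
  assumes "0 \<le> p" "p \<le> 1"
  shows "bprob A p (\<lambda>R. P R \<or> Q R) \<le> bprob A p P + bprob A p Q"
  unfolding bprob_def bexp_add[symmetric] by (rule bexp_mono) (use assms in auto)

lemma bprob_Bex:
  assumes "0 \<le> p" "p \<le> 1" "finite I"
  shows "bprob A p (\<lambda>R. \<exists>i\<in>I. P i R) \<le> (\<Sum>i\<in>I. bprob A p (P i))"
  unfolding bprob_def bexp_sum[symmetric]
proof (rule bexp_mono)
  fix R
  show "of_bool (\<exists>i\<in>I. P i R) \<le> (\<Sum>i\<in>I. of_bool (P i R) :: real)"
  proof (cases "\<exists>i\<in>I. P i R")
    case True
    then obtain i where "i \<in> I" "P i R" by blast
    then have "of_bool (P i R) \<le> (\<Sum>i\<in>I. of_bool (P i R) :: real)"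
      by (intro member_le_sum) (use assms in auto)
    then show ?thesis using True \<open>P i R\<close> by simp
  qed (simp add: sum_nonneg)
qed (use assms in auto)

lemma bprob_not:
  assumes "finite A"
  shows "bprob A p (\<lambda>R. \<not> P R) = 1 - bprob A p P"
proof -
  have "bprob A p (\<lambda>R. \<not> P R) = bexp A p (\<lambda>R. 1 - of_bool (P R))"
    unfolding bprob_def by (rule bexp_cong) auto
  then show ?thesis using assms by (simp add: bexp_diff bexp_const bprob_def)
qed

lemma bprob_markov:
  assumes "0 \<le> p" "p \<le> 1" "0 < t" and "\<And>R. R \<subseteq> A \<Longrightarrow> 0 \<le> F R"
  shows "bprob A p (\<lambda>R. t \<le> F R) \<le> bexp A p F / t"
proof -
  have "bprob A p (\<lambda>R. t \<le> F R) \<le> bexp A p (\<lambda>R. (1 / t) * F R)"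
    unfolding bprob_def by (rule bexp_mono) (use assms in \<open>auto simp: field_simps\<close>)
  then show ?thesis by (simp only: bexp_cmult) simp
qed

text \<open>A case of Harris's inequality: by \<open>bexp_superset\<close>, conditioning on
  \<open>B \<subseteq> R\<close> amounts to adding \<open>B\<close> to \<open>R\<close>, which can
  only destroy a decreasing event.\<close>

lemma bprob_superset_decreasing:
  assumes "finite A" "B \<subseteq> A" "0 \<le> p" "p \<le> 1"
    and "\<And>R R'. R \<subseteq> R' \<Longrightarrow> R' \<subseteq> A \<Longrightarrow> P R' \<Longrightarrow> P R"
  shows "bprob A p (\<lambda>R. B \<subseteq> R \<and> P R) \<le> p ^ card B * bprob A p P"
proof -
  have "bprob A p (\<lambda>R. B \<subseteq> R \<and> P R) = bexp A p (\<lambda>R. of_bool (B \<subseteq> R) * of_bool (P R))"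
    unfolding bprob_def by (rule bexp_cong) auto
  also have "\<dots> = p ^ card B * bexp A p (\<lambda>R. of_bool (P (R \<union> B)))"
    by (rule bexp_superset[OF assms(1,2)])
  also have "\<dots> \<le> p ^ card B * bprob A p P"
    unfolding bprob_def
  proof (intro mult_left_mono bexp_mono)
    fix R assume R: "R \<subseteq> A"
    have "P R" if "P (R \<union> B)" using assms(5)[of R "R \<union> B"] that R assms(2) by auto
    then show "of_bool (P (R \<union> B)) \<le> (of_bool (P R) :: real)" by auto
  qed (use assms in auto)
  finally show ?thesis .
qed

text \<open>Up to a null set, \<open>f\<close> is \<open>False\<close> off \<open>A\<close>, so it
  is determined by the set that it selects, and the product measure gives that set the weight used
  in \<open>bexp\<close>.\<close>

lemma bernoulli_subset_conv_bprob:
  assumes "finite A" "0 \<le> p" "p \<le> 1"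
  shows "measure_pmf.prob (map_pmf (\<lambda>f. {e \<in> A. f e}) (Pi_pmf A False (\<lambda>_. bernoulli_pmf p))) {R. P R}
    = bprob A p P"
proof -
  let ?M = "Pi_pmf A False (\<lambda>_. bernoulli_pmf p)"
  let ?S = "PiE_dflt A False (\<lambda>_. UNIV :: bool set)"
  let ?D = "map_pmf (\<lambda>f. {e \<in> A. f e}) ?M"
  have pmf: "pmf ?D R = p ^ card R * (1 - p) ^ card (A - R)" if "R \<subseteq> A" for R
  proof -
    have "pmf ?D R = measure_pmf.prob ?M ((\<lambda>f. {e \<in> A. f e}) -` {R})"
      by (simp add: pmf_map)
    also have "\<dots> = measure_pmf.prob ?M {\<lambda>e. e \<in> R}"
    proof (rule measure_pmf.finite_measure_eq_AE)
      show "AE f in ?M. (f \<in> (\<lambda>f. {e \<in> A. f e}) -` {R}) = (f \<in> {\<lambda>e. e \<in> R})"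
        unfolding AE_measure_pmf_iff
      proof
        fix f assume "f \<in> set_pmf ?M"
        then have "\<forall>e. e \<notin> A \<longrightarrow> \<not> f e"
          using set_Pi_pmf_subset[OF assms(1), of False "\<lambda>_. bernoulli_pmf p"] by auto
        then show "(f \<in> (\<lambda>f. {e \<in> A. f e}) -` {R}) = (f \<in> {\<lambda>e. e \<in> R})"
          using that by (auto simp: fun_eq_iff)
      qed
    qed auto
    also have "\<dots> = pmf ?M (\<lambda>e. e \<in> R)" by (simp add: measure_pmf_single)
    also have "\<dots> = (\<Prod>e\<in>A. pmf (bernoulli_pmf p) (e \<in> R))"
      using that by (subst pmf_Pi[OF assms(1)]) auto
    also have "\<dots> = (\<Prod>e\<in>R. p) * (\<Prod>e\<in>A-R. 1 - p)"
    proof -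
      have "(\<Prod>e\<in>A. pmf (bernoulli_pmf p) (e \<in> R)) = (\<Prod>e\<in>A. if e \<in> R then p else 1 - p)"
        by (rule prod.cong) (use assms in auto)
      also have "\<dots> = (\<Prod>e\<in>A \<inter> R. p) * (\<Prod>e\<in>A-R. 1 - p)"
        using prod.If_cases[OF assms(1), of "\<lambda>e. e \<in> R" "\<lambda>_. p" "\<lambda>_. 1 - p"]
        by (simp add: Diff_eq Collect_mem_eq)
      finally show ?thesis using that by (simp add: Int_absorb1)
    qed
    finally show ?thesis by simp
  qed
  have set: "set_pmf ?D \<subseteq> Pow A" by auto
  have "measure_pmf.prob ?D {R. P R} = measure_pmf.prob ?D {R \<in> Pow A. P R}"
    by (rule measure_pmf.finite_measure_eq_AE) (use set in \<open>auto simp: AE_measure_pmf_iff\<close>)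
  also have "\<dots> = (\<Sum>R\<in>{R \<in> Pow A. P R}. pmf ?D R)"
    by (rule measure_measure_pmf_finite) (use assms in auto)
  also have "\<dots> = (\<Sum>R\<in>{R \<in> Pow A. P R}. p ^ card R * (1 - p) ^ card (A - R))"
    by (rule sum.cong) (auto simp: pmf)
  also have "\<dots> = bprob A p P"
    unfolding bprob_def bexp_def
    by (rule sum.mono_neutral_cong_left) (use assms in auto)
  finally show ?thesis .
qed

text \<open>The integrand is \<open>1 - \<theta>\<close> to the number of indices whose set lies in
  \<open>R\<close>, which is what the Chernoff argument needs. Induction on \<open>D\<close>: when
  \<open>m\<close> is added, only the \<open>S a\<close> that meet \<open>S m\<close> depend on the
  event \<open>S m \<subseteq> R\<close>, and the price for them is \<theta> times their joint
  probabilities with \<open>S m\<close>. The double sum runs over ordered pairs and includes a =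
  b.\<close>

lemma janson_product:
  fixes S :: "'i \<Rightarrow> 'x set"
  assumes A: "finite A" and D: "finite D" and S: "\<And>a. a \<in> D \<Longrightarrow> S a \<subseteq> A"
    and p: "0 \<le> p" "p \<le> 1" and \<theta>: "0 \<le> \<theta>" "\<theta> \<le> 1"
  shows "bexp A p (\<lambda>R. \<Prod>a\<in>D. 1 - \<theta> * of_bool (S a \<subseteq> R))
    \<le> exp (- \<theta> * (\<Sum>a\<in>D. p ^ card (S a))
        + \<theta>^2 * (\<Sum>a\<in>D. \<Sum>b\<in>D. of_bool (S a \<inter> S b \<noteq> {}) * p ^ card (S a \<union> S b)))"
  using D S
proof (induction D)
  case empty
  then show ?case using A by (simp add: bexp_const)
next
  case (insert m D)
  define Z where "Z D' R = (\<Prod>a\<in>D'. 1 - \<theta> * of_bool (S a \<subseteq> R))" for D' and R :: "'x set"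
  define Nb where "Nb = {a \<in> D. S a \<inter> S m \<noteq> {}}"
  define No where "No = {a \<in> D. S a \<inter> S m = {}}"
  have D_eq: "D = Nb \<union> No" "Nb \<inter> No = {}" by (auto simp: Nb_def No_def)
  have fin: "finite Nb" "finite No" using insert.hyps by (auto simp: Nb_def No_def)
  have sub: "S a \<subseteq> A" if "a \<in> insert m D" for a using insert.prems that by auto
  have Z01: "0 \<le> Z D' R" "Z D' R \<le> 1" for D' R
    unfolding Z_def by (intro prod_nonneg prod_le_1; use \<theta> in \<open>auto simp: of_bool_def\<close>)+
  have Z_split: "Z D R = Z Nb R * Z No R" for R
    unfolding Z_def D_eq(1) by (rule prod.union_disjoint) (use fin D_eq in auto)
  have Z_anti: "Z D' R' \<le> Z D' R" if "R \<subseteq> R'" for D' R R'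
    unfolding Z_def by (intro prod_mono) (use that \<theta> in \<open>auto simp: of_bool_def\<close>)
  have Z_No: "Z No (R \<union> S m) = Z No R" for R
    unfolding Z_def by (rule prod.cong) (auto simp: No_def of_bool_def)
  define \<delta> where "\<delta> = (\<Sum>a\<in>Nb. p ^ card (S a \<union> S m))"
  have Z_Nb: "Z Nb R \<ge> 1 - \<theta> * (\<Sum>a\<in>Nb. of_bool (S a \<subseteq> R))" for R
    using Weierstrass_prod_ineq[of Nb "\<lambda>a. \<theta> * of_bool (S a \<subseteq> R)"] \<theta>
    by (auto simp: Z_def sum_distrib_left)
  \<comment> \<open>On the event \<open>S m \<subseteq> R\<close> the factors from \<open>No\<close>
    are unaffected, and Weierstrass's inequality bounds the product of the others from below by 1
    minus \<theta> times the number of \<open>a \<in> Nb\<close> with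
    \<open>S a \<subseteq> R\<close>. Each of these events is negatively correlated with the
    decreasing function \<open>Z No\<close>. A negative bracket makes the claim trivial.\<close>
  have key: "bexp A p (Z D) * (p ^ card (S m) - \<theta> * \<delta>)
      \<le> bexp A p (\<lambda>R. of_bool (S m \<subseteq> R) * Z D R)"
  proof (cases "p ^ card (S m) - \<theta> * \<delta> \<ge> 0")
    case True
    have "bexp A p (Z D) \<le> bexp A p (Z No)"
      by (rule bexp_mono) (use p Z01 in \<open>auto simp: Z_split intro: mult_left_le_one_le\<close>)
    then have "bexp A p (Z D) * (p ^ card (S m) - \<theta> * \<delta>)
        \<le> bexp A p (Z No) * (p ^ card (S m) - \<theta> * \<delta>)"
      using True by (rule mult_right_mono)
    also have "\<dots> = p ^ card (S m) * (bexp A p (Z No)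
        - \<theta> * (\<Sum>a\<in>Nb. p ^ card (S a - S m) * bexp A p (Z No)))"
    proof -
      have "p ^ card (S m) * p ^ card (S a - S m) = p ^ card (S a \<union> S m)" if "a \<in> Nb" for a
      proof -
        have f: "finite (S a)" "finite (S m)" using sub[of a] sub[of m] that A
          by (auto simp: Nb_def intro: finite_subset)
        have "card (S a \<union> S m) = card (S m) + card (S a - S m)"
          using f card_Un_disjoint[of "S m" "S a - S m"] by (simp add: Un_commute)
        then show ?thesis by (simp add: power_add)
      qed
      then have "\<delta> = (\<Sum>a\<in>Nb. p ^ card (S m) * p ^ card (S a - S m))"
        by (simp add: \<delta>_def)
      then show ?thesis
        by (simp add: algebra_simps sum_distrib_left sum_distrib_right)
    qed
    also have "\<dots> \<le> p ^ card (S m) * (bexp A p (Z No)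
        - \<theta> * (\<Sum>a\<in>Nb. bexp A p (\<lambda>R. of_bool (S a \<subseteq> R \<union> S m) * Z No R)))"
    proof -
      have "bexp A p (\<lambda>R. of_bool (S a \<subseteq> R \<union> S m) * Z No R)
          \<le> p ^ card (S a - S m) * bexp A p (Z No)" if "a \<in> Nb" for a
      proof -
        have "bexp A p (\<lambda>R. of_bool (S a \<subseteq> R \<union> S m) * Z No R)
            = bexp A p (\<lambda>R. of_bool (S a - S m \<subseteq> R) * Z No R)"
          by (rule bexp_cong) (auto simp: of_bool_def)
        also have "\<dots> = p ^ card (S a - S m) * bexp A p (\<lambda>R. Z No (R \<union> (S a - S m)))"
          by (rule bexp_superset) (use A sub[of a] that in \<open>auto simp: Nb_def\<close>)
        also have "\<dots> \<le> p ^ card (S a - S m) * bexp A p (Z No)"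
          by (intro mult_left_mono bexp_mono Z_anti) (use p in auto)
        finally show ?thesis .
      qed
      then show ?thesis
        by (intro mult_left_mono diff_left_mono sum_mono) (use p \<theta> in auto)
    qed
    also have "\<dots> = p ^ card (S m) * bexp A p (\<lambda>R.
        (1 - \<theta> * (\<Sum>a\<in>Nb. of_bool (S a \<subseteq> R \<union> S m))) * Z No R)"
      by (simp add: bexp_sum[symmetric] bexp_cmult[symmetric] bexp_diff[symmetric]
          sum_distrib_right sum_distrib_left algebra_simps)
    also have "\<dots> \<le> p ^ card (S m) * bexp A p (\<lambda>R. Z D (R \<union> S m))"
      unfolding Z_split Z_No
      by (intro mult_left_mono bexp_mono mult_right_mono Z_Nb) (use p Z01 in auto)
    also have "\<dots> = bexp A p (\<lambda>R. of_bool (S m \<subseteq> R) * Z D R)"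
      by (rule bexp_superset[symmetric]) (use A sub in auto)
    finally show ?thesis .
  next
    case False
    have "bexp A p (Z D) * (p ^ card (S m) - \<theta> * \<delta>) \<le> 0"
      using False bexp_nonneg[OF p, of A "Z D"] Z01 by (intro mult_nonneg_nonpos) auto
    also have "\<dots> \<le> bexp A p (\<lambda>R. of_bool (S m \<subseteq> R) * Z D R)"
      by (rule bexp_nonneg) (use p Z01 in auto)
    finally show ?thesis .
  qed
  have nn: "0 \<le> bexp A p (Z D)" by (intro bexp_nonneg p Z01)
  have "bexp A p (Z (insert m D)) = bexp A p (Z D) - \<theta> * bexp A p (\<lambda>R. of_bool (S m \<subseteq> R) * Z D R)"
    using insert.hyps
    by (simp add: Z_def[abs_def] bexp_cmult[symmetric] bexp_diff[symmetric] algebra_simps)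
  also have "\<dots> \<le> bexp A p (Z D) - \<theta> * (bexp A p (Z D) * (p ^ card (S m) - \<theta> * \<delta>))"
    using key \<theta> by (intro diff_left_mono mult_left_mono) auto
  also have "\<dots> = bexp A p (Z D) * (1 + (- \<theta> * p ^ card (S m) + \<theta>^2 * \<delta>))"
    by (simp add: algebra_simps power2_eq_square)
  also have "\<dots> \<le> bexp A p (Z D) * exp (- \<theta> * p ^ card (S m) + \<theta>^2 * \<delta>)"
    using nn by (intro mult_left_mono exp_ge_add_one_self) auto
  also have "\<dots> \<le> exp (- \<theta> * (\<Sum>a\<in>D. p ^ card (S a))
        + \<theta>^2 * (\<Sum>a\<in>D. \<Sum>b\<in>D. of_bool (S a \<inter> S b \<noteq> {}) * p ^ card (S a \<union> S b)))
      * exp (- \<theta> * p ^ card (S m) + \<theta>^2 * \<delta>)"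
    using insert.IH sub by (intro mult_right_mono) (auto simp: Z_def[abs_def])
  also have "\<dots> = exp (- \<theta> * (\<Sum>a\<in>insert m D. p ^ card (S a))
      + \<theta>^2 * ((\<Sum>a\<in>D. \<Sum>b\<in>D. of_bool (S a \<inter> S b \<noteq> {}) * p ^ card (S a \<union> S b)) + \<delta>))"
    using insert.hyps by (simp add: exp_add[symmetric] algebra_simps)
  also have "\<dots> \<le> exp (- \<theta> * (\<Sum>a\<in>insert m D. p ^ card (S a))
      + \<theta>^2 * (\<Sum>a\<in>insert m D. \<Sum>b\<in>insert m D. of_bool (S a \<inter> S b \<noteq> {}) * p ^ card (S a \<union> S b)))"
  proof -
    define f where "f a b = of_bool (S a \<inter> S b \<noteq> {}) * p ^ card (S a \<union> S b)" for a b
    have f0: "0 \<le> f a b" for a b using p by (simp add: f_def)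
    have "\<delta> = (\<Sum>a\<in>D. f a m)"
      unfolding \<delta>_def Nb_def f_def using insert.hyps by (intro sum.mono_neutral_cong_left) auto
    moreover have "(\<Sum>a\<in>insert m D. \<Sum>b\<in>insert m D. f a b)
        = (\<Sum>a\<in>D. \<Sum>b\<in>D. f a b) + (\<Sum>a\<in>D. f a m) + (f m m + (\<Sum>b\<in>D. f m b))"
      using insert.hyps by (simp add: sum.distrib)
    ultimately have "(\<Sum>a\<in>D. \<Sum>b\<in>D. f a b) + \<delta> \<le> (\<Sum>a\<in>insert m D. \<Sum>b\<in>insert m D. f a b)"
      using f0 by (simp add: sum_nonneg add_nonneg_nonneg)
    then show ?thesis
      unfolding f_def by (intro iffD2[OF exp_le_cancel_iff] add_left_mono mult_left_mono) auto
  qed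
  finally show ?case by (simp add: Z_def[abs_def])
qed

text \<open>Markov's inequality applied to \<open>janson_product\<close>. The exponent becomes at
  most - \<theta> t + 3 \<theta>^2 Q: one Q bounds the overlap sum, and 2 Q come from the quadratic
  term in the estimate of ln (1 - \<theta>) together with \<mu> \<le> Q.\<close>

lemma janson_lower_tail:
  fixes S :: "'i \<Rightarrow> 'x set"
  assumes A: "finite A" and D: "finite D" and S: "\<And>a. a \<in> D \<Longrightarrow> S a \<subseteq> A \<and> S a \<noteq> {}"
    and p: "0 \<le> p" "p \<le> 1"
    and Q: "(\<Sum>a\<in>D. \<Sum>b\<in>D. of_bool (S a \<inter> S b \<noteq> {}) * p ^ card (S a \<union> S b)) \<le> Q" "0 < Q"
    and t: "0 \<le> t" "t \<le> 3 * Q"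
  shows "bprob A p (\<lambda>R. real (card {a \<in> D. S a \<subseteq> R}) \<le> (\<Sum>a\<in>D. p ^ card (S a)) - t)
    \<le> exp (- (t^2 / (12 * Q)))"
proof -
  define \<mu> where "\<mu> = (\<Sum>a\<in>D. p ^ card (S a))"
  \<comment> \<open>The minimiser of - \<theta> t + 3 \<theta>^2 Q. The hypothesis
    \<open>t \<le> 3 * Q\<close> makes it at most 1/2, the range of the logarithm estimate.\<close>
  define \<theta> where "\<theta> = t / (6 * Q)"
  have \<theta>: "0 \<le> \<theta>" "\<theta> \<le> 1/2" using t Q by (auto simp: \<theta>_def field_simps)
  \<comment> \<open>The diagonal pairs alone contribute \<mu>, since each \<open>S a\<close> is
    nonempty and thus meets itself.\<close>
  have "\<mu> \<le> (\<Sum>a\<in>D. \<Sum>b\<in>D. of_bool (S a \<inter> S b \<noteq> {}) * p ^ card (S a \<union> S b))"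
    unfolding \<mu>_def
  proof (rule sum_mono)
    fix a assume a: "a \<in> D"
    have "p ^ card (S a) = of_bool (S a \<inter> S a \<noteq> {}) * p ^ card (S a \<union> S a)"
      using S[OF a] by simp
    also have "\<dots> \<le> (\<Sum>b\<in>D. of_bool (S a \<inter> S b \<noteq> {}) * p ^ card (S a \<union> S b))"
      by (rule member_le_sum[OF a]) (use p D in auto)
    finally show "p ^ card (S a) \<le> (\<Sum>b\<in>D. of_bool (S a \<inter> S b \<noteq> {}) * p ^ card (S a \<union> S b))" .
  qed
  then have \<mu>Q: "\<mu> \<le> Q" using Q by simp
  let ?X = "\<lambda>R. real (card {a \<in> D. S a \<subseteq> R})"
  have Zeq: "(\<Prod>a\<in>D. 1 - \<theta> * of_bool (S a \<subseteq> R)) = (1 - \<theta>) ^ card {a \<in> D. S a \<subseteq> R}" for R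
  proof -
    have "(\<Prod>a\<in>D. 1 - \<theta> * of_bool (S a \<subseteq> R)) = (\<Prod>a\<in>D. if S a \<subseteq> R then 1 - \<theta> else 1)"
      by (rule prod.cong) auto
    also have "\<dots> = (1 - \<theta>) ^ card {a \<in> D. S a \<subseteq> R}"
      using D by (simp add: prod.If_cases Int_def)
    finally show ?thesis .
  qed
  let ?c = "exp (- (\<theta> + 2 * \<theta>^2) * (\<mu> - t))"
  have lb: "?c * of_bool (?X R \<le> \<mu> - t) \<le> (\<Prod>a\<in>D. 1 - \<theta> * of_bool (S a \<subseteq> R))" for R
  proof (cases "?X R \<le> \<mu> - t")
    case True
    have "?c \<le> exp (- (\<theta> + 2 * \<theta>^2) * ?X R)"
      using True \<theta> by (intro iffD2[OF exp_le_cancel_iff] mult_left_mono_neg)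
          (auto intro: order_trans[of _ 0])
    also have "\<dots> = exp (- (\<theta> + 2 * \<theta>^2)) ^ card {a \<in> D. S a \<subseteq> R}"
      by (simp add: exp_of_nat_mult[symmetric] mult.commute)
    also have "\<dots> \<le> (1 - \<theta>) ^ card {a \<in> D. S a \<subseteq> R}"
    proof (rule power_mono)
      have "ln (1 - \<theta>) \<ge> - \<theta> - 2 * \<theta>^2"
        using ln_one_minus_pos_lower_bound \<theta> by simp
      then show "exp (- (\<theta> + 2 * \<theta>^2)) \<le> 1 - \<theta>"
        using \<theta> by (subst (asm) ln_ge_iff) (auto simp: algebra_simps)
    qed simp
    finally show ?thesis using True by (simp add: Zeq)
  next
    case False
    have "0 \<le> (1 - \<theta>) ^ card {a \<in> D. S a \<subseteq> R}" using \<theta> by simp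
    then show ?thesis using False by (simp add: Zeq)
  qed
  have "?c * bprob A p (\<lambda>R. ?X R \<le> \<mu> - t) = bexp A p (\<lambda>R. ?c * of_bool (?X R \<le> \<mu> - t))"
    by (simp only: bprob_def bexp_cmult)
  also have "\<dots> \<le> bexp A p (\<lambda>R. \<Prod>a\<in>D. 1 - \<theta> * of_bool (S a \<subseteq> R))"
    by (rule bexp_mono) (use p lb in auto)
  also have "\<dots> \<le> exp (- \<theta> * \<mu>
        + \<theta>^2 * (\<Sum>a\<in>D. \<Sum>b\<in>D. of_bool (S a \<inter> S b \<noteq> {}) * p ^ card (S a \<union> S b)))"
    unfolding \<mu>_def by (rule janson_product) (use A D S p \<theta> in auto)
  also have "\<dots> \<le> exp (- \<theta> * \<mu> + \<theta>^2 * Q)"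
    using Q by (simp add: mult_left_mono)
  finally have "bprob A p (\<lambda>R. ?X R \<le> \<mu> - t) \<le> exp (- \<theta> * \<mu> + \<theta>^2 * Q) / ?c"
    by (simp add: field_simps)
  also have "\<dots> = exp (- \<theta> * t + \<theta>^2 * (Q + 2 * (\<mu> - t)))"
    by (simp add: exp_diff[symmetric] algebra_simps)
  also have "\<dots> \<le> exp (- \<theta> * t + \<theta>^2 * (3 * Q))"
    using \<mu>Q t by (simp add: mult_left_mono)
  also have "- \<theta> * t + \<theta>^2 * (3 * Q) = - (t^2 / (12 * Q))"
    using Q by (simp add: \<theta>_def field_simps power2_eq_square)
  finally show ?thesis by (simp add: \<mu>_def)
qed

section \<open>Hypergraph containers\<close>

text \<open>
  The fingerprint \<open>fp I\<close> and the container \<open>ct I\<close> do not change when \<open>I\<close> is replaced by anything between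
  \<open>fp I\<close> and \<open>I\<close>. In particular, the container of a set depends only on its fingerprint, and schemes can be composed.
\<close>

definition container_fns ::
    "'x set \<Rightarrow> ('x set \<Rightarrow> bool) \<Rightarrow> real \<Rightarrow> real \<Rightarrow> ('x set \<Rightarrow> 'x set) \<Rightarrow> ('x set \<Rightarrow> 'x set) \<Rightarrow> bool" where
  "container_fns X P s m fp ct \<longleftrightarrow>
     (\<forall>I I'. fp I \<subseteq> I' \<and> I' \<subseteq> I \<longrightarrow> fp I' = fp I \<and> ct I' = ct I) \<and>
     (\<forall>I. I \<subseteq> X \<and> P I \<longrightarrow> fp I \<subseteq> I \<and> real (card (fp I)) \<le> s \<and>
        I \<subseteq> ct I \<and> ct I \<subseteq> X \<and> real (card (ct I)) \<le> m)"

definition container_scheme :: "'x set \<Rightarrow> ('x set \<Rightarrow> bool) \<Rightarrow> real \<Rightarrow> real \<Rightarrow> bool" where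
  "container_scheme X P s m \<longleftrightarrow> (\<exists>fp ct. container_fns X P s m fp ct)"

lemma container_fnsD:
  assumes "container_fns X P s m fp ct"
  shows "fp I \<subseteq> I' \<Longrightarrow> I' \<subseteq> I \<Longrightarrow> fp I' = fp I" "fp I \<subseteq> I' \<Longrightarrow> I' \<subseteq> I \<Longrightarrow> ct I' = ct I"
    and "I \<subseteq> X \<Longrightarrow> P I \<Longrightarrow> fp I \<subseteq> I" "I \<subseteq> X \<Longrightarrow> P I \<Longrightarrow> real (card (fp I)) \<le> s"
    and "I \<subseteq> X \<Longrightarrow> P I \<Longrightarrow> I \<subseteq> ct I" "I \<subseteq> X \<Longrightarrow> P I \<Longrightarrow> ct I \<subseteq> X"
    and "I \<subseteq> X \<Longrightarrow> P I \<Longrightarrow> real (card (ct I)) \<le> m"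
  using assms by (simp_all add: container_fns_def)

lemma container_schemeI:
  assumes "\<And>I I'. fp I \<subseteq> I' \<Longrightarrow> I' \<subseteq> I \<Longrightarrow> fp I' = fp I \<and> ct I' = ct I"
    and "\<And>I. I \<subseteq> X \<Longrightarrow> P I \<Longrightarrow> fp I \<subseteq> I \<and> real (card (fp I)) \<le> s \<and>
        I \<subseteq> ct I \<and> ct I \<subseteq> X \<and> real (card (ct I)) \<le> m"
  shows "container_scheme X P s m"
proof -
  have "container_fns X P s m fp ct"
    unfolding container_fns_def using assms by simp
  then show ?thesis unfolding container_scheme_def by (intro exI)
qed

lemma container_scheme_trivial:
  assumes "real (card X) \<le> m" "0 \<le> s"
  shows "container_scheme X P s m"
  by (rule container_schemeI[of "\<lambda>_. {}" "\<lambda>_. X"]) (use assms in auto)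

lemma container_scheme_mono:
  assumes "container_scheme X P s m"
    and "\<And>I. I \<subseteq> X \<Longrightarrow> P' I \<Longrightarrow> P I" "s \<le> s'" "m \<le> m'"
  shows "container_scheme X P' s' m'"
proof -
  obtain fp ct where "container_fns X P s m fp ct"
    using assms(1) unfolding container_scheme_def by (elim exE)
  note D = container_fnsD[OF this]
  show ?thesis
  proof (rule container_schemeI[of fp ct])
    fix I assume "I \<subseteq> X" "P' I"
    then show "fp I \<subseteq> I \<and> real (card (fp I)) \<le> s' \<and> I \<subseteq> ct I \<and> ct I \<subseteq> X \<and> real (card (ct I)) \<le> m'"
      using D(3-7)[of I] assms(2)[of I] assms(3,4) by simp
  qed (use D(1,2) in simp)
qed

text \<open>The second scheme runs inside the container given by the first. The union of the two
  fingerprints still determines everything: any set between it and \<open>I\<close> has the same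
  first container by invariance, hence is treated by the same second scheme.\<close>

lemma container_scheme_bind:
  assumes "container_scheme X P s m"
    and "\<And>E. E \<subseteq> X \<Longrightarrow> real (card E) \<le> m \<Longrightarrow> container_scheme E P s' m'"
  shows "container_scheme X P (s + s') m'"
proof -
  obtain fp ct where "container_fns X P s m fp ct"
    using assms(1) unfolding container_scheme_def by (elim exE)
  note D = container_fnsD[OF this]
  \<comment> \<open>The side conditions on \<open>E\<close> are moved into the property, so that a
    set which cannot be a first container has a vacuous scheme and choice functions exist for all
    \<open>E\<close>.\<close>
  have "\<exists>fp ct. container_fns E (\<lambda>I. P I \<and> E \<subseteq> X \<and> real (card E) \<le> m) s' m' fp ct" for E
  proof (cases "E \<subseteq> X \<and> real (card E) \<le> m")
    case True
    then show ?thesis using assms(2)[of E] by (simp add: container_scheme_def)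
  next
    case False
    show ?thesis
      by (rule exI[of _ "\<lambda>_. {}"], rule exI[of _ "\<lambda>_. {}"]) (use False in \<open>auto simp: container_fns_def\<close>)
  qed
  then obtain FP CT where
    "\<And>E. container_fns E (\<lambda>I. P I \<and> E \<subseteq> X \<and> real (card E) \<le> m) s' m' (FP E) (CT E)"
    by metis
  note E = container_fnsD[OF this]
  show ?thesis
  proof (rule container_schemeI[of "\<lambda>I. fp I \<union> FP (ct I) I" "\<lambda>I. CT (ct I) I"])
    fix I I' assume "fp I \<union> FP (ct I) I \<subseteq> I'" "I' \<subseteq> I"
    then have a: "fp I' = fp I" "ct I' = ct I" and b: "FP (ct I) I \<subseteq> I'" "I' \<subseteq> I"
      using D(1,2)[of I I'] by auto
    show "fp I' \<union> FP (ct I') I' = fp I \<union> FP (ct I) I \<and> CT (ct I') I' = CT (ct I) I"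
      using E(1,2)[of "ct I" I I', OF b] a by simp
  next
    fix I assume I: "I \<subseteq> X" "P I"
    note i = D(3-7)[OF I]
    have P: "P I \<and> ct I \<subseteq> X \<and> real (card (ct I)) \<le> m" using I i by simp
    note ii = E(3-7)[OF i(3) P]
    have "real (card (fp I \<union> FP (ct I) I)) \<le> s + s'"
      using card_Un_le[of "fp I" "FP (ct I) I"] i(2) ii(2) by linarith
    then show "fp I \<union> FP (ct I) I \<subseteq> I \<and> real (card (fp I \<union> FP (ct I) I)) \<le> s + s' \<and>
      I \<subseteq> CT (ct I) I \<and> CT (ct I) I \<subseteq> X \<and> real (card (CT (ct I) I)) \<le> m'"
      using i(1,4) ii(1,3,4,5) by auto
  qed
qed

text \<open>The minimum with respect to an arbitrary numbering of \<open>H\<close>. A minimum stays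
  the same when the set shrinks but keeps it; this stability gives the invariance of fingerprints
  under removal of other elements.\<close>

lemma finite_selector:
  assumes "finite H"
  obtains first :: "'x set \<Rightarrow> 'x"
  where "\<And>Z. Z \<subseteq> H \<Longrightarrow> Z \<noteq> {} \<Longrightarrow> first Z \<in> Z"
    and "\<And>Z Z'. Z \<subseteq> H \<Longrightarrow> Z' \<subseteq> Z \<Longrightarrow> first Z \<in> Z' \<Longrightarrow> first Z' = first Z"
proof -
  obtain f :: "'x \<Rightarrow> nat" where f: "inj_on f H"
    using finite_imp_inj_to_nat_seg[OF assms] by auto
  define first where "first Z = inv_into H f (Min (f ` Z))" for Z
  have 1: "first Z \<in> Z \<and> f (first Z) = Min (f ` Z)" if "Z \<subseteq> H" "Z \<noteq> {}" for Z
  proof -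
    have "Min (f ` Z) \<in> f ` Z"
      using that finite_subset[OF that(1) assms] by (intro Min_in) auto
    then obtain z where "z \<in> Z" "Min (f ` Z) = f z" by auto
    then show ?thesis using f that by (auto simp: first_def)
  qed
  show thesis
  proof (rule that)
    fix Z Z' assume *: "Z \<subseteq> H" "Z' \<subseteq> Z" "first Z \<in> Z'"
    then have ne: "Z \<noteq> {}" "Z' \<noteq> {}" "Z' \<subseteq> H" by auto
    have fin: "finite Z" "finite Z'" using * ne assms finite_subset by blast+
    have "Min (f ` Z') \<le> f (first Z)" using * fin by auto
    moreover have "Min (f ` Z) \<le> Min (f ` Z')" using * ne fin by (intro Min_antimono) auto
    ultimately have "f (first Z') = f (first Z)" using 1[OF *(1) ne(1)] 1[OF ne(3,2)] by auto
    then show "first Z' = first Z"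
      using inj_onD[OF f] 1[OF *(1) ne(1)] 1[OF ne(3,2)] *(1) ne(3) by blast
  qed (use 1 in auto)
qed

text \<open>If \<open>I\<close> misses \<open>H\<close>, the container is \<open>X - H\<close> and
  nothing is recorded. Otherwise the first element of \<open>I \<inter> H\<close> is recorded, at
  the price of 1, and the scheme for that element takes over. A set between the fingerprint and
  \<open>I\<close> contains the recorded element and, by stability of the selector, selects it
  again.\<close>

lemma container_scheme_branch:
  assumes "finite H" "H \<subseteq> X" "real (card (X - H)) \<le> m" "0 \<le> s"
    and "\<And>v. v \<in> H \<Longrightarrow> container_scheme X (\<lambda>I. P I \<and> v \<in> I) s m"
  shows "container_scheme X P (s + 1) m"
proof -
  obtain first where
    f1: "\<And>Z. Z \<subseteq> H \<Longrightarrow> Z \<noteq> {} \<Longrightarrow> first Z \<in> Z" and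
    f2: "\<And>Z Z'. Z \<subseteq> H \<Longrightarrow> Z' \<subseteq> Z \<Longrightarrow> first Z \<in> Z' \<Longrightarrow> first Z' = first Z"
    using finite_selector[OF assms(1)] by metis
  have "\<forall>v\<in>H. \<exists>fp ct. container_fns X (\<lambda>I. P I \<and> v \<in> I) s m fp ct"
    using assms(5) by (simp add: container_scheme_def)
  then obtain FP CT where
    "\<And>v. v \<in> H \<Longrightarrow> container_fns X (\<lambda>I. P I \<and> v \<in> I) s m (FP v) (CT v)"
    by metis
  note E = container_fnsD[OF this]
  define fp where "fp I = (if I \<inter> H = {} then {} else
    insert (first (I \<inter> H)) (FP (first (I \<inter> H)) I))" for I
  define ct where "ct I = (if I \<inter> H = {} then X - H else CT (first (I \<inter> H)) I)" for I
  show ?thesis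
  proof (rule container_schemeI[of fp ct])
    fix I I' assume *: "fp I \<subseteq> I'" "I' \<subseteq> I"
    show "fp I' = fp I \<and> ct I' = ct I"
    proof (cases "I \<inter> H = {}")
      case True
      then have "I' \<inter> H = {}" using * by auto
      then show ?thesis using True by (simp add: fp_def ct_def)
    next
      case False
      have v: "first (I \<inter> H) \<in> I \<inter> H" using f1[of "I \<inter> H"] False by blast
      then have v': "first (I \<inter> H) \<in> I' \<inter> H" using * False by (auto simp: fp_def)
      then have eq: "first (I' \<inter> H) = first (I \<inter> H)" using * by (intro f2) auto
      have "FP (first (I \<inter> H)) I \<subseteq> I'" using * False by (auto simp: fp_def)
      then have "FP (first (I \<inter> H)) I' = FP (first (I \<inter> H)) I"
          "CT (first (I \<inter> H)) I' = CT (first (I \<inter> H)) I"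
        using E(1,2)[of "first (I \<inter> H)" I I'] v * by auto
      moreover have "I' \<inter> H \<noteq> {}" using v' by auto
      ultimately show ?thesis using False eq by (simp add: fp_def ct_def)
    qed
  next
    fix I assume I: "I \<subseteq> X" "P I"
    show "fp I \<subseteq> I \<and> real (card (fp I)) \<le> s + 1 \<and> I \<subseteq> ct I \<and> ct I \<subseteq> X \<and> real (card (ct I)) \<le> m"
    proof (cases "I \<inter> H = {}")
      case True
      then show ?thesis using I assms by (auto simp: fp_def ct_def)
    next
      case False
      define v where "v = first (I \<inter> H)"
      have v: "v \<in> I \<inter> H" using f1[of "I \<inter> H"] False unfolding v_def by blast
      have "v \<in> H" "P I \<and> v \<in> I" using v I by auto
      note ii = E(3-7)[OF this(1) I(1) this(2)]
      have "real (card (insert v (FP v I))) \<le> real (card (FP v I)) + 1"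
        by (cases "finite (FP v I)") (auto simp: card_insert_if)
      then show ?thesis using v ii False by (auto simp: fp_def ct_def v_def[symmetric])
    qed
  qed
qed

text \<open>The weighted degree of a set in a hypergraph on \<open>X\<close> with edge weights
  \<open>w\<close>; for the empty set it is the total weight. Weights take the place of edge
  multiplicities when links of several vertices are added up.\<close>

definition wdeg :: "'x set \<Rightarrow> ('x set \<Rightarrow> real) \<Rightarrow> 'x set \<Rightarrow> real" where
  "wdeg X w A = (\<Sum>E\<in>Pow X. of_bool (A \<subseteq> E) * w E)"

lemma wdeg_mono: "(\<And>E. w E \<le> w' E) \<Longrightarrow> wdeg X w A \<le> wdeg X w' A"
  unfolding wdeg_def by (intro sum_mono mult_left_mono) auto

lemma wdeg_nonneg: "(\<And>E. 0 \<le> w E) \<Longrightarrow> 0 \<le> wdeg X w A"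
  unfolding wdeg_def by (intro sum_nonneg) auto

lemma wdeg_add: "wdeg X (\<lambda>E. w E + w' E) A = wdeg X w A + wdeg X w' A"
  by (simp add: wdeg_def algebra_simps sum.distrib)

lemma sum_wdeg_singletons:
  assumes "finite X"
  shows "(\<Sum>v\<in>X. wdeg X w {v}) = (\<Sum>E\<in>Pow X. real (card E) * w E)"
proof -
  have "(\<Sum>v\<in>X. wdeg X w {v}) = (\<Sum>E\<in>Pow X. \<Sum>v\<in>X. of_bool (v \<in> E) * w E)"
    unfolding wdeg_def by (subst sum.swap) simp
  also have "\<dots> = (\<Sum>E\<in>Pow X. real (card E) * w E)"
  proof (rule sum.cong[OF refl])
    fix E assume E: "E \<in> Pow X"
    have "(\<Sum>v\<in>X. of_bool (v \<in> E) * w E) = (\<Sum>v\<in>X. of_bool (v \<in> E)) * w E"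
      by (simp only: sum_distrib_right)
    also have "(\<Sum>v\<in>X. of_bool (v \<in> E) :: real) = real (card E)"
      using assms E by (simp add: Int_absorb1 Int_def[symmetric] Collect_conj_eq)
    finally show "(\<Sum>v\<in>X. of_bool (v \<in> E) * w E) = real (card E) * w E" .
  qed
  finally show ?thesis .
qed

text \<open>An edge of size \<open>k\<close> is counted once for each of its \<open>2 ^ k\<close>
  subsets. This limits how many sets can have large degree.\<close>

lemma sum_wdeg:
  assumes "finite X" and "\<And>E. w E \<noteq> 0 \<Longrightarrow> card E = k"
  shows "(\<Sum>A\<in>Pow X. wdeg X w A) = 2 ^ k * wdeg X w {}"
proof -
  have "(\<Sum>A\<in>Pow X. wdeg X w A) = (\<Sum>E\<in>Pow X. \<Sum>A\<in>Pow X. of_bool (A \<subseteq> E) * w E)"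
    unfolding wdeg_def by (rule sum.swap)
  also have "\<dots> = (\<Sum>E\<in>Pow X. 2 ^ k * w E)"
  proof (rule sum.cong[OF refl])
    fix E assume E: "E \<in> Pow X"
    have "(\<Sum>A\<in>Pow X. of_bool (A \<subseteq> E) * w E) = (\<Sum>A\<in>Pow X. of_bool (A \<subseteq> E)) * w E"
      by (simp only: sum_distrib_right)
    also have "(\<Sum>A\<in>Pow X. of_bool (A \<subseteq> E) :: real) = (\<Sum>A\<in>Pow E. 1)"
      by (rule sum.mono_neutral_cong_right) (use E assms in auto)
    also have "\<dots> = 2 ^ card E"
      using finite_subset[of E X] E assms(1) by (simp add: card_Pow)
    finally show "(\<Sum>A\<in>Pow X. of_bool (A \<subseteq> E) * w E) = 2 ^ k * w E"
      using assms(2)[of E] by (cases "w E = 0") auto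
  qed
  finally show ?thesis by (simp add: wdeg_def sum_distrib_left)
qed

lemma wdeg_link:
  assumes "finite X" "v \<in> X"
  shows "wdeg X (\<lambda>E. of_bool (v \<notin> E) * w (insert v E)) A = of_bool (v \<notin> A) * wdeg X w (insert v A)"
proof (cases "v \<in> A")
  case True
  then show ?thesis by (auto simp: wdeg_def intro!: sum.neutral)
next
  case False
  have "wdeg X (\<lambda>E. of_bool (v \<notin> E) * w (insert v E)) A
      = (\<Sum>E\<in>{E \<in> Pow X. v \<notin> E \<and> A \<subseteq> E}. w (insert v E))"
    unfolding wdeg_def by (rule sum.mono_neutral_cong_right) (use assms in auto)
  also have "\<dots> = (\<Sum>E\<in>{E \<in> Pow X. insert v A \<subseteq> E}. w E)"
    by (rule sum.reindex_bij_witness[of _ "\<lambda>E. E - {v}" "insert v"])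
      (use assms False in \<open>auto simp: insert_absorb\<close>)
  also have "\<dots> = wdeg X w (insert v A)"
    unfolding wdeg_def by (rule sum.mono_neutral_cong_left) (use assms in auto)
  finally show ?thesis using False by simp
qed

text \<open>
  The argument of Nenadov and Pham: starting from a weighted \<open>j\<close>-uniform hypergraph, repeatedly pick
  a vertex of high degree from the independent set and add its link to a hypergraph of uniformity
  \<open>j - 1\<close>, ignoring the edges that contain a set whose degree in the new hypergraph has become large.
  If no vertex of high degree is left, then the vertices of low degree form the container; otherwise
  the new hypergraph satisfies the same hypotheses up to constants.
\<close>

lemma hypergraph_container:
  fixes j :: nat and d :: real
  assumes "0 < d"
  shows "\<exists>C>0. \<exists>c>0. \<forall>(X :: 'x set) w \<tau> N b.
    finite X \<longrightarrow> real (card X) \<le> N \<longrightarrow> 0 < \<tau> \<longrightarrow> 1 \<le> \<tau> * N \<longrightarrow> 0 < b \<longrightarrow>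
    (\<forall>E. 0 \<le> w E) \<longrightarrow> (\<forall>E. w E \<noteq> 0 \<longrightarrow> card E = j) \<longrightarrow>
    (\<forall>A. A \<subseteq> X \<and> A \<noteq> {} \<longrightarrow> wdeg X w A \<le> b * \<tau> ^ (card A - 1)) \<longrightarrow>
    d * N * b \<le> wdeg X w {} \<longrightarrow>
    container_scheme X (\<lambda>I. \<forall>E. E \<subseteq> I \<longrightarrow> w E = 0) (C * \<tau> * N) (real (card X) - c * N)"
  using assms
proof (induction j arbitrary: d)
  case 0
  show ?case
  proof (intro exI[of _ 1] conjI allI impI)
    fix X :: "'x set" and w \<tau> N b
    assume *: "finite X" "(0::real) < \<tau>" "1 \<le> \<tau> * N" "0 < b" "\<forall>E. 0 \<le> w E" "\<forall>E. w E \<noteq> 0 \<longrightarrow> card E = 0"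
      "d * N * b \<le> wdeg X w {}"
    have "0 < N"
      using *(2,3) by (smt (verit) mult_nonneg_nonpos)
    then have "0 < wdeg X w {}" using * \<open>0 < d\<close>
      by (smt (verit) mult_pos_pos)
    moreover have "wdeg X w {} = (\<Sum>E\<in>{{}}. w E)"
      unfolding wdeg_def using * finite_subset[of _ X]
      by (intro sum.mono_neutral_cong_right) fastforce+
    ultimately have "w {} \<noteq> 0" by auto
    \<comment> \<open>The empty edge has positive weight and lies in every \<open>I\<close>, so no
      set has the property and the scheme has nothing to contain.\<close>
    then show "container_scheme X (\<lambda>I. \<forall>E. E \<subseteq> I \<longrightarrow> w E = 0) (1 * \<tau> * N) (real (card X) - 1 * N)"
      by (intro container_schemeI[of "\<lambda>_. {}" "\<lambda>_. {}"]) auto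
  qed auto
next
  case (Suc k)
  \<comment> \<open>\<open>\<beta> * b\<close> is the degree from which a vertex counts as high.
    \<open>M\<close> is the saturation factor, chosen so that ignoring the edges through saturated
    sets loses at most half of the weight \<open>d * N * b\<close>.\<close>
  define \<beta> where "\<beta> = d / 4"
  define M where "M = 2 ^ (k + 2) / d"
  have pos: "0 < \<beta>" "0 < M" using Suc.prems by (auto simp: \<beta>_def M_def)
  obtain C' c' where C': "0 < C'" "0 < c'" and IH: "\<And>(X :: 'x set) w \<tau> N b.
    \<lbrakk>finite X; real (card X) \<le> N; 0 < \<tau>; 1 \<le> \<tau> * N; 0 < b;
    \<forall>E. 0 \<le> w E; \<forall>E. w E \<noteq> 0 \<longrightarrow> card E = k;
    \<forall>A. A \<subseteq> X \<and> A \<noteq> {} \<longrightarrow> wdeg X w A \<le> b * \<tau> ^ (card A - 1);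
    \<beta> / (M + 1) * N * b \<le> wdeg X w {}\<rbrakk> \<Longrightarrow>
    container_scheme X (\<lambda>I. \<forall>E. E \<subseteq> I \<longrightarrow> w E = 0) (C' * \<tau> * N) (real (card X) - c' * N)"
    using Suc.IH[of "\<beta> / (M + 1)"] pos by auto
  define c where "c = min (d / 4) c'"
  show ?case
  proof (rule exI[of _ "C' + 2"], rule conjI, use C' in simp,
      rule exI[of _ c], rule conjI, use C' Suc.prems in \<open>simp add: c_def\<close>, intro allI impI)
    fix X :: "'x set" and w \<tau> N b
    assume fin: "finite X" and card: "real (card X) \<le> N" and \<tau>: "(0::real) < \<tau>" and \<tau>N: "1 \<le> \<tau> * N"
      and b: "0 < b" and w0: "\<forall>E. 0 \<le> w E" and w_card: "\<forall>E. w E \<noteq> 0 \<longrightarrow> card E = Suc k"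
      and w_deg: "\<forall>A. A \<subseteq> X \<and> A \<noteq> {} \<longrightarrow> wdeg X w A \<le> b * \<tau> ^ (card A - 1)"
      and w_tot: "d * N * b \<le> wdeg X w {}"
    have N: "0 < N" using \<tau> \<tau>N by (smt (verit) mult_nonneg_nonpos)
    \<comment> \<open>The number of vertices to be picked from the independent set. As
      \<open>\<tau> * N \<ge> 1\<close>, rounding up at most doubles it, whence the 2 in
      \<open>C' + 2\<close>.\<close>
    define s where "s = nat \<lceil>\<tau> * N\<rceil>"
    have s: "\<tau> * N \<le> real s" "real s \<le> 2 * (\<tau> * N)"
      using \<tau>N unfolding s_def by linarith+
    let ?P = "\<lambda>u I. (\<forall>E. E \<subseteq> I \<longrightarrow> w E = 0) \<and> (\<forall>E. E \<subseteq> I \<longrightarrow> u E = 0)"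
    \<comment> \<open>\<open>t\<close> rounds are left, and \<open>u\<close> collects the links of
      the \<open>s - t\<close> vertices picked so far. Each round adds a link of weight between
      \<open>\<beta> * b\<close> and \<open>b\<close>, while the degrees in \<open>u\<close> stay
      below \<open>(M + 1) * b * \<tau> ^ card A\<close>.\<close>
    have loop: "container_scheme X (?P u) (C' * \<tau> * N + real t) (real (card X) - c * N)"
      if "t \<le> s" "\<forall>E. 0 \<le> u E" "\<forall>E. u E \<noteq> 0 \<longrightarrow> card E = k"
        "\<forall>A. A \<subseteq> X \<and> A \<noteq> {} \<longrightarrow> wdeg X u A \<le> (M + 1) * b * \<tau> ^ card A"
        "wdeg X u {} \<le> real (s - t) * b" "real (s - t) * (\<beta> * b) \<le> wdeg X u {}"
      for t u
      using that
    proof (induction t arbitrary: u)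
      case 0
      \<comment> \<open>No round is left: \<open>u\<close> is \<open>k\<close>-uniform and satisfies
        the hypotheses with \<open>(M + 1) * b * \<tau>\<close> for \<open>b\<close> and
        \<open>\<beta> / (M + 1)\<close> for \<open>d\<close>, because its total weight is at least
        \<open>s * (\<beta> * b)\<close>.\<close>
      have "container_scheme X (\<lambda>I. \<forall>E. E \<subseteq> I \<longrightarrow> u E = 0) (C' * \<tau> * N) (real (card X) - c' * N)"
      proof (rule IH)
        show "\<forall>A. A \<subseteq> X \<and> A \<noteq> {} \<longrightarrow> wdeg X u A \<le> (M + 1) * b * \<tau> * \<tau> ^ (card A - 1)"
        proof (intro allI impI)
          fix A assume A: "A \<subseteq> X \<and> A \<noteq> {}"
          then have "card A \<noteq> 0" using fin finite_subset by fastforce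
          then have "\<tau> * \<tau> ^ (card A - 1) = \<tau> ^ card A" by (cases "card A") auto
          then show "wdeg X u A \<le> (M + 1) * b * \<tau> * \<tau> ^ (card A - 1)"
            using 0 A by (simp add: mult.assoc)
        qed
        have "\<beta> / (M + 1) * N * ((M + 1) * b * \<tau>) = \<tau> * N * (\<beta> * b)"
          using pos by (simp add: field_simps)
        also have "\<dots> \<le> real s * (\<beta> * b)"
          using s pos b by (intro mult_right_mono) auto
        finally show "\<beta> / (M + 1) * N * ((M + 1) * b * \<tau>) \<le> wdeg X u {}"
          using 0 by simp
      qed (use fin card \<tau> \<tau>N b pos 0 in auto)
      then show ?case
        by (rule container_scheme_mono) (use N in \<open>auto simp: c_def mult_right_mono\<close>)
    next
      case (Suc t)
      \<comment> \<open>Saturated sets. Edges through them are dropped before a link is taken, so a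
        degree in \<open>u\<close> can exceed the saturation level by at most the contribution of a
        single link.\<close>
      define sat where "sat A \<longleftrightarrow> A \<noteq> {} \<and> A \<subseteq> X \<and> M * b * \<tau> ^ card A \<le> wdeg X u A" for A
      define w' where "w' E = (if \<exists>A\<subseteq>E. sat A then 0 else w E)" for E
      define H where "H = {v \<in> X. \<beta> * b \<le> wdeg X w' {v}}"
      have w': "0 \<le> w' E" "w' E \<le> w E" for E using w0 by (auto simp: w'_def)
      have w'_deg: "wdeg X w' A \<le> wdeg X w A" for A by (intro wdeg_mono w')
      have H: "finite H" "H \<subseteq> X" using fin by (auto simp: H_def)
      \<comment> \<open>The degree of a saturated set in \<open>w\<close> is at most its degree in
        \<open>u\<close> divided by \<open>M * \<tau>\<close>, and all degrees in \<open>u\<close>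
        together amount to \<open>2 ^ k\<close> times the total weight of \<open>u\<close>, which is
        at most \<open>2 * (\<tau> * N) * b\<close>.\<close>
      have removed: "wdeg X w {} - wdeg X w' {} \<le> d / 2 * N * b"
      proof -
        let ?S = "{A \<in> Pow X. sat A}"
        have "wdeg X w {} - wdeg X w' {} = (\<Sum>E\<in>Pow X. w E - w' E)"
          by (simp add: wdeg_def sum_subtractf)
        also have "\<dots> \<le> (\<Sum>E\<in>Pow X. \<Sum>A\<in>?S. of_bool (A \<subseteq> E) * w E)"
        proof (rule sum_mono)
          fix E assume E: "E \<in> Pow X"
          show "w E - w' E \<le> (\<Sum>A\<in>?S. of_bool (A \<subseteq> E) * w E)"
          proof (cases "\<exists>A\<subseteq>E. sat A")
            case True
            then obtain A where A: "A \<subseteq> E" "sat A" by blast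
            have "of_bool (A \<subseteq> E) * w E \<le> (\<Sum>A\<in>?S. of_bool (A \<subseteq> E) * w E)"
              using fin w0 A E by (intro member_le_sum) auto
            then show ?thesis using A True by (simp add: w'_def)
          next
            case False
            then have "w' E = w E" unfolding w'_def by (rule if_not_P)
            then show ?thesis using w0 by (simp add: sum_nonneg)
          qed
        qed
        also have "\<dots> = (\<Sum>A\<in>?S. wdeg X w A)"
          unfolding wdeg_def by (rule sum.swap)
        also have "\<dots> \<le> (\<Sum>A\<in>?S. wdeg X u A / (M * \<tau>))"
        proof (rule sum_mono)
          fix A assume A: "A \<in> ?S"
          then have A': "A \<subseteq> X" "A \<noteq> {}" "card A \<noteq> 0"
            using fin finite_subset[of A X] by (auto simp: sat_def)
          then have *: "\<tau> * \<tau> ^ (card A - 1) = \<tau> ^ card A" by (cases "card A") auto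
          have "wdeg X w A \<le> b * \<tau> ^ (card A - 1)" using w_deg A' by auto
          also have "\<dots> = M * b * \<tau> ^ card A / (M * \<tau>)"
            using pos \<tau> *[symmetric] by simp
          also have "\<dots> \<le> wdeg X u A / (M * \<tau>)"
            using A pos \<tau> by (intro divide_right_mono) (auto simp: sat_def)
          finally show "wdeg X w A \<le> wdeg X u A / (M * \<tau>)" .
        qed
        also have "\<dots> \<le> (\<Sum>A\<in>Pow X. wdeg X u A / (M * \<tau>))"
          using fin pos \<tau> Suc.prems by (intro sum_mono2) (auto intro!: divide_nonneg_nonneg wdeg_nonneg)
        also have "\<dots> = 2 ^ k * wdeg X u {} / (M * \<tau>)"
          using sum_wdeg[OF fin, of u k] Suc.prems by (simp add: sum_divide_distrib[symmetric])
        also have "\<dots> \<le> 2 ^ k * (2 * (\<tau> * N) * b) / (M * \<tau>)"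
        proof -
          have "wdeg X u {} \<le> real (s - Suc t) * b" using Suc.prems by auto
          also have "\<dots> \<le> 2 * (\<tau> * N) * b"
            using b s by (intro mult_right_mono) linarith+
          finally show ?thesis using pos \<tau> by (intro divide_right_mono mult_left_mono) auto
        qed
        also have "\<dots> = d / 2 * N * b"
          using \<tau> \<open>0 < d\<close> by (simp add: M_def field_simps)
        finally show ?thesis .
      qed
      \<comment> \<open>At least \<open>d / 2 * N * b\<close> of the weight remains. The low
        vertices have total degree at most \<open>N * (\<beta> * b) = d / 4 * N * b\<close>, and
        each high vertex has degree at most \<open>b\<close>.\<close>
      have cardH: "c * N \<le> real (card H)"
      proof -
        have "d / 2 * N * b \<le> wdeg X w' {}" using removed w_tot by simp
        also have "\<dots> \<le> (\<Sum>E\<in>Pow X. real (card E) * w' E)"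
          unfolding wdeg_def
        proof (rule sum_mono)
          fix E assume "E \<in> Pow X"
          have "w E = 0 \<or> 1 \<le> real (card E)" using w_card by force
          then have "1 * w' E \<le> real (card E) * w' E"
            using w'[of E] mult_right_mono[of 1 "real (card E)" "w' E"] by auto
          then show "of_bool ({} \<subseteq> E) * w' E \<le> real (card E) * w' E" by simp
        qed
        also have "\<dots> = (\<Sum>v\<in>X. wdeg X w' {v})"
          by (rule sum_wdeg_singletons[OF fin, symmetric])
        also have "\<dots> \<le> (\<Sum>v\<in>X. of_bool (v \<in> H) * b + \<beta> * b)"
        proof (rule sum_mono)
          fix v assume v: "v \<in> X"
          have "wdeg X w' {v} \<le> b" using w'_deg[of "{v}"] w_deg v by force
          then show "wdeg X w' {v} \<le> of_bool (v \<in> H) * b + \<beta> * b"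
            using v mult_pos_pos[OF pos(1) b] by (auto simp: H_def)
        qed
        also have "\<dots> = real (card H) * b + real (card X) * (\<beta> * b)"
          using fin H by (simp add: sum.distrib Int_absorb1 flip: sum_distrib_right Int_def)
        also have "\<dots> \<le> real (card H) * b + N * (\<beta> * b)"
          using card pos b by (simp add: mult_right_mono)
        finally have "d / 4 * N * b \<le> real (card H) * b" by (simp add: \<beta>_def algebra_simps)
        then have "d / 4 * N \<le> real (card H)" using b by simp
        moreover have "c * N \<le> d / 4 * N" using N by (intro mult_right_mono) (auto simp: c_def)
        ultimately show ?thesis by simp
      qed
      have "container_scheme X (?P u) (C' * \<tau> * N + real t + 1) (real (card X) - c * N)"
      proof (rule container_scheme_branch[OF H])
        show "real (card (X - H)) \<le> real (card X) - c * N"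
          using H fin cardH by (simp add: card_Diff_subset of_nat_diff card_mono)
        show "0 \<le> C' * \<tau> * N + real t" using C' \<tau> N by simp
        fix v assume v: "v \<in> H"
        then have vX: "v \<in> X" and v_deg: "\<beta> * b \<le> wdeg X w' {v}" by (auto simp: H_def)
        have v_deg': "wdeg X w' {v} \<le> b" using w'_deg[of "{v}"] w_deg vX by force
        define u' where "u' E = u E + of_bool (v \<notin> E) * w' (insert v E)" for E
        have u'_deg: "wdeg X u' A = wdeg X u A + of_bool (v \<notin> A) * wdeg X w' (insert v A)" for A
          unfolding u'_def by (simp only: wdeg_add wdeg_link[OF fin vX])
        have "container_scheme X (?P u') (C' * \<tau> * N + real t) (real (card X) - c * N)"
        proof (rule Suc.IH)
          show "\<forall>E. u' E \<noteq> 0 \<longrightarrow> card E = k"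
          proof (intro allI impI)
            fix E assume "u' E \<noteq> 0"
            then consider "u E \<noteq> 0" | "v \<notin> E" "w (insert v E) \<noteq> 0"
              by (cases "u E = 0"; cases "v \<in> E") (auto simp: u'_def w'_def split: if_splits)
            then show "card E = k"
            proof cases
              case 2
              then have "card (insert v E) = Suc k" using w_card by blast
              moreover from this have "finite E" using card.infinite[of "insert v E"] by fastforce
              ultimately show ?thesis using 2 by simp
            qed (use Suc.prems in auto)
          qed
          show "\<forall>A. A \<subseteq> X \<and> A \<noteq> {} \<longrightarrow> wdeg X u' A \<le> (M + 1) * b * \<tau> ^ card A"
          proof (intro allI impI)
            fix A assume A: "A \<subseteq> X \<and> A \<noteq> {}"
            then have finA: "finite A" using fin finite_subset by blast
            have u_deg: "wdeg X u A \<le> (M + 1) * b * \<tau> ^ card A" using Suc.prems A by blast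
            consider "v \<in> A" | "v \<notin> A" "sat A" | "v \<notin> A" "\<not> sat A" by blast
            then show "wdeg X u' A \<le> (M + 1) * b * \<tau> ^ card A"
            proof cases
              case 2
              then have "wdeg X w' (insert v A) = 0"
                by (auto simp: wdeg_def w'_def intro!: sum.neutral)
              then show ?thesis using u_deg by (simp add: u'_deg)
            next
              case 3
              then have "wdeg X u A \<le> M * b * \<tau> ^ card A" using A by (auto simp: sat_def)
              moreover have "wdeg X w' (insert v A) \<le> b * \<tau> ^ card A"
                using order_trans[OF w'_deg w_deg[rule_format, of "insert v A"]] A vX finA 3 by simp
              ultimately show ?thesis using 3 by (simp add: u'_deg algebra_simps)
            qed (use u_deg in \<open>simp add: u'_deg\<close>)
          qed
          have "real (s - t) = real (s - Suc t) + 1" using Suc.prems(1) by linarith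
          then show "wdeg X u' {} \<le> real (s - t) * b" "real (s - t) * (\<beta> * b) \<le> wdeg X u' {}"
            using Suc.prems v_deg v_deg' by (simp_all add: u'_deg algebra_simps)
        qed (use Suc.prems w' in \<open>auto simp: u'_def\<close>)
        \<comment> \<open>A set that contains \<open>v\<close> and no edge of \<open>w\<close>
          contains no edge of the link of \<open>v\<close> either, so it is independent in
          \<open>u'\<close> as well.\<close>
        then show "container_scheme X (\<lambda>I. ?P u I \<and> v \<in> I) (C' * \<tau> * N + real t) (real (card X) - c * N)"
          by (rule container_scheme_mono) (auto simp: u'_def w'_def)
      qed
      then show ?case by (simp add: add_ac)
    qed
    have "container_scheme X (?P (\<lambda>_. 0 :: real)) (C' * \<tau> * N + real s) (real (card X) - c * N)"
      by (rule loop[of s "\<lambda>_. 0"]) (use pos b \<tau> in \<open>auto simp: wdeg_def\<close>)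
    then show "container_scheme X (\<lambda>I. \<forall>E. E \<subseteq> I \<longrightarrow> w E = 0) ((C' + 2) * \<tau> * N) (real (card X) - c * N)"
      by (rule container_scheme_mono) (use s in \<open>auto simp: algebra_simps\<close>)
  qed
qed

section \<open>Graphs and collections of graphs\<close>

lemma verts_graph_image [simp]: "verts (graph_image f G) = f ` verts G"
  by (simp add: graph_image_def)

lemma edges_graph_image [simp]: "edges (graph_image f G) = (\<lambda>e. f ` e) ` edges G"
  by (simp add: graph_image_def)

lemma verts_union_graph [simp]: "verts (union_graph F) = (\<Union>T\<in>F. verts T)"
  by (simp add: union_graph_def)

lemma edges_union_graph [simp]: "edges (union_graph F) = (\<Union>T\<in>F. edges T)"
  by (simp add: union_graph_def)

lemma graph_image_comp: "graph_image g (graph_image f G) = graph_image (g \<circ> f) G"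
  by (simp add: graph_image_def image_image)

lemma graph_image_cong:
  assumes "\<And>x. x \<in> verts G \<Longrightarrow> f x = g x" "\<And>e. e \<in> edges G \<Longrightarrow> e \<subseteq> verts G"
  shows "graph_image f G = graph_image g G"
proof -
  have "(\<lambda>e. f ` e) ` edges G = (\<lambda>e. g ` e) ` edges G"
    by (rule image_cong[OF refl], rule image_cong[OF refl]) (use assms in auto)
  moreover have "f ` verts G = g ` verts G" using assms by auto
  ultimately show ?thesis by (simp add: graph_image_def)
qed

lemma graph_image_ident:
  assumes "\<And>x. x \<in> verts G \<Longrightarrow> f x = x" "\<And>e. e \<in> edges G \<Longrightarrow> e \<subseteq> verts G"
  shows "graph_image f G = G"
proof -
  have "graph_image f G = graph_image id G"
    by (rule graph_image_cong) (use assms in auto)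
  then show ?thesis by (cases G) (simp add: graph_image_def)
qed

lemma simple_graph_edgeD:
  assumes "simple_graph G" "e \<in> edges G"
  shows "e \<subseteq> verts G" "card e = 2" "finite e"
  using assms by (auto simp: simple_graph_def intro: card_ge_0_finite)

lemma simple_graph_finite:
  assumes "simple_graph G"
  shows "finite (verts G)" "finite (edges G)"
proof -
  show 1: "finite (verts G)" using assms by (simp add: simple_graph_def)
  have "edges G \<subseteq> Pow (verts G)" using assms by (auto simp: simple_graph_def)
  then show "finite (edges G)" using 1 finite_subset by blast
qed

lemma inj_on_image_sets: "inj_on f V \<Longrightarrow> \<E> \<subseteq> Pow V \<Longrightarrow> inj_on (\<lambda>e. f ` e) \<E>"
proof (rule inj_onI)
  fix x y assume "inj_on f V" "\<E> \<subseteq> Pow V" "x \<in> \<E>" "y \<in> \<E>" "f ` x = f ` y"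
  then show "x = y" using inj_on_image_eq_iff[of f V x y] by blast
qed

lemma simple_graph_image:
  assumes "simple_graph G" "inj_on f (verts G)"
  shows "simple_graph (graph_image f G)"
    and "card (verts (graph_image f G)) = card (verts G)"
    and "card (edges (graph_image f G)) = card (edges G)"
proof -
  show "simple_graph (graph_image f G)"
    unfolding simple_graph_def
  proof (intro conjI ballI)
    show "finite (verts (graph_image f G))" using simple_graph_finite[OF assms(1)] by simp
    fix e assume "e \<in> edges (graph_image f G)"
    then obtain e' where e': "e' \<in> edges G" "e = f ` e'" by auto
    note * = simple_graph_edgeD[OF assms(1) e'(1)]
    show "e \<subseteq> verts (graph_image f G)" using e' * by auto
    show "card e = 2" using e' * inj_on_subset[OF assms(2)] by (simp add: card_image)
  qed
  show "card (verts (graph_image f G)) = card (verts G)" using assms by (simp add: card_image)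
  have "inj_on (\<lambda>e. f ` e) (edges G)"
    by (rule inj_on_image_sets[OF assms(2)]) (use simple_graph_edgeD[OF assms(1)] in auto)
  then show "card (edges (graph_image f G)) = card (edges G)" by (simp add: card_image)
qed

lemma graph_iso_simple:
  assumes "simple_graph G" "graph_iso G G'"
  shows "simple_graph G'" "card (verts G') = card (verts G)" "card (edges G') = card (edges G)"
  using assms simple_graph_image unfolding graph_iso_def by blast+

lemma graph_iso_image:
  assumes "simple_graph G" "graph_iso G G'" "inj_on f (verts G')"
  shows "graph_iso G (graph_image f G')"
proof -
  obtain g where g: "inj_on g (verts G)" "G' = graph_image g G"
    using assms(2) by (auto simp: graph_iso_def)
  then have "inj_on (f \<circ> g) (verts G)" using assms(3) by (auto intro: comp_inj_on)
  moreover have "graph_image f G' = graph_image (f \<circ> g) G" by (simp add: g graph_image_comp)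
  ultimately show ?thesis unfolding graph_iso_def by (intro exI conjI)
qed

lemma simple_graph_three_vertices:
  assumes "simple_graph G" "2 \<le> card (edges G)"
  shows "3 \<le> card (verts G)"
proof (rule ccontr)
  assume "\<not> 3 \<le> card (verts G)"
  then have le: "card (verts G) \<le> 2" by simp
  have "edges G \<subseteq> {verts G}"
  proof
    fix e assume e: "e \<in> edges G"
    note * = simple_graph_edgeD[OF assms(1) e]
    have "e = verts G" using card_seteq[of "verts G" e] * le simple_graph_finite[OF assms(1)] by auto
    then show "e \<in> {verts G}" by simp
  qed
  then have "card (edges G) \<le> card {verts G}" by (intro card_mono) auto
  then show False using assms(2) by simp
qed

lemma finite_subgraphs:
  assumes "finite (verts G)" "finite (edges G)"
  shows "finite {G'. subgraph G' G}"
proof -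
  have "{G'. subgraph G' G} \<subseteq> (\<lambda>(V, E). UGraph V E) ` (Pow (verts G) \<times> Pow (edges G))"
  proof
    fix G' assume "G' \<in> {G'. subgraph G' G}"
    then show "G' \<in> (\<lambda>(V, E). UGraph V E) ` (Pow (verts G) \<times> Pow (edges G))"
      by (cases G') (auto simp: subgraph_def)
  qed
  from finite_subset[OF this] show ?thesis using assms by simp
qed

lemma m2_ge:
  assumes "simple_graph H" "simple_graph H'" "subgraph H' H" "2 \<le> card (edges H')"
  shows "(real (card (edges H')) - 1) / (real (card (verts H')) - 2) \<le> m2 H"
proof -
  let ?S = "{H'. simple_graph H' \<and> subgraph H' H \<and> 2 \<le> card (edges H')}"
  have "finite ?S"
    by (rule finite_subset[OF _ finite_subgraphs[of H]]) (use simple_graph_finite[OF assms(1)] in auto)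
  then have "finite ((\<lambda>H'. (real (card (edges H')) - 1) / (real (card (verts H')) - 2)) ` ?S)"
    by simp
  moreover have "{(real (card (edges H')) - 1) / (real (card (verts H')) - 2) | H'.
      simple_graph H' \<and> subgraph H' H \<and> 2 \<le> card (edges H')}
    = (\<lambda>H'. (real (card (edges H')) - 1) / (real (card (verts H')) - 2)) ` ?S" by auto
  ultimately show ?thesis
    unfolding m2_def using assms by (intro Max_ge) auto
qed

text \<open>With the denominator cleared, the bound extends to a single edge, which
  \<open>m2\<close> leaves out; there it only says that an edge has two ends.\<close>

lemma m2_sub:
  assumes "simple_graph H" "V \<subseteq> verts H" "E \<subseteq> edges H" "\<And>e. e \<in> E \<Longrightarrow> e \<subseteq> V" "E \<noteq> {}"
    and "m2 H \<le> r" "0 \<le> r"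
  shows "real (card E) - 1 \<le> r * (real (card V) - 2)"
proof (cases "2 \<le> card E")
  case True
  have s: "simple_graph (UGraph V E)"
    using assms simple_graph_finite[OF assms(1)] finite_subset by (auto simp: simple_graph_def)
  then have "3 \<le> card V" using simple_graph_three_vertices[OF s] True by simp
  moreover have "(real (card E) - 1) / (real (card V) - 2) \<le> m2 H"
    using m2_ge[OF assms(1) s] assms True by (simp add: subgraph_def)
  then have "(real (card E) - 1) / (real (card V) - 2) \<le> r" using assms(6) by simp
  ultimately show ?thesis by (simp add: pos_divide_le_eq)
next
  case False
  have fin: "finite E" "finite V"
    using assms simple_graph_finite[OF assms(1)] finite_subset by blast+
  have "0 < card E" using fin assms(5) by (simp add: card_gt_0_iff)
  then have c: "card E = 1" using False by linarith
  obtain e where "e \<in> E" using assms by auto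
  then have "card e = 2" "e \<subseteq> V" using assms(3,4) simple_graph_edgeD(2)[OF assms(1)] by auto
  then have V: "2 \<le> card V" using card_mono[OF fin(2), of e] by simp
  show ?thesis using c V assms(7) by simp
qed

text \<open>Bounds the number of collections living on a fixed \<open>u\<close>-set: at most
  \<open>2 ^ u\<close> vertex sets and \<open>2 ^ 2 ^ u\<close> edge sets for each member, and then
  any set of such members.\<close>

definition type_bound :: "nat \<Rightarrow> nat" where
  "type_bound u = 2 ^ (2 ^ u * 2 ^ 2 ^ u)"

lemma binomial_le_power: "n choose r \<le> n ^ r"
  by (cases "r \<le> n") (auto simp: binomial_le_pow binomial_eq_0)

lemma card_supersets_le:
  assumes "finite X"
  shows "card {W. V \<subseteq> W \<and> W \<subseteq> X \<and> card W = u} \<le> card X ^ (u - card V)"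
proof (cases "V \<subseteq> X")
  case True
  have finV: "finite V" using True assms finite_subset by blast
  have "card {W. V \<subseteq> W \<and> W \<subseteq> X \<and> card W = u} \<le> card {B. B \<subseteq> X \<and> card B = u - card V}"
  proof (rule card_inj_on_le[of "\<lambda>W. W - V"])
    show "inj_on (\<lambda>W. W - V) {W. V \<subseteq> W \<and> W \<subseteq> X \<and> card W = u}" by (auto simp: inj_on_def)
    show "(\<lambda>W. W - V) ` {W. V \<subseteq> W \<and> W \<subseteq> X \<and> card W = u} \<subseteq> {B. B \<subseteq> X \<and> card B = u - card V}"
      using finV by (auto simp: card_Diff_subset)
    show "finite {B. B \<subseteq> X \<and> card B = u - card V}" using assms by simp
  qed
  also have "\<dots> = card X choose (u - card V)" using assms by (rule n_subsets)
  finally show ?thesis using binomial_le_power order_trans by blast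
next
  case False
  then have "{W. V \<subseteq> W \<and> W \<subseteq> X \<and> card W = u} = {}" by auto
  then show ?thesis by (simp only: card.empty)
qed

text \<open>The vertex set of the union is chosen first; up to a constant, it determines the collection.\<close>

lemma card_collections_le:
  assumes "finite X" "A \<subseteq> \<G>" and "\<And>G. G \<in> \<G> \<Longrightarrow> verts G \<subseteq> X \<and> (\<forall>e\<in>edges G. e \<subseteq> verts G)"
  shows "card {F. F \<subseteq> \<G> \<and> A \<subseteq> F \<and> card (verts (union_graph F)) = u}
    \<le> type_bound u * card X ^ (u - card (verts (union_graph A)))"
proof -
  let ?G = "\<lambda>W. (\<lambda>(V, E). UGraph V E) ` (Pow W \<times> Pow (Pow W))"
  let ?W = "{W. verts (union_graph A) \<subseteq> W \<and> W \<subseteq> X \<and> card W = u}"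
  let ?S = "{F. F \<subseteq> \<G> \<and> A \<subseteq> F \<and> card (verts (union_graph F)) = u}"
  have finW: "finite ?W" using assms(1) by (auto intro: finite_subset[of _ "Pow X"])
  have G: "finite (?G W)" "card (?G W) \<le> 2 ^ u * 2 ^ 2 ^ u" if "W \<in> ?W" for W
  proof -
    have W: "finite W" "card W = u" using that assms(1) finite_subset by auto
    then show "finite (?G W)" by simp
    have "card (?G W) \<le> card (Pow W \<times> Pow (Pow W))" using W by (intro card_image_le) simp
    then show "card (?G W) \<le> 2 ^ u * 2 ^ 2 ^ u" using W by (simp add: card_cartesian_product card_Pow)
  qed
  have "?S \<subseteq> (\<Union>W\<in>?W. Pow (?G W))"
  proof
    fix F assume F: "F \<in> ?S"
    have "verts (union_graph F) \<in> ?W" using F assms(3) by auto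
    moreover have "F \<subseteq> ?G (verts (union_graph F))"
    proof
      fix G assume G: "G \<in> F"
      then have "(verts G, edges G) \<in> Pow (verts (union_graph F)) \<times> Pow (Pow (verts (union_graph F)))"
        using F assms(3)[of G] by fastforce
      then have "UGraph (verts G) (edges G) \<in> ?G (verts (union_graph F))" by (intro image_eqI) auto
      then show "G \<in> ?G (verts (union_graph F))" by simp
    qed
    ultimately show "F \<in> (\<Union>W\<in>?W. Pow (?G W))" by blast
  qed
  then have "card ?S \<le> card (\<Union>W\<in>?W. Pow (?G W))"
    using finW G by (intro card_mono) auto
  also have "\<dots> \<le> (\<Sum>W\<in>?W. card (Pow (?G W)))" by (rule card_UN_le[OF finW])
  also have "\<dots> \<le> (\<Sum>W\<in>?W. type_bound u)"
  proof (rule sum_mono)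
    fix W assume W: "W \<in> ?W"
    show "card (Pow (?G W)) \<le> type_bound u"
      unfolding type_bound_def card_Pow[OF G(1)[OF W]] using G(2)[OF W] by (intro power_increasing) auto
  qed
  also have "\<dots> = type_bound u * card ?W" by simp
  also have "\<dots> \<le> type_bound u * card X ^ (u - card (verts (union_graph A)))"
    by (intro mult_left_mono card_supersets_le assms(1)) simp
  finally show ?thesis .
qed

definition types_upto :: "nat \<Rightarrow> real" where
  "types_upto k = (\<Sum>u\<le>k. real (type_bound u))"

text \<open>With \<open>n = card X\<close>, at most \<open>type_bound u * n ^ u\<close> of the
  collections have \<open>u\<close> vertices, and each of those contributes at most
  \<open>M / n ^ u\<close>. In the moment estimates this stands in for a sum over isomorphism
  types.\<close>

lemma sum_collections_le:
  assumes X: "finite X" and \<G>: "finite \<G>" "\<And>G. G \<in> \<G> \<Longrightarrow> verts G \<subseteq> X \<and> (\<forall>e\<in>edges G. e \<subseteq> verts G)"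
    and "X \<noteq> {}" and \<D>: "\<D> \<subseteq> Pow \<G>"
    and k: "\<And>F. F \<in> \<D> \<Longrightarrow> card (verts (union_graph F)) \<le> k"
    and g: "\<And>F. F \<in> \<D> \<Longrightarrow> real (card X) ^ card (verts (union_graph F)) * g F \<le> M" and "0 \<le> M"
  shows "(\<Sum>F\<in>\<D>. g F) \<le> types_upto k * M"
proof -
  have fin: "finite \<D>" using \<D> \<G>(1) finite_subset by blast
  have n: "0 < real (card X)" using X \<open>X \<noteq> {}\<close> by (simp add: card_gt_0_iff)
  let ?D = "\<lambda>u. {F \<in> \<D>. card (verts (union_graph F)) = u}"
  have "(\<Sum>F\<in>\<D>. g F) = (\<Sum>u\<le>k. \<Sum>F\<in>?D u. g F)"
    by (rule sum.group[OF fin, symmetric]) (use k in auto)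
  also have "\<dots> \<le> (\<Sum>u\<le>k. real (type_bound u) * M)"
  proof (rule sum_mono)
    fix u
    have "card (?D u) \<le> card {F. F \<subseteq> \<G> \<and> {} \<subseteq> F \<and> card (verts (union_graph F)) = u}"
      using \<D> \<G>(1) by (intro card_mono) auto
    also have "\<dots> \<le> type_bound u * card X ^ (u - card (verts (union_graph ({}::'a ugraph set))))"
      by (rule card_collections_le[OF X]) (use \<G> in auto)
    finally have c: "real (card (?D u)) \<le> real (type_bound u) * real (card X) ^ u"
      by (simp flip: of_nat_power of_nat_mult)
    have "(\<Sum>F\<in>?D u. g F) \<le> (\<Sum>F\<in>?D u. M / real (card X) ^ u)"
      using g n by (intro sum_mono) (fastforce simp: field_simps)
    also have "\<dots> = real (card (?D u)) * (M / real (card X) ^ u)" by simp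
    also have "\<dots> \<le> real (type_bound u) * real (card X) ^ u * (M / real (card X) ^ u)"
      using c \<open>0 \<le> M\<close> n by (intro mult_right_mono) auto
    also have "\<dots> = real (type_bound u) * M" using n by simp
    finally show "(\<Sum>F\<in>?D u. g F) \<le> real (type_bound u) * M" .
  qed
  also have "\<dots> = types_upto k * M" by (simp add: types_upto_def sum_distrib_right)
  finally show ?thesis .
qed

section \<open>Densities\<close>

lemma verts_union_image: "verts (union_graph (graph_image f ` F)) = f ` verts (union_graph F)"
  by auto

lemma edges_union_image: "edges (union_graph (graph_image f ` F)) = (\<lambda>e. f ` e) ` edges (union_graph F)"
  by auto

lemma inj_on_graph_image:
  assumes "inj_on f V" "\<And>G. G \<in> F \<Longrightarrow> verts G \<subseteq> V \<and> (\<forall>e\<in>edges G. e \<subseteq> verts G)"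
  shows "inj_on (graph_image f) F"
proof (rule inj_onI)
  fix G G' assume G: "G \<in> F" "G' \<in> F" "graph_image f G = graph_image f G'"
  have "f ` verts G = f ` verts G'" "(\<lambda>e. f ` e) ` edges G = (\<lambda>e. f ` e) ` edges G'"
    using G(3) by (simp_all add: graph_image_def)
  moreover have "edges G \<subseteq> Pow V" "edges G' \<subseteq> Pow V" using assms(2)[OF G(1)] assms(2)[OF G(2)] by blast+
  moreover have "inj_on (\<lambda>e. f ` e) (Pow V)" using inj_on_image_sets[OF assms(1)] by blast
  ultimately have "verts G = verts G'" "edges G = edges G'"
    using inj_on_image_eq_iff[OF assms(1), of "verts G" "verts G'"] assms(2)[OF G(1)] assms(2)[OF G(2)]
      inj_on_image_eq_iff[of "\<lambda>e. f ` e" "Pow V" "edges G" "edges G'"] by auto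
  then show "G = G'" by (cases G; cases G') auto
qed

lemma card_union_image:
  assumes "inj_on f (verts (union_graph F))" "\<And>G. G \<in> F \<Longrightarrow> \<forall>e\<in>edges G. e \<subseteq> verts G"
  shows "card (graph_image f ` F) = card F"
    and "card (verts (union_graph (graph_image f ` F))) = card (verts (union_graph F))"
    and "card (edges (union_graph (graph_image f ` F))) = card (edges (union_graph F))"
proof -
  show "card (graph_image f ` F) = card F"
    by (rule card_image, rule inj_on_graph_image[OF assms(1)]) (use assms(2) in auto)
  show "card (verts (union_graph (graph_image f ` F))) = card (verts (union_graph F))"
    unfolding verts_union_image by (rule card_image[OF assms(1)])
  have "inj_on (\<lambda>e. f ` e) (edges (union_graph F))"
    by (rule inj_on_image_sets[OF assms(1)]) (use assms(2) in fastforce)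
  then show "card (edges (union_graph (graph_image f ` F))) = card (edges (union_graph F))"
    unfolding edges_union_image by (rule card_image)
qed

lemma graph_image_image: "graph_image g ` graph_image f ` F = graph_image (g \<circ> f) ` F"
  by (simp add: image_image graph_image_comp)

lemma graph_image_image_ident:
  assumes "\<And>x. x \<in> verts (union_graph F) \<Longrightarrow> f x = x" "\<And>G. G \<in> F \<Longrightarrow> \<forall>e\<in>edges G. e \<subseteq> verts G"
  shows "graph_image f ` F = F"
proof -
  have "graph_image f G = G" if "G \<in> F" for G
    by (rule graph_image_ident) (use that assms in auto)
  then show ?thesis by simp
qed

lemma collection_iso_image:
  assumes "collection_iso F D" "inj_on h (verts (union_graph D))"
  shows "collection_iso F (graph_image h ` D)"
proof -
  obtain f where f: "inj_on f (verts (union_graph F))" "D = graph_image f ` F"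
    using assms(1) unfolding collection_iso_def by (elim exE conjE)
  have "inj_on (h \<circ> f) (verts (union_graph F))"
    using f assms(2) by (intro comp_inj_on) (auto simp only: verts_union_image)
  then show ?thesis
    unfolding collection_iso_def f(2) graph_image_image by (intro exI conjI) auto
qed

lemma collection_iso_sym:
  assumes "collection_iso F D" "\<And>G. G \<in> F \<Longrightarrow> \<forall>e\<in>edges G. e \<subseteq> verts G"
  shows "collection_iso D F"
proof -
  obtain f where f: "inj_on f (verts (union_graph F))" "D = graph_image f ` F"
    using assms(1) unfolding collection_iso_def by (elim exE conjE)
  define g where "g = inv_into (verts (union_graph F)) f"
  have "graph_image g ` D = F"
    unfolding f(2) graph_image_image
    by (rule graph_image_image_ident) (use assms(2) inv_into_f_f[OF f(1)] in \<open>auto simp: g_def\<close>)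
  moreover have "inj_on g (verts (union_graph D))"
    unfolding f(2) verts_union_image g_def by (rule inj_on_inv_into) simp
  ultimately show ?thesis unfolding collection_iso_def by (intro exI[of _ g]) auto
qed

lemma T_density_iso_le:
  assumes "collection_iso F D" "\<And>G. G \<in> F \<Longrightarrow> \<forall>e\<in>edges G. e \<subseteq> verts G"
  shows "T_density T F \<le> T_density T D"
proof -
  obtain f where f: "inj_on f (verts (union_graph F))" "D = graph_image f ` F"
    using assms(1) unfolding collection_iso_def by (elim exE conjE)
  show ?thesis
    unfolding T_density_def
  proof (rule Sup_subset_mono, clarify)
    fix F' assume F': "F' \<subseteq> F" "2 \<le> card F'"
    have inj: "inj_on f (verts (union_graph F'))"
      using F' by (intro inj_on_subset[OF f(1)]) auto
    note c = card_union_image[OF inj]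
    show "\<exists>F''. (of_nat (card (edges (union_graph F')) - card (edges T)) :: ennreal) /
        of_nat (card (verts (union_graph F')) - card (verts T)) =
        of_nat (card (edges (union_graph F'')) - card (edges T)) /
        of_nat (card (verts (union_graph F'')) - card (verts T)) \<and> F'' \<subseteq> D \<and> 2 \<le> card F''"
    proof (rule exI[of _ "graph_image f ` F'"], intro conjI)
      show "graph_image f ` F' \<subseteq> D" using F' f by auto
      have w: "\<And>G. G \<in> F' \<Longrightarrow> \<forall>e\<in>edges G. e \<subseteq> verts G" using assms(2) F' by auto
      show "2 \<le> card (graph_image f ` F')" using c(1)[OF w] F' by simp
      show "(of_nat (card (edges (union_graph F')) - card (edges T)) :: ennreal) /
        of_nat (card (verts (union_graph F')) - card (verts T)) =
        of_nat (card (edges (union_graph (graph_image f ` F'))) - card (edges T)) /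
        of_nat (card (verts (union_graph (graph_image f ` F'))) - card (verts T))"
        by (simp only: c(2,3)[OF w])
    qed
  qed
qed

text \<open>Clearing the denominator is correct for \<open>b = 0\<close> as well, because
  \<open>a / 0\<close> is infinite unless \<open>a = 0\<close>.\<close>

lemma ennreal_ratio_le_iff:
  assumes "0 \<le> m"
  shows "(of_nat a / of_nat b :: ennreal) \<le> ennreal m \<longleftrightarrow> real a \<le> m * real b"
proof (cases "b = 0")
  case True
  then show ?thesis
    by (cases "a = 0") (auto simp: divide_ennreal_def ennreal_mult_top top_unique)
next
  case False
  then have "(of_nat a / of_nat b :: ennreal) = ennreal (real a / real b)"
    by (simp add: ennreal_of_nat_eq_real_of_nat divide_ennreal)
  then show ?thesis using False assms by (simp add: ennreal_le_iff pos_divide_le_eq)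
qed

lemma ennreal_ratio_ge:
  assumes "ennreal m \<le> of_nat a / of_nat b"
  shows "m * real b \<le> real a"
proof (cases "b = 0")
  case False
  then have "(of_nat a / of_nat b :: ennreal) = ennreal (real a / real b)"
    by (simp add: ennreal_of_nat_eq_real_of_nat divide_ennreal)
  then have "m \<le> real a / real b" using assms by (simp add: ennreal_le_iff)
  then show ?thesis using False by (simp add: pos_le_divide_eq)
qed simp

lemma T_density_le_iff:
  assumes "0 \<le> m"
  shows "T_density T F \<le> ennreal m \<longleftrightarrow> (\<forall>F'. F' \<subseteq> F \<and> 2 \<le> card F' \<longrightarrow>
    real (card (edges (union_graph F')) - card (edges T))
      \<le> m * real (card (verts (union_graph F')) - card (verts T)))"
  unfolding T_density_def Sup_le_iff using ennreal_ratio_le_iff[OF assms] by blast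

text \<open>The supremum is over a finite set and hence attained; \<open>0 < m\<close> rules out the
  empty set, whose supremum is 0.\<close>

lemma T_density_ge_witness:
  assumes "ennreal m \<le> T_density T F" "0 < m" "finite F"
  obtains F' where "F' \<subseteq> F" "2 \<le> card F'"
    "m * real (card (verts (union_graph F')) - card (verts T))
      \<le> real (card (edges (union_graph F')) - card (edges T))"
proof -
  let ?r = "\<lambda>F'. (of_nat (card (edges (union_graph F')) - card (edges T)) :: ennreal) /
                        of_nat (card (verts (union_graph F')) - card (verts T))"
  let ?S = "?r ` {F'. F' \<subseteq> F \<and> 2 \<le> card F'}"
  have eq: "T_density T F = Sup ?S"
    unfolding T_density_def by (rule arg_cong[of _ _ Sup]) auto
  have fin: "finite ?S" using assms(3) by (intro finite_imageI) (auto intro: finite_subset[of _ "Pow F"])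
  have ne: "?S \<noteq> {}"
  proof
    assume "?S = {}"
    then have "T_density T F = 0" unfolding eq by (simp only: Sup_empty bot_ennreal)
    then show False using assms(1,2) by simp
  qed
  then have "Sup ?S \<in> ?S" using Max_in[OF fin ne] Max_Sup[OF fin ne] by (simp only:)
  then obtain F' where F': "F' \<subseteq> F" "2 \<le> card F'" "T_density T F = ?r F'" unfolding eq by auto
  then have "ennreal m \<le> ?r F'" using assms(1) by (simp only:)
  then show thesis using ennreal_ratio_ge F' that by blast
qed

lemma card_union_iso:
  assumes "simple_graph T" "finite F" "\<And>G. G \<in> F \<Longrightarrow> graph_iso T G"
  shows "card (edges (union_graph F)) \<le> card F * card (edges T)"
    and "card (verts (union_graph F)) \<le> card F * card (verts T)"
    and "G \<in> F \<Longrightarrow> card (verts T) \<le> card (verts (union_graph F))"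
    and "G \<in> F \<Longrightarrow> card (edges T) \<le> card (edges (union_graph F))"
    and "finite (verts (union_graph F))" "finite (edges (union_graph F))"
proof -
  note s = graph_iso_simple[OF assms(1) assms(3)]
  have fin: "finite (verts G)" "finite (edges G)" if "G \<in> F" for G
    using simple_graph_finite[OF s(1)[OF that]] by auto
  show fv: "finite (verts (union_graph F))" and fe: "finite (edges (union_graph F))"
    using fin assms(2) by auto
  have "card (edges (union_graph F)) \<le> (\<Sum>G\<in>F. card (edges G))"
    unfolding edges_union_graph by (rule card_UN_le[OF assms(2)])
  also have "\<dots> = card F * card (edges T)" using s(3) by simp
  finally show "card (edges (union_graph F)) \<le> card F * card (edges T)" .
  have "card (verts (union_graph F)) \<le> (\<Sum>G\<in>F. card (verts G))"
    unfolding verts_union_graph by (rule card_UN_le[OF assms(2)])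
  also have "\<dots> = card F * card (verts T)" using s(2) by simp
  finally show "card (verts (union_graph F)) \<le> card F * card (verts T)" .
  show "card (verts T) \<le> card (verts (union_graph F))" if "G \<in> F"
    using card_mono[OF fv, of "verts G"] that s(2)[OF that] by auto
  show "card (edges T) \<le> card (edges (union_graph F))" if "G \<in> F"
    using card_mono[OF fe, of "edges G"] that s(3)[OF that] by auto
qed

lemma card_edges_disjoint_union:
  assumes "simple_graph T" "finite F" "\<And>G. G \<in> F \<Longrightarrow> graph_iso T G"
    and "\<And>G G'. G \<in> F \<Longrightarrow> G' \<in> F \<Longrightarrow> G \<noteq> G' \<Longrightarrow> edges G \<inter> edges G' = {}"
  shows "card (edges (union_graph F)) = card F * card (edges T)"
proof -
  note s = graph_iso_simple[OF assms(1) assms(3)]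
  have "card (edges (union_graph F)) = (\<Sum>G\<in>F. card (edges G))"
    unfolding edges_union_graph
    by (rule card_UN_disjoint) (use assms(2,4) simple_graph_finite(2)[OF s(1)] in auto)
  then show ?thesis using s(3) by simp
qed

lemma covering_nonempty:
  assumes "union_contains H F" "2 \<le> card (edges H)"
  shows "F \<noteq> {}"
proof
  assume "F = {}"
  then have "copies H (UGraph (UNIV :: nat set) {}) \<noteq> {}" using assms(1) by (simp add: union_contains_def)
  then obtain H' where "edges (H' :: nat ugraph) \<subseteq> {}" "graph_iso H H'"
    by (auto simp: copies_def subgraph_def)
  then have "edges H = {}" by (auto simp: graph_iso_def)
  then show False using assms(2) by simp
qed

text \<open>The hypotheses on \<open>m\<close> say that m (v(T) - 2) = e(T) - 1. The copies sitting
  on a set of edges of \<open>H\<close> with span \<open>W\<close> have at least card W + k (v(T) -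
  2) vertices, where k is their number. Each copy beyond the first thus brings e(T) - 1 edges at
  rate \<open>m\<close>, and its remaining edge is paid for by the bound k - 1 \<le> m (card W - 2)
  in \<open>H\<close>.\<close>

lemma edgewise_density_le_m2:
  assumes "simple_graph T" "simple_graph H" "edgewise_covering T H Fe"
    and m: "m2 H \<le> m" "0 < m" "real (card (edges T)) - 1 \<le> m * (real (card (verts T)) - 2)"
      "m * (real (card (verts T)) - 2) \<le> real (card (edges T)) - 1" "2 \<le> card (verts T)"
  shows "T_density T Fe \<le> ennreal m"
proof (subst T_density_le_iff, use m in simp, intro allI impI, elim conjE)
  fix F' assume F': "F' \<subseteq> Fe" "2 \<le> card F'"
  obtain H0 c where H0: "graph_iso H H0" "bij_betw c (edges H0) Fe"
    and c12: "\<forall>e\<in>edges H0. graph_iso T (c e) \<and> e \<in> edges (c e) \<and> verts (c e) \<inter> verts H0 = e"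
      "\<forall>e\<in>edges H0. \<forall>e'\<in>edges H0. e \<noteq> e' \<longrightarrow> verts (c e) \<inter> verts (c e') = e \<inter> e'"
    using assms(3) unfolding edgewise_covering_def by (elim exE conjE)
  note c1 = bspec[OF c12(1)]
  have c2: "verts (c e) \<inter> verts (c e') = e \<inter> e'"
    if "e \<in> edges H0" "e' \<in> edges H0" "e \<noteq> e'" for e e'
    using c12(2) that by simp
  obtain h where h: "inj_on h (verts H)" "H0 = graph_image h H"
    using H0(1) unfolding graph_iso_def by (elim exE conjE)
  have s0: "simple_graph H0" using graph_iso_simple[OF assms(2) H0(1)] by simp
  define E where "E = {e \<in> edges H0. c e \<in> F'}"
  have finF': "finite F'" by (rule card_ge_0_finite) (use F'(2) in simp)
  have inj: "inj_on c E" using H0(2) unfolding bij_betw_def E_def by (auto intro: inj_on_subset)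
  have img: "c ` E = F'" using H0(2) F' unfolding bij_betw_def E_def by auto
  have cardE: "card E = card F'" using card_image[OF inj] img by simp
  have E0: "E \<subseteq> edges H0" by (auto simp: E_def)
  have finE: "finite E" using finite_imageD[OF _ inj] img finF' by simp
  have iso: "\<And>G. G \<in> F' \<Longrightarrow> graph_iso T G" using c1 img E0 by auto
  define W where "W = \<Union>E"
  have W: "W \<subseteq> verts H0" using E0 simple_graph_edgeD(1)[OF s0] by (auto simp: W_def)
  have finW: "finite W" using W simple_graph_finite[OF s0] finite_subset by auto
  have e_prop: "card e = 2" "e \<subseteq> verts (c e)" "finite (verts (c e))" "card (verts (c e)) = card (verts T)"
    if "e \<in> E" for e
  proof -
    have e: "e \<in> edges H0" using that E0 by auto
    show "card e = 2" using simple_graph_edgeD[OF s0 e] by simp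
    note s = graph_iso_simple[OF assms(1) conjunct1[OF c1[OF e]]]
    show "finite (verts (c e))" "card (verts (c e)) = card (verts T)" using s simple_graph_finite by auto
    show "e \<subseteq> verts (c e)" using c1[OF e] by auto
  qed
  \<comment> \<open>Outside of their edges of \<open>H0\<close> the copies are pairwise disjoint and
    avoid \<open>W\<close>, so each adds its full v(T) - 2 vertices.\<close>
  have "card W + (\<Sum>e\<in>E. card (verts (c e) - e)) = card W + card (\<Union>e\<in>E. verts (c e) - e)"
  proof -
    have "card (\<Union>e\<in>E. verts (c e) - e) = (\<Sum>e\<in>E. card (verts (c e) - e))"
    proof (rule card_UN_disjoint[OF finE])
      show "\<forall>e\<in>E. finite (verts (c e) - e)" using e_prop by auto
      show "\<forall>e\<in>E. \<forall>e'\<in>E. e \<noteq> e' \<longrightarrow> (verts (c e) - e) \<inter> (verts (c e') - e') = {}"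
        using c2 E0 by blast
    qed
    then show ?thesis by simp
  qed
  also have "\<dots> = card (W \<union> (\<Union>e\<in>E. verts (c e) - e))"
  proof (rule card_Un_disjoint[symmetric])
    show "finite (\<Union>e\<in>E. verts (c e) - e)" using finE e_prop by auto
    show "W \<inter> (\<Union>e\<in>E. verts (c e) - e) = {}"
    proof -
      have "(verts (c e) - e) \<inter> W = {}" if "e \<in> E" for e
        using c1[of e] that E0 W by blast
      then show ?thesis by blast
    qed
  qed (rule finW)
  also have "\<dots> \<le> card (verts (union_graph F'))"
  proof (rule card_mono)
    show "finite (verts (union_graph F'))" by (rule card_union_iso[OF assms(1) finF' iso])
    show "W \<union> (\<Union>e\<in>E. verts (c e) - e) \<subseteq> verts (union_graph F')"
      using e_prop(2) unfolding img[symmetric] W_def by auto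
  qed
  also have "(\<Sum>e\<in>E. card (verts (c e) - e)) = card E * (card (verts T) - 2)"
  proof -
    have "card (verts (c e) - e) = card (verts T) - 2" if "e \<in> E" for e
      using e_prop[OF that] card_Diff_subset[of e "verts (c e)"] finite_subset by fastforce
    then show ?thesis by simp
  qed
  finally have vU: "card W + card E * (card (verts T) - 2) \<le> card (verts (union_graph F'))" .
  \<comment> \<open>\<open>W\<close> and \<open>E\<close> are pulled back to \<open>H\<close>
    itself, where the bound on \<open>m2 H\<close> applies.\<close>
  define V where "V = {x \<in> verts H. h x \<in> W}"
  define E' where "E' = {e \<in> edges H. h ` e \<in> E}"
  have hV: "h ` V = W" using W h(2) by (auto simp: V_def)
  have cV: "card V = card W" using card_image[OF inj_on_subset[OF h(1)], of V] hV by (auto simp: V_def)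
  have hE: "(\<lambda>e. h ` e) ` E' = E" using E0 h(2) by (auto simp: E'_def)
  have inj_h: "inj_on (\<lambda>e. h ` e) (edges H)"
    by (rule inj_on_image_sets[OF h(1)]) (use simple_graph_edgeD[OF assms(2)] in auto)
  then have cE: "card E' = card E"
    using card_image[OF inj_on_subset[OF inj_h, of E']] hE by (auto simp: E'_def)
  have "E' \<noteq> {}" using cE cardE F'(2) by auto
  have "real (card E') - 1 \<le> m * (real (card V) - 2)"
  proof (rule m2_sub[OF assms(2), where r = m])
    fix e assume "e \<in> E'"
    then have "e \<subseteq> verts H" "h ` e \<in> E" using simple_graph_edgeD[OF assms(2)] by (auto simp: E'_def)
    then show "e \<subseteq> V" by (auto simp: V_def W_def)
  qed (use m \<open>E' \<noteq> {}\<close> in \<open>auto simp: V_def E'_def\<close>)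
  then have A: "real (card F') - 1 \<le> m * (real (card W) - 2)" using cV cE cardE by simp
  \<comment> \<open>In each copy one edge is charged to \<open>H\<close> and the other e(T) - 1 to
    the new vertices of the copy.\<close>
  have "(real (card F') - 1) * real (card (edges T)) = (real (card F') - 1) * (real (card (edges T)) - 1) + (real (card F') - 1)"
    by (simp add: algebra_simps)
  also have "\<dots> \<le> (real (card F') - 1) * (m * (real (card (verts T)) - 2)) + m * (real (card W) - 2)"
    using A m F'(2) by (intro add_mono mult_left_mono) auto
  also have "\<dots> = m * (real (card W) + real (card F') * (real (card (verts T)) - 2) - real (card (verts T)))"
    by (simp add: algebra_simps)
  also have "\<dots> \<le> m * (real (card (verts (union_graph F'))) - real (card (verts T)))"
  proof -
    have "real (card W) + real (card F') * (real (card (verts T)) - 2)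
        = real (card W + card E * (card (verts T) - 2))"
      using m(5) cardE by (simp add: of_nat_diff)
    also have "\<dots> \<le> real (card (verts (union_graph F')))" using vU by (simp only: of_nat_le_iff)
    finally show ?thesis using m(2) by (intro mult_left_mono) auto
  qed
  finally have B: "(real (card F') - 1) * real (card (edges T))
      \<le> m * (real (card (verts (union_graph F'))) - real (card (verts T)))" .
  have F'_ne: "F' \<noteq> {}" using F'(2) by auto
  then obtain G where "G \<in> F'" by blast
  note c = card_union_iso[OF assms(1) finF' iso]
  have "real (card (edges (union_graph F')) - card (edges T))
      \<le> (real (card F') - 1) * real (card (edges T))"
  proof -
    have "real (card (edges (union_graph F'))) \<le> real (card F') * real (card (edges T))"
      using c(1) by (metis of_nat_le_iff of_nat_mult)
    then show ?thesis using c(4)[OF _ \<open>G \<in> F'\<close>] by (simp add: of_nat_diff algebra_simps)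
  qed
  also note B
  also have "m * (real (card (verts (union_graph F'))) - real (card (verts T)))
      = m * real (card (verts (union_graph F')) - card (verts T))"
    using c(3)[OF _ \<open>G \<in> F'\<close>] by (simp add: of_nat_diff)
  finally show "real (card (edges (union_graph F')) - card (edges T))
      \<le> m * real (card (verts (union_graph F')) - card (verts T))" .
qed

section \<open>Consequences of 2-balancedness for a fixed graph T\<close>

locale pattern_graph =
  fixes T :: "'a ugraph"
  assumes simple_T: "simple_graph T" and balanced_T: "two_balanced T"
begin

abbreviation vT :: nat where "vT \<equiv> card (verts T)"
abbreviation eT :: nat where "eT \<equiv> card (edges T)"

definition host :: "nat \<Rightarrow> nat ugraph set" where
  "host n = copies T (complete_graph n)"

lemma eT_ge: "2 \<le> eT" using balanced_T by (simp add: two_balanced_def)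

lemma vT_ge: "3 \<le> vT" using simple_graph_three_vertices[OF simple_T eT_ge] .

lemma m2_T: "m2 T * (real vT - 2) = real eT - 1"
  using balanced_T vT_ge by (simp add: two_balanced_def)

text \<open>Two edges span at most four vertices. The value 1/2 is what makes a 2-balanced graph
  balanced in \<open>sub_balanced\<close>.\<close>

lemma m2_T_ge: "1 / 2 \<le> m2 T"
proof -
  obtain e e' where e: "e \<in> edges T" "e' \<in> edges T" "e \<noteq> e'"
    using eT_ge card_le_Suc0_iff_eq[OF simple_graph_finite(2)[OF simple_T]] by fastforce
  note d = simple_graph_edgeD[OF simple_T]
  let ?H = "UGraph (e \<union> e') {e, e'}"
  have s: "simple_graph ?H" using e d by (auto simp: simple_graph_def)
  have c: "card (edges ?H) = 2" using e by simp
  have h1: "(real (card (edges ?H)) - 1) / (real (card (verts ?H)) - 2) \<le> m2 T"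
    by (rule m2_ge[OF simple_T s]) (use e d in \<open>auto simp: subgraph_def\<close>)
  have h2: "card (verts ?H) \<le> 4" using card_Un_le[of e e'] d e by simp
  have h3: "3 \<le> card (verts ?H)" using simple_graph_three_vertices[OF s] c by simp
  have "1 / 2 \<le> 1 / (real (card (verts ?H)) - 2)"
    using h2 h3 by (intro divide_left_mono) auto
  then show ?thesis using h1 unfolding c by simp
qed

lemma m2_T_pos: "0 < m2 T" using m2_T_ge by simp

text \<open>The first inequality is \<open>m2_sub\<close> for the subgraph, subtracted from the
  equation \<open>m2_T\<close>. The second says that \<open>T\<close> is also balanced in the
  ordinary sense, with maximal ratio of edges to vertices; it follows by
  \<open>2 * m2 T \<ge> 1\<close>.\<close>

lemma sub_balanced:
  assumes "graph_iso T T'" "V \<subseteq> verts T'" "E \<subseteq> edges T'" "\<And>e. e \<in> E \<Longrightarrow> e \<subseteq> V" "E \<noteq> {}"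
  shows "m2 T * (real vT - real (card V)) \<le> real eT - real (card E)"
    and "real vT * real (card E) \<le> real (card V) * real eT"
    and "card V \<le> vT" "card E \<le> eT" "1 \<le> card E"
proof -
  obtain h where h: "inj_on h (verts T)" "T' = graph_image h T"
    using assms(1) unfolding graph_iso_def by (elim exE conjE)
  define V' where "V' = {x \<in> verts T. h x \<in> V}"
  define E' where "E' = {e \<in> edges T. h ` e \<in> E}"
  have hV: "h ` V' = V" using assms h(2) by (auto simp: V'_def)
  have cV: "card V' = card V" using card_image[OF inj_on_subset[OF h(1)], of V'] hV by (auto simp: V'_def)
  have hE: "(\<lambda>e. h ` e) ` E' = E" using assms h(2) by (auto simp: E'_def)
  have inj_h: "inj_on (\<lambda>e. h ` e) (edges T)"
    by (rule inj_on_image_sets[OF h(1)]) (use simple_graph_edgeD[OF simple_T] in auto)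
  then have cE: "card E' = card E"
    using card_image[OF inj_on_subset[OF inj_h, of E']] hE by (auto simp: E'_def)
  have "E' \<noteq> {}" using hE assms by auto
  have A: "real (card E') - 1 \<le> m2 T * (real (card V') - 2)"
  proof (rule m2_sub[OF simple_T])
    fix e assume "e \<in> E'"
    then have "e \<subseteq> verts T" "h ` e \<in> E" using simple_graph_edgeD[OF simple_T] by (auto simp: E'_def)
    then show "e \<subseteq> V'" using assms(4)[of "h ` e"] by (auto simp: V'_def)
  qed (use m2_T_pos \<open>E' \<noteq> {}\<close> in \<open>auto simp: V'_def E'_def\<close>)
  then show "m2 T * (real vT - real (card V)) \<le> real eT - real (card E)"
    using m2_T cV cE by (simp add: algebra_simps)
  have fin: "finite (verts T)" "finite (edges T)" using simple_graph_finite[OF simple_T] by auto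
  show cV': "card V \<le> vT" and cE': "card E \<le> eT"
    using card_mono[OF fin(1), of V'] card_mono[OF fin(2), of E'] cV cE by (auto simp: V'_def E'_def)
  have "finite E'" using fin by (simp add: E'_def)
  then have "0 < card E'" using \<open>E' \<noteq> {}\<close> by (simp add: card_gt_0_iff)
  then show "1 \<le> card E" using cE by simp
  define m where "m = m2 T"
  have m: "1 / 2 \<le> m" "m * (real vT - 2) = real eT - 1" "real (card E) - 1 \<le> m * (real (card V) - 2)"
    using m2_T_ge m2_T A cV cE by (simp_all add: m_def)
  have "m * (real vT * real (card E)) = (real eT - 1 + 2 * m) * real (card E)"
    unfolding m(2)[symmetric] by (simp add: algebra_simps)
  also have "\<dots> \<le> (real (card E) - 1 + 2 * m) * real eT"
  proof -
    have "0 \<le> (2 * m - 1) * (real eT - real (card E))"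
      using m cE' by (intro mult_nonneg_nonneg) auto
    then show ?thesis by (simp add: algebra_simps)
  qed
  also have "\<dots> \<le> m * real (card V) * real eT"
    using m(3) by (intro mult_right_mono) (auto simp: algebra_simps)
  finally have "m * (real vT * real (card E)) \<le> m * (real (card V) * real eT)" by (simp add: mult.assoc)
  then show "real vT * real (card E) \<le> real (card V) * real eT" using m(1) by simp
qed

lemma host_iff: "G \<in> host n \<longleftrightarrow> graph_iso T G \<and> verts G \<subseteq> {..<n}"
proof -
  have "edges G \<subseteq> edges (complete_graph n)" if "graph_iso T G" "verts G \<subseteq> {..<n}"
  proof
    fix e assume "e \<in> edges G"
    then have "e \<subseteq> verts G" "card e = 2"
      using simple_graph_edgeD[OF graph_iso_simple(1)[OF simple_T that(1)]] by auto
    then show "e \<in> edges (complete_graph n)" using that(2) by (auto simp: complete_graph_def)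
  qed
  then show ?thesis by (auto simp: host_def copies_def subgraph_def complete_graph_def)
qed

lemma hostD:
  assumes "G \<in> host n"
  shows "graph_iso T G" "verts G \<subseteq> {..<n}" "simple_graph G" "card (verts G) = vT" "card (edges G) = eT"
    "edges G \<subseteq> edges (complete_graph n)" "finite (verts G)" "finite (edges G)" "edges G \<noteq> {}"
    "\<forall>e\<in>edges G. e \<subseteq> verts G"
proof -
  show 1: "graph_iso T G" "verts G \<subseteq> {..<n}" using assms by (auto simp: host_iff)
  show 2: "simple_graph G" "card (verts G) = vT" "card (edges G) = eT"
    using graph_iso_simple[OF simple_T 1(1)] by auto
  show "edges G \<subseteq> edges (complete_graph n)" using assms by (auto simp: host_def copies_def subgraph_def)
  show "finite (verts G)" "finite (edges G)" using simple_graph_finite[OF 2(1)] by auto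
  show "edges G \<noteq> {}" using 2(3) eT_ge by auto
  show "\<forall>e\<in>edges G. e \<subseteq> verts G" using simple_graph_edgeD[OF 2(1)] by auto
qed

text \<open>Labelled copies, for which one can ask where a given set of edges of \<open>T\<close> is
  mapped. Extensional functions keep the set finite.\<close>

definition embeddings :: "nat \<Rightarrow> ('a \<Rightarrow> nat) set" where
  "embeddings n = {\<phi> \<in> verts T \<rightarrow>\<^sub>E {..<n}. inj_on \<phi> (verts T)}"

lemma finite_embeddings: "finite (embeddings n)"
  unfolding embeddings_def
  by (rule finite_subset[of _ "verts T \<rightarrow>\<^sub>E {..<n}"])
    (use simple_graph_finite[OF simple_T] in \<open>auto intro: finite_PiE\<close>)

lemma card_embeddings_le: "card (embeddings n) \<le> n ^ vT"
proof -
  have "card (embeddings n) \<le> card (verts T \<rightarrow>\<^sub>E {..<n})"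
    unfolding embeddings_def using simple_graph_finite[OF simple_T]
    by (intro card_mono) (auto intro: finite_PiE)
  then show ?thesis using simple_graph_finite[OF simple_T] by (simp add: card_PiE)
qed

lemma host_eq_image: "host n = (\<lambda>\<phi>. graph_image \<phi> T) ` embeddings n"
proof (intro set_eqI iffI)
  fix G assume "G \<in> host n"
  then obtain h where h: "inj_on h (verts T)" "G = graph_image h T" "verts G \<subseteq> {..<n}"
    unfolding host_iff graph_iso_def by auto
  let ?\<phi> = "restrict h (verts T)"
  have "graph_image ?\<phi> T = G"
    unfolding h(2) by (rule graph_image_cong) (use simple_graph_edgeD[OF simple_T] in auto)
  moreover have "?\<phi> \<in> embeddings n" using h by (auto simp: embeddings_def)
  ultimately show "G \<in> (\<lambda>\<phi>. graph_image \<phi> T) ` embeddings n" by blast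
qed (auto simp: host_iff graph_iso_def embeddings_def)

lemma finite_host: "finite (host n)"
  unfolding host_eq_image using finite_embeddings by simp

lemma card_host_le: "card (host n) \<le> n ^ vT"
  unfolding host_eq_image
  by (rule order_trans[OF card_image_le[OF finite_embeddings] card_embeddings_le])

text \<open>By edge-disjointness, all of \<open>F\<close> has exactly
  \<open>(card F - 1) * eT\<close> more edges than one copy, but at most
  \<open>(card F - 1) * vT\<close> more vertices. Consequently \<open>n powr (vT - eT / m)\<close>
  is at least 1, which the container lemma demands of \<open>\<tau> * N\<close>.\<close>

lemma covering_density_ge:
  assumes "T_covering T H F" "2 \<le> card F"
  shows "ennreal (real eT / real vT) \<le> T_density T F"
proof -
  have F: "finite F" "\<And>G. G \<in> F \<Longrightarrow> graph_iso T G"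
    "\<And>G G'. G \<in> F \<Longrightarrow> G' \<in> F \<Longrightarrow> G \<noteq> G' \<Longrightarrow> edges G \<inter> edges G' = {}"
    using assms(1) unfolding T_covering_def by auto
  obtain G where G: "G \<in> F" using assms(2) by fastforce
  note c = card_union_iso[OF simple_T F(1,2)]
  let ?a = "card (edges (union_graph F)) - eT" and ?b = "card (verts (union_graph F)) - vT"
  have a: "real ?a = (real (card F) - 1) * real eT"
    using card_edges_disjoint_union[OF simple_T F] c(4)[OF _ G] by (simp add: of_nat_diff algebra_simps)
  have b: "real ?b \<le> (real (card F) - 1) * real vT"
  proof -
    have "real (card (verts (union_graph F))) \<le> real (card F) * real vT"
      using c(2) by (metis of_nat_le_iff of_nat_mult)
    then show ?thesis using c(3)[OF _ G] by (simp add: of_nat_diff algebra_simps)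
  qed
  have "ennreal (real eT / real vT) \<le> of_nat ?a / of_nat ?b"
  proof (cases "?b = 0")
    case True
    have "?a \<noteq> 0"
    proof
      assume "?a = 0"
      then have "(real (card F) - 1) * real eT = 0" using a by simp
      then show False using assms(2) eT_ge by auto
    qed
    then show ?thesis unfolding True by (simp add: divide_ennreal_def ennreal_mult_top)
  next
    case False
    have "real eT / real vT \<le> real ?a / real ?b"
    proof -
      have "real eT * real ?b \<le> real eT * ((real (card F) - 1) * real vT)"
        using b by (intro mult_left_mono) auto
      also have "\<dots> = real ?a * real vT" unfolding a by simp
      finally show ?thesis using False vT_ge by (intro frac_le_eq[THEN iffD2]) (auto simp: divide_simps)
    qed
    moreover have "(of_nat ?a / of_nat ?b :: ennreal) = ennreal (real ?a / real ?b)"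
      using False by (simp add: ennreal_of_nat_eq_real_of_nat divide_ennreal)
    ultimately show ?thesis by (simp add: ennreal_leI)
  qed
  also have "\<dots> \<le> T_density T F"
    unfolding T_density_def by (rule Sup_upper) (use assms(2) in auto)
  finally show ?thesis .
qed

lemma edgewise_density_le:
  assumes "simple_graph H" "edgewise_covering T H Fe" "m2 H \<le> m2 T"
  shows "T_density T Fe \<le> ennreal (m2 T)"
  by (rule edgewise_density_le_m2[OF simple_T assms(1,2)]) (use assms m2_T m2_T_pos vT_ge in auto)

lemma powr_product_eq:
  assumes "0 < (x :: real)"
  shows "x ^ a * (y * x powr c) ^ b = y ^ b * x powr (real a + c * real b)"
  using assms by (simp add: power_mult_distrib powr_add powr_realpow powr_power mult.commute)

text \<open>Since \<open>m \<le> m2 T\<close> and \<open>T\<close> is 2-balanced, the exponent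
  \<open>card V - card E / m\<close> is smallest for \<open>T\<close> itself; at least one factor
  \<omega> is left because \<open>E\<close> is nonempty. Up to a constant, the left side becomes the
  exponent in Janson's inequality.\<close>

lemma scaled_powr_bound:
  assumes n: "0 < n" and m: "0 < m" "m \<le> m2 T" and \<omega>: "1 \<le> \<omega>"
    and sub: "graph_iso T T'" "V \<subseteq> verts T'" "E \<subseteq> edges T'" "\<And>e. e \<in> E \<Longrightarrow> e \<subseteq> V" "E \<noteq> {}"
  shows "\<omega> * real n powr (real vT - real eT / m)
    \<le> real n ^ card V * (\<omega> * real n powr (- (1 / m))) ^ card E"
proof -
  note b = sub_balanced[OF sub]
  have "m * (real vT - real (card V)) \<le> m2 T * (real vT - real (card V))"
    using m b(3) by (intro mult_right_mono) auto
  then have "m * (real vT - real (card V)) \<le> real eT - real (card E)" using b(1) by simp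
  then have "real vT - real (card V) \<le> (real eT - real (card E)) / m"
    using m(1) by (simp add: pos_le_divide_eq mult.commute)
  then have ex: "real vT - real eT / m \<le> real (card V) - real (card E) / m"
    by (simp add: diff_divide_distrib)
  have "\<omega> * real n powr (real vT - real eT / m) \<le> \<omega> ^ card E * real n powr (real (card V) - real (card E) / m)"
  proof (intro mult_mono)
    show "\<omega> \<le> \<omega> ^ card E" using \<omega> b(5) by (simp add: self_le_power)
    show "real n powr (real vT - real eT / m) \<le> real n powr (real (card V) - real (card E) / m)"
      using ex n by (intro powr_mono) auto
  qed (use \<omega> in auto)
  also have "\<dots> = real n ^ card V * (\<omega> * real n powr (- (1 / m))) ^ card E"
    using powr_product_eq[of "real n" "card V" \<omega> "- (1 / m)" "card E"] n by simp
  finally show ?thesis .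
qed

text \<open>The analogue at the scale of \<open>threshold0\<close>: by ordinary balancedness the
  exponent of \<open>n\<close> is nonnegative. It provides the second moment bound for the lower
  estimate.\<close>

lemma scaled_powr_bound0:
  assumes n: "0 < n" and \<omega>: "1 \<le> \<omega>"
    and sub: "graph_iso T T'" "V \<subseteq> verts T'" "E \<subseteq> edges T'" "\<And>e. e \<in> E \<Longrightarrow> e \<subseteq> V" "E \<noteq> {}"
  shows "\<omega> \<le> real n ^ card V * (\<omega> * real n powr (- (real vT / real eT))) ^ card E"
proof -
  note b = sub_balanced[OF sub]
  have ex: "0 \<le> real (card V) - real vT / real eT * real (card E)"
    using b(2) eT_ge by (simp add: field_simps)
  have "\<omega> * 1 \<le> \<omega> ^ card E * real n powr (real (card V) - real vT / real eT * real (card E))"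
  proof (intro mult_mono)
    show "\<omega> \<le> \<omega> ^ card E" using \<omega> b(5) by (simp add: self_le_power)
    show "1 \<le> real n powr (real (card V) - real vT / real eT * real (card E))"
      using ex n by (intro ge_one_powr_ge_zero) auto
  qed (use \<omega> in auto)
  also have "\<dots> = real n ^ card V * (\<omega> * real n powr (- (real vT / real eT))) ^ card E"
    using powr_product_eq[of "real n" "card V" \<omega> "- (real vT / real eT)" "card E"] n by simp
  finally show ?thesis by simp
qed

text \<open>Up to constants, \<open>l\<close> is a lower bound for the expected number of copies of every subgraph of \<open>T\<close>.\<close>

lemma overlap_sum:
  assumes n: "0 < n" and D: "D \<subseteq> host n" and p: "0 \<le> p" and lam: "0 < l"
    and sub: "\<And>(T' :: nat ugraph) V E. graph_iso T T' \<Longrightarrow> V \<subseteq> verts T' \<Longrightarrow> E \<subseteq> edges T' \<Longrightarrow> (\<And>e. e \<in> E \<Longrightarrow> e \<subseteq> V) \<Longrightarrow> E \<noteq> {} \<Longrightarrow>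
      l \<le> real n ^ card V * p ^ card E"
  shows "(\<Sum>a\<in>D. \<Sum>b\<in>D. of_bool (edges a \<inter> edges b \<noteq> {}) * p ^ card (edges a \<union> edges b))
    \<le> 4 * types_upto (2 * vT) * ((real n ^ vT * p ^ eT)^2 / l)"
proof -
  let ?M = "(real n ^ vT * p ^ eT)^2 / l"
  have finD: "finite D" using D finite_host finite_subset by blast
  let ?P = "{(a, b) \<in> D \<times> D. edges a \<inter> edges b \<noteq> {}}"
  let ?g = "\<lambda>F. p ^ card (edges (union_graph F))"
  let ?\<D> = "(\<lambda>(a, b). {a, b}) ` ?P"
  have finP: "finite ?P" using finD by (auto intro: finite_subset[of _ "D \<times> D"])
  have "(\<Sum>a\<in>D. \<Sum>b\<in>D. of_bool (edges a \<inter> edges b \<noteq> {}) * p ^ card (edges a \<union> edges b))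
      = (\<Sum>(a,b)\<in>?P. p ^ card (edges a \<union> edges b))"
    unfolding sum.cartesian_product
    by (rule sum.mono_neutral_cong_right) (use finD in auto)
  also have "\<dots> = (\<Sum>x\<in>?P. ?g ((\<lambda>(a, b). {a, b}) x))"
    by (rule sum.cong) auto
  also have "\<dots> = (\<Sum>F\<in>?\<D>. \<Sum>x\<in>{x \<in> ?P. (\<lambda>(a, b). {a, b}) x = F}. ?g ((\<lambda>(a, b). {a, b}) x))"
    by (rule sum.image_gen[OF finP])
  \<comment> \<open>A set \<open>{a, b}\<close> arises from at most 2 * 2 ordered pairs.\<close>
  also have "\<dots> \<le> (\<Sum>F\<in>?\<D>. 4 * ?g F)"
  proof (rule sum_mono)
    fix F assume F: "F \<in> ?\<D>"
    have sub: "{x \<in> ?P. (\<lambda>(a, b). {a, b}) x = F} \<subseteq> F \<times> F" by auto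
    obtain a b where "F = {a, b}" using F by auto
    then have "finite F" "card F \<le> 2" by (cases "a = b"; simp)+
    then have "card {x \<in> ?P. (\<lambda>(a, b). {a, b}) x = F} \<le> 2 * 2"
      using card_mono[OF _ sub] mult_le_mono[of "card F" 2 "card F" 2] by (simp add: card_cartesian_product)
    moreover have "(\<Sum>x\<in>{x \<in> ?P. (\<lambda>(a, b). {a, b}) x = F}. ?g ((\<lambda>(a, b). {a, b}) x))
      = real (card {x \<in> ?P. (\<lambda>(a, b). {a, b}) x = F}) * ?g F" by simp
    ultimately show "(\<Sum>x\<in>{x \<in> ?P. (\<lambda>(a, b). {a, b}) x = F}. ?g ((\<lambda>(a, b). {a, b}) x)) \<le> 4 * ?g F"
      using p by (simp add: mult_right_mono)
  qed
  also have "\<dots> = 4 * (\<Sum>F\<in>?\<D>. ?g F)" by (simp add: sum_distrib_left)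
  also have "(\<Sum>F\<in>?\<D>. ?g F) \<le> types_upto (2 * vT) * ?M"
  proof (rule sum_collections_le[of "{..<n}" "host n"])
    fix F assume F: "F \<in> ?\<D>"
    then obtain a b where ab: "a \<in> host n" "b \<in> host n" "edges a \<inter> edges b \<noteq> {}" "F = {a, b}"
      using D by auto
    note a = hostD[OF ab(1)] and b = hostD[OF ab(2)]
    have vU: "card (verts a \<union> verts b) + card (verts a \<inter> verts b) = 2 * vT"
      using card_Un_Int[of "verts a" "verts b"] a b by simp
    have eU: "card (edges a \<union> edges b) + card (edges a \<inter> edges b) = 2 * eT"
      using card_Un_Int[of "edges a" "edges b"] a b by simp
    show "card (verts (union_graph F)) \<le> 2 * vT" using vU ab by simp
    \<comment> \<open>Union and intersection together have the vertices and edges of two copies of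
      \<open>T\<close>, so a lower bound for the intersection turns into an upper bound for the
      union.\<close>
    have "l \<le> real n ^ card (verts a \<inter> verts b) * p ^ card (edges a \<inter> edges b)"
      by (rule sub[OF a(1)]) (use a b ab in auto)
    then have "real n ^ card (verts a \<union> verts b) * p ^ card (edges a \<union> edges b) * l
      \<le> real n ^ card (verts a \<union> verts b) * p ^ card (edges a \<union> edges b) *
        (real n ^ card (verts a \<inter> verts b) * p ^ card (edges a \<inter> edges b))"
      using p by (intro mult_left_mono) auto
    also have "\<dots> = real n ^ (card (verts a \<union> verts b) + card (verts a \<inter> verts b)) *
        p ^ (card (edges a \<union> edges b) + card (edges a \<inter> edges b))"
      by (simp add: power_add mult_ac)
    also have "\<dots> = (real n ^ vT * p ^ eT)^2"
      unfolding vU eU by (simp add: power_mult_distrib power_mult[symmetric] mult.commute)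
    finally show "real (card {..<n}) ^ card (verts (union_graph F)) * ?g F \<le> ?M"
      using lam ab by (simp add: pos_le_divide_eq)
  qed (use n D finite_host hostD lam in \<open>auto simp: divide_nonneg_pos\<close>)
  finally show ?thesis by simp
qed

end

section \<open>Supersaturation\<close>

lemma card_supersets_eq:
  assumes "finite X" "V \<subseteq> X" "card V \<le> m"
  shows "card {M. V \<subseteq> M \<and> M \<subseteq> X \<and> card M = m} = (card X - card V) choose (m - card V)"
proof -
  have finV: "finite V" using assms finite_subset by auto
  have "bij_betw (\<lambda>M. M - V) {M. V \<subseteq> M \<and> M \<subseteq> X \<and> card M = m} {B. B \<subseteq> X - V \<and> card B = m - card V}"
  proof (rule bij_betwI[where g = "\<lambda>B. B \<union> V"])
    show "(\<lambda>B. B \<union> V) \<in> {B. B \<subseteq> X - V \<and> card B = m - card V} \<rightarrow> {M. V \<subseteq> M \<and> M \<subseteq> X \<and> card M = m}"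
    proof
      fix B assume B: "B \<in> {B. B \<subseteq> X - V \<and> card B = m - card V}"
      then have "finite B" using assms(1) finite_subset[of B X] by auto
      then have "card (B \<union> V) = card B + card V" using B finV by (intro card_Un_disjoint) auto
      then show "B \<union> V \<in> {M. V \<subseteq> M \<and> M \<subseteq> X \<and> card M = m}" using B assms by auto
    qed
  qed (use finV in \<open>auto simp: card_Diff_subset\<close>)
  then have "card {M. V \<subseteq> M \<and> M \<subseteq> X \<and> card M = m} = card {B. B \<subseteq> X - V \<and> card B = m - card V}"
    by (rule bij_betw_same_card)
  then show ?thesis using assms finV n_subsets[of "X - V" "m - card V"] by (simp add: card_Diff_subset)
qed

definition collection_free :: "'a ugraph set set \<Rightarrow> 'b ugraph set \<Rightarrow> bool" where
  "collection_free \<F> C \<longleftrightarrow> \<not> (\<exists>D F. D \<subseteq> C \<and> F \<in> \<F> \<and> collection_iso F D)"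

lemma collection_free_mono: "collection_free \<F> C \<Longrightarrow> C' \<subseteq> C \<Longrightarrow> collection_free \<F> C'"
  unfolding collection_free_def by blast

context pattern_graph
begin

lemma ex_star_eq: "ex_star n T \<F> = Max (card ` {C. C \<subseteq> host n \<and> collection_free \<F> C})"
  unfolding ex_star_def host_def collection_free_def by (rule arg_cong[of _ _ Max]) auto

lemma finite_free: "finite {C. C \<subseteq> host n \<and> collection_free \<F> C}"
  using finite_host by simp

lemma ex_star_ge: "C \<subseteq> host n \<Longrightarrow> collection_free \<F> C \<Longrightarrow> card C \<le> ex_star n T \<F>"
  unfolding ex_star_eq using finite_free by (intro Max_ge) auto

lemma ex_star_attained:
  assumes "{} \<notin> \<F>"
  obtains C where "C \<subseteq> host n" "collection_free \<F> C" "card C = ex_star n T \<F>"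
proof -
  have "collection_free \<F> ({} :: nat ugraph set)"
    using assms by (auto simp: collection_free_def collection_iso_def)
  then have "card ` {C. C \<subseteq> host n \<and> collection_free \<F> C} \<noteq> {}" by blast
  then have "ex_star n T \<F> \<in> card ` {C. C \<subseteq> host n \<and> collection_free \<F> C}"
    unfolding ex_star_eq using finite_free by (intro Max_in) auto
  then show thesis using that by auto
qed

text \<open>Renames the vertices in \<open>M\<close> to \<open>{..<m}\<close>, where
  \<open>ex_star m\<close> is defined. The inverse renaming \<open>g\<close> carries forbidden
  sub-collections back.\<close>

lemma host_transfer:
  assumes D: "D \<subseteq> host n" and M: "\<And>G. G \<in> D \<Longrightarrow> verts G \<subseteq> M" "finite M" "card M = m"
  obtains b g where "inj_on b M" "b ` M = {..<m}" "inj_on g {..<m}" "graph_image b ` D \<subseteq> host m"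
    "card (graph_image b ` D) = card D" "\<And>G. G \<in> D \<Longrightarrow> graph_image g (graph_image b G) = G"
proof -
  obtain b where b: "bij_betw b M {..<m}"
    using finite_same_card_bij[OF M(2), of "{..<m}"] M(3) by auto
  define g where "g = inv_into M b"
  have inj: "inj_on b M" "b ` M = {..<m}" using b by (auto simp: bij_betw_def)
  have g: "inj_on g {..<m}" unfolding g_def using inj by (intro inj_on_inv_into) auto
  have w: "verts G \<subseteq> M \<and> (\<forall>e\<in>edges G. e \<subseteq> verts G)" if "G \<in> D" for G
    using M(1)[OF that] hostD(10)[of G n] D that by auto
  show thesis
  proof (rule that[OF inj g])
    show "graph_image b ` D \<subseteq> host m"
    proof
      fix G' assume "G' \<in> graph_image b ` D"
      then obtain G where G: "G \<in> D" "G' = graph_image b G" by auto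
      have "graph_iso T G'"
        unfolding G(2) by (rule graph_iso_image[OF simple_T])
          (use hostD(1)[of G n] D G w[OF G(1)] inj in \<open>auto intro: inj_on_subset\<close>)
      then show "G' \<in> host m" using w[OF G(1)] inj G(2) by (auto simp: host_iff)
    qed
    show "card (graph_image b ` D) = card D"
      by (rule card_image, rule inj_on_graph_image[OF inj(1)]) (use w in auto)
    fix G assume G: "G \<in> D"
    show "graph_image g (graph_image b G) = G"
      unfolding graph_image_comp
      by (rule graph_image_ident) (use w[OF G] inv_into_f_f[OF inj(1)] in \<open>auto simp: g_def\<close>)
  qed
qed

lemma card_free_le:
  assumes D: "D \<subseteq> host n" and M: "\<And>G. G \<in> D \<Longrightarrow> verts G \<subseteq> M" "finite M" "card M = m"
    and free: "collection_free \<F> D"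
  shows "card D \<le> ex_star m T \<F>"
proof -
  obtain b g where b: "inj_on b M" "b ` M = {..<m}" "inj_on g {..<m}" "graph_image b ` D \<subseteq> host m"
    "card (graph_image b ` D) = card D" and gb: "\<And>G. G \<in> D \<Longrightarrow> graph_image g (graph_image b G) = G"
    using host_transfer[OF D M] by blast
  have "collection_free \<F> (graph_image b ` D)"
    unfolding collection_free_def
  proof clarify
    fix D' F assume *: "D' \<subseteq> graph_image b ` D" "F \<in> \<F>" "collection_iso F D'"
    have "verts (union_graph D') \<subseteq> {..<m}" using *(1) b(4) hostD(2) by fastforce
    then have "collection_iso F (graph_image g ` D')"
      by (intro collection_iso_image[OF *(3)] inj_on_subset[OF b(3)])
    moreover have "graph_image g ` D' \<subseteq> D"
    proof
      fix G' assume "G' \<in> graph_image g ` D'"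
      then obtain G where "G \<in> D" "G' = graph_image g (graph_image b G)" using *(1) by auto
      then show "G' \<in> D" using gb[of G] by simp
    qed
    ultimately show False using free *(2) unfolding collection_free_def by blast
  qed
  then show ?thesis using ex_star_ge[OF b(4)] b(5) by metis
qed

lemma card_in_subset_le:
  assumes D: "D \<subseteq> host n" and M: "\<And>G. G \<in> D \<Longrightarrow> verts G \<subseteq> M" "finite M" "card M = m"
  shows "card D \<le> m ^ vT"
proof -
  obtain b g :: "nat \<Rightarrow> nat" where b: "graph_image b ` D \<subseteq> host m" "card (graph_image b ` D) = card D"
    by (rule host_transfer[OF D M])
  have "card D \<le> card (host m)" using card_mono[OF finite_host b(1)] b(2) by simp
  then show ?thesis using card_host_le[of m] by simp
qed

section \<open>Averaging over m-subsets\<close>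

definition msets :: "nat \<Rightarrow> nat \<Rightarrow> nat set set" where
  "msets n m = {M. M \<subseteq> {..<n} \<and> card M = m}"

lemma msets_finite: "finite (msets n m)" "card (msets n m) = n choose m"
  using n_subsets[of "{..<n}" m] by (auto simp: msets_def)

lemma sum_restrict:
  assumes D: "D \<subseteq> host n" and m: "vT \<le> m"
  shows "(\<Sum>M\<in>msets n m. card {G \<in> D. verts G \<subseteq> M}) = card D * ((n - vT) choose (m - vT))"
proof -
  have finD: "finite D" using D finite_host finite_subset by auto
  have "(\<Sum>M\<in>msets n m. card {G \<in> D. verts G \<subseteq> M}) = (\<Sum>M\<in>msets n m. \<Sum>G\<in>D. of_bool (verts G \<subseteq> M))"
    using finD by (intro sum.cong refl) (simp add: Int_def)
  also have "\<dots> = (\<Sum>G\<in>D. \<Sum>M\<in>msets n m. of_bool (verts G \<subseteq> M))" by (rule sum.swap)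
  also have "\<dots> = (\<Sum>G\<in>D. (n - vT) choose (m - vT))"
  proof (rule sum.cong[OF refl])
    fix G assume "G \<in> D"
    then have G: "G \<in> host n" using D by auto
    have "(\<Sum>M\<in>msets n m. of_bool (verts G \<subseteq> M)) = card {M \<in> msets n m. verts G \<subseteq> M}"
      using msets_finite by (simp add: Int_def)
    also have "{M \<in> msets n m. verts G \<subseteq> M} = {M. verts G \<subseteq> M \<and> M \<subseteq> {..<n} \<and> card M = m}"
      by (auto simp: msets_def)
    also have "card \<dots> = (n - vT) choose (m - vT)"
      using card_supersets_eq[of "{..<n}" "verts G" m] hostD[OF G] m by simp
    finally show "(\<Sum>M\<in>msets n m. of_bool (verts G \<subseteq> M)) = (n - vT) choose (m - vT)" .
  qed
  finally show ?thesis by simp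
qed

definition ex_star_ratio :: "nat ugraph set set \<Rightarrow> nat \<Rightarrow> real" where
  "ex_star_ratio \<F> n = real (ex_star n T \<F>) / real (n choose vT)"

text \<open>The averaging argument of Katona, Nemetz and Simonovits: an extremal collection on
  \<open>n\<close> vertices restricts to a free one on every \<open>m\<close>-subset, and each of
  its members survives in the same number of subsets.\<close>

lemma ex_star_ratio_antimono:
  assumes "{} \<notin> \<F>" "vT \<le> m" "m \<le> n"
  shows "ex_star_ratio \<F> n \<le> ex_star_ratio \<F> m"
proof -
  obtain C where C: "C \<subseteq> host n" "collection_free \<F> C" "card C = ex_star n T \<F>"
    using ex_star_attained[OF assms(1)] by blast
  have "card C * ((n - vT) choose (m - vT)) = (\<Sum>M\<in>msets n m. card {G \<in> C. verts G \<subseteq> M})"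
    by (rule sum_restrict[OF C(1) assms(2), symmetric])
  also have "\<dots> \<le> (\<Sum>M\<in>msets n m. ex_star m T \<F>)"
  proof (rule sum_mono)
    fix M assume M: "M \<in> msets n m"
    show "card {G \<in> C. verts G \<subseteq> M} \<le> ex_star m T \<F>"
      by (rule card_free_le[where M = M and n = n])
        (use M C collection_free_mono[OF C(2)] finite_subset[of M "{..<n}"] in \<open>auto simp: msets_def\<close>)
  qed
  also have "\<dots> = (n choose m) * ex_star m T \<F>" by (simp add: msets_finite)
  finally have 1: "ex_star n T \<F> * ((n - vT) choose (m - vT)) \<le> (n choose m) * ex_star m T \<F>"
    unfolding C(3) .
  have 2: "(n choose m) * (m choose vT) = (n choose vT) * ((n - vT) choose (m - vT))"
    by (rule choose_mult) (use assms in auto)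
  have pos: "0 < m choose vT" "0 < n choose vT" "0 < (n - vT) choose (m - vT)" using assms by auto
  have "(ex_star n T \<F> * (m choose vT)) * ((n - vT) choose (m - vT))
      = (ex_star n T \<F> * ((n - vT) choose (m - vT))) * (m choose vT)" by simp
  also have "\<dots> \<le> ((n choose m) * ex_star m T \<F>) * (m choose vT)" using 1 by (rule mult_le_mono1)
  also have "\<dots> = (ex_star m T \<F> * (n choose vT)) * ((n - vT) choose (m - vT))" using 2 by simp
  finally have "ex_star n T \<F> * (m choose vT) \<le> ex_star m T \<F> * (n choose vT)" using pos(3) by simp
  then have "real (ex_star n T \<F>) * real (m choose vT) \<le> real (ex_star m T \<F>) * real (n choose vT)"
    by (simp flip: of_nat_mult)
  then show ?thesis using pos by (simp add: ex_star_ratio_def divide_simps)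
qed

text \<open>A nonincreasing nonnegative sequence converges. Take \<open>m\<close> where it is within
  \<epsilon> of its limit, which bounds all later values from below.\<close>

lemma ex_star_ratio_cauchy:
  assumes "{} \<notin> \<F>" "0 < \<epsilon>"
  obtains m where "m0 \<le> m" "vT \<le> m" "\<And>n. m \<le> n \<Longrightarrow> ex_star_ratio \<F> m \<le> ex_star_ratio \<F> n + \<epsilon>"
proof -
  let ?X = "\<lambda>k. ex_star_ratio \<F> (k + vT)"
  have "decseq ?X" unfolding decseq_def using ex_star_ratio_antimono[OF assms(1)] by auto
  moreover have "\<forall>k. 0 \<le> ?X k" by (simp add: ex_star_ratio_def)
  ultimately obtain L where L: "?X \<longlonglongrightarrow> L" "\<forall>k. L \<le> ?X k"
    using decseq_convergent[of ?X 0] by blast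
  have "eventually (\<lambda>k. ?X k < L + \<epsilon>) sequentially"
    using L(1) assms(2) by (intro order_tendstoD(2)) auto
  then obtain k0 where k0: "\<And>k. k0 \<le> k \<Longrightarrow> ?X k < L + \<epsilon>" unfolding eventually_sequentially by blast
  define m where "m = max k0 m0 + vT"
  show thesis
  proof (rule that[of m])
    fix n assume "m \<le> n"
    then have "L \<le> ex_star_ratio \<F> n" using L(2)[rule_format, of "n - vT"] by (simp add: m_def)
    moreover have "ex_star_ratio \<F> m < L + \<epsilon>" using k0[of "max k0 m0"] by (simp add: m_def)
    ultimately show "ex_star_ratio \<F> m \<le> ex_star_ratio \<F> n + \<epsilon>" by simp
  qed (auto simp: m_def)
qed

text \<open>Erdos-Simonovits averaging: a positive proportion of the \<open>m\<close>-subsets must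
  span more than \<open>ex_star m\<close> members of \<open>D\<close>, so each of these contains a
  copy of some \<open>F\<close>. A fixed copy with \<open>u\<close> vertices is seen by only
  \<open>(n - u) choose (m - u)\<close> subsets, which leaves order \<open>n ^ u\<close> different
  ones.\<close>

lemma supersaturation:
  assumes fin: "finite \<F>"
    and F: "\<And>F. F \<in> \<F> \<Longrightarrow> F \<noteq> {} \<and> finite F \<and> (\<forall>G\<in>F. graph_iso T G)"
    and \<epsilon>: "0 < \<epsilon>"
  obtains \<delta> n0 where "0 < \<delta>"
    "\<And>n D. n0 \<le> n \<Longrightarrow> D \<subseteq> host n \<Longrightarrow> real (ex_star n T \<F>) + \<epsilon> * real n ^ vT \<le> real (card D) \<Longrightarrow>
      \<exists>F\<in>\<F>. \<delta> * real n ^ card (verts (union_graph F)) \<le> real (card {E. E \<subseteq> D \<and> collection_iso F E})"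
proof -
  let ?u = "\<lambda>F :: nat ugraph set. card (verts (union_graph F))"
  have ne: "{} \<notin> \<F>" using F by blast
  obtain m where m: "Max (insert 0 (?u ` \<F>)) \<le> m" "vT \<le> m"
    and ratio: "\<And>n. m \<le> n \<Longrightarrow> ex_star_ratio \<F> m \<le> ex_star_ratio \<F> n + \<epsilon> / 2"
    using ex_star_ratio_cauchy[OF ne, of "\<epsilon> / 2"] \<epsilon> by auto
  have u_le: "?u F \<le> m" if "F \<in> \<F>" for F
  proof -
    have "?u F \<le> Max (insert 0 (?u ` \<F>))" using that fin by (intro Max_ge) auto
    then show ?thesis using m(1) by simp
  qed
  have mpos: "0 < m" using m(2) vT_ge by simp
  \<comment> \<open>A good \<open>m\<close>-set spans at most \<open>m ^ vT\<close> copies, so the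
    excess of \<epsilon> / 2 in the ratio makes a proportion \<eta> of all \<open>m\<close>-sets
    good. In \<delta>, \<open>2 ^ m\<close> bounds a binomial coefficient of \<open>m\<close>,
    \<open>m ^ m\<close> compares a power of \<open>n\<close> with a binomial coefficient, and the 1
    added to \<open>card \<F>\<close> makes the last comparison strict, also for an empty
    family.\<close>
  define \<eta> where "\<eta> = \<epsilon> / (2 * real m ^ vT)"
  define \<delta> where "\<delta> = \<eta> / ((real (card \<F>) + 1) * 2 ^ m * real m ^ m)"
  have \<eta>: "0 < \<eta>" using \<epsilon> mpos by (simp add: \<eta>_def)
  have \<delta>: "0 < \<delta>" using \<eta> mpos by (simp add: \<delta>_def)
  show thesis
  proof (rule that[OF \<delta>, of m])
    fix n D assume n: "m \<le> n" and D: "D \<subseteq> host n"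
      and big: "real (ex_star n T \<F>) + \<epsilon> * real n ^ vT \<le> real (card D)"
    let ?DM = "\<lambda>M. {G \<in> D. verts G \<subseteq> M}"
    let ?S = "\<lambda>F. {E. E \<subseteq> D \<and> collection_iso F E}"
    define good where "good = {M \<in> msets n m. ex_star m T \<F> < card (?DM M)}"
    have finD: "finite D" using D finite_host finite_subset by auto
    have fin_good: "finite good" "good \<subseteq> msets n m" using msets_finite by (auto simp: good_def)
    have Mprop: "finite M" "card M = m" if "M \<in> msets n m" for M
      using that finite_subset[of M "{..<n}"] by (auto simp: msets_def)
    have pos: "0 < n choose vT" "0 < m choose vT" using m n by auto
    have "card D * ((n - vT) choose (m - vT)) = (\<Sum>M\<in>msets n m. card (?DM M))"
      by (rule sum_restrict[OF D m(2), symmetric])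
    also have "\<dots> \<le> (\<Sum>M\<in>msets n m. of_bool (M \<in> good) * m ^ vT + ex_star m T \<F>)"
    proof (rule sum_mono)
      fix M assume M: "M \<in> msets n m"
      have "card (?DM M) \<le> m ^ vT"
        by (rule card_in_subset_le[where M = M and n = n]) (use M Mprop D in auto)
      then show "card (?DM M) \<le> of_bool (M \<in> good) * m ^ vT + ex_star m T \<F>"
        using M by (auto simp: good_def)
    qed
    also have "\<dots> = card good * m ^ vT + (n choose m) * ex_star m T \<F>"
      using msets_finite fin_good
      by (simp add: sum.distrib Int_absorb1 flip: sum_distrib_right Int_def)
    finally have 1: "real (card D) * real ((n - vT) choose (m - vT))
        \<le> real (card good) * real m ^ vT + real (n choose m) * real (ex_star m T \<F>)"
      by (simp flip: of_nat_mult of_nat_add of_nat_power)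
    have cm: "real (n choose m) * real (m choose vT) = real (n choose vT) * real ((n - vT) choose (m - vT))"
      using choose_mult[OF m(2) n] by (simp flip: of_nat_mult)
    have "real (n choose m) * (real (ex_star m T \<F>) + real (m choose vT) * (\<epsilon> / 2))
        = real (n choose m) * real (m choose vT) * (ex_star_ratio \<F> m + \<epsilon> / 2)"
      using pos by (simp add: ex_star_ratio_def field_simps)
    also have "\<dots> \<le> real (n choose m) * real (m choose vT) * (ex_star_ratio \<F> n + \<epsilon>)"
      using ratio[OF n] by (intro mult_left_mono) auto
    also have "\<dots> = (real (ex_star n T \<F>) + real (n choose vT) * \<epsilon>) * real ((n - vT) choose (m - vT))"
      unfolding cm using pos by (simp add: ex_star_ratio_def field_simps)
    also have "\<dots> \<le> real (card D) * real ((n - vT) choose (m - vT))"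
    proof (rule mult_right_mono)
      have "real (n choose vT) \<le> real n ^ vT"
        using binomial_le_power[of n vT] by (simp flip: of_nat_power)
      then have "real (n choose vT) * \<epsilon> \<le> \<epsilon> * real n ^ vT" using \<epsilon> by (simp add: mult.commute)
      then show "real (ex_star n T \<F>) + real (n choose vT) * \<epsilon> \<le> real (card D)" using big by simp
    qed simp
    also note 1
    finally have "real (n choose m) * (real (m choose vT) * (\<epsilon> / 2)) \<le> real (card good) * real m ^ vT"
      by (simp add: algebra_simps)
    moreover have "real (n choose m) * (1 * (\<epsilon> / 2)) \<le> real (n choose m) * (real (m choose vT) * (\<epsilon> / 2))"
      using pos \<epsilon> by (intro mult_left_mono mult_right_mono) (auto simp: Suc_le_eq)
    ultimately have good_ge: "\<eta> * real (n choose m) \<le> real (card good)"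
      using mpos by (simp add: \<eta>_def field_simps)
    have "good \<subseteq> (\<Union>F\<in>\<F>. \<Union>E\<in>?S F. {M. verts (union_graph E) \<subseteq> M \<and> M \<subseteq> {..<n} \<and> card M = m})"
    proof
      fix M assume M: "M \<in> good"
      then have Mm: "M \<in> msets n m" and gt: "ex_star m T \<F> < card (?DM M)" by (auto simp: good_def)
      have "\<not> collection_free \<F> (?DM M)"
        using card_free_le[of "?DM M" n M m \<F>] Mprop[OF Mm] D gt by fastforce
      then obtain E F where EF: "E \<subseteq> ?DM M" "F \<in> \<F>" "collection_iso F E"
        unfolding collection_free_def by blast
      then have "E \<in> ?S F" "verts (union_graph E) \<subseteq> M" by auto
      moreover have "M \<subseteq> {..<n}" "card M = m" using Mm by (auto simp: msets_def)
      ultimately show "M \<in> (\<Union>F\<in>\<F>. \<Union>E\<in>?S F. {M. verts (union_graph E) \<subseteq> M \<and> M \<subseteq> {..<n} \<and> card M = m})"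
        using EF(2) by blast
    qed
    then have "card good \<le> card (\<Union>F\<in>\<F>. \<Union>E\<in>?S F. {M. verts (union_graph E) \<subseteq> M \<and> M \<subseteq> {..<n} \<and> card M = m})"
      using fin finD by (intro card_mono finite_UN_I) (auto intro: finite_subset[of _ "Pow {..<n}"])
    also have "\<dots> \<le> (\<Sum>F\<in>\<F>. card (\<Union>E\<in>?S F. {M. verts (union_graph E) \<subseteq> M \<and> M \<subseteq> {..<n} \<and> card M = m}))"
      by (rule card_UN_le[OF fin])
    also have "\<dots> \<le> (\<Sum>F\<in>\<F>. \<Sum>E\<in>?S F. card {M. verts (union_graph E) \<subseteq> M \<and> M \<subseteq> {..<n} \<and> card M = m})"
      using finD by (intro sum_mono card_UN_le) auto
    also have "\<dots> = (\<Sum>F\<in>\<F>. card (?S F) * ((n - ?u F) choose (m - ?u F)))"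
    proof (rule sum.cong[OF refl])
      fix F assume F': "F \<in> \<F>"
      have "card {M. verts (union_graph E) \<subseteq> M \<and> M \<subseteq> {..<n} \<and> card M = m} = (n - ?u F) choose (m - ?u F)"
        if E: "E \<in> ?S F" for E
      proof -
        obtain f where f: "inj_on f (verts (union_graph F))" "E = graph_image f ` F"
          using E unfolding collection_iso_def by auto
        have c: "card (verts (union_graph E)) = ?u F"
          unfolding f(2) verts_union_image by (rule card_image[OF f(1)])
        have "verts (union_graph E) \<subseteq> {..<n}" using E D hostD(2) by fastforce
        then show ?thesis
          using card_supersets_eq[of "{..<n}" "verts (union_graph E)" m] u_le[OF F'] by (simp add: c del: verts_union_graph)
      qed
      then show "(\<Sum>E\<in>?S F. card {M. verts (union_graph E) \<subseteq> M \<and> M \<subseteq> {..<n} \<and> card M = m})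
        = card (?S F) * ((n - ?u F) choose (m - ?u F))" by simp
    qed
    finally have 2: "real (card good) \<le> (\<Sum>F\<in>\<F>. real (card (?S F)) * real ((n - ?u F) choose (m - ?u F)))"
      by (simp flip: of_nat_mult of_nat_sum)
    show "\<exists>F\<in>\<F>. \<delta> * real n ^ ?u F \<le> real (card (?S F))"
    proof (rule ccontr)
      assume neg: "\<not> ?thesis"
      have "(\<Sum>F\<in>\<F>. real (card (?S F)) * real ((n - ?u F) choose (m - ?u F)))
        \<le> (\<Sum>F\<in>\<F>. \<eta> / (real (card \<F>) + 1) * real (n choose m))"
      proof (rule sum_mono)
        fix F assume F': "F \<in> \<F>"
        let ?v = "?u F" and ?r = "real ((n - ?u F) choose (m - ?u F))"
        have cm': "real (n choose m) * real (m choose ?v) = real (n choose ?v) * ?r"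
          using choose_mult[OF u_le[OF F'] n] by (simp flip: of_nat_mult)
        have upos: "0 < ?v"
        proof -
          obtain G where "G \<in> F" using F[OF F'] by blast
          then show ?thesis
            using card_union_iso(3)[OF simple_T, of F G] F[OF F'] vT_ge by force
        qed
        have vn: "?v \<le> n" using u_le[OF F'] n by simp
        have "real n ^ ?v \<le> real m ^ m * real (n choose ?v)"
        proof -
          have "real n ^ ?v = real ?v ^ ?v * (real n / real ?v) ^ ?v"
            using upos by (simp add: power_divide)
          also have "\<dots> \<le> real m ^ m * real (n choose ?v)"
          proof (rule mult_mono)
            have "real ?v ^ ?v \<le> real m ^ ?v" using u_le[OF F'] by (intro power_mono) auto
            also have "\<dots> \<le> real m ^ m" using u_le[OF F'] mpos by (intro power_increasing) auto
            finally show "real ?v ^ ?v \<le> real m ^ m" .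
            show "(real n / real ?v) ^ ?v \<le> real (n choose ?v)"
              using binomial_ge_n_over_k_pow_k[OF vn] by simp
          qed auto
          finally show ?thesis .
        qed
        then have "\<delta> * real n ^ ?v \<le> \<delta> * (real m ^ m * real (n choose ?v))"
          using \<delta> by (intro mult_left_mono) auto
        then have "real (card (?S F)) \<le> \<delta> * (real m ^ m * real (n choose ?v))" using neg F' by force
        then have "real (card (?S F)) * ?r \<le> \<delta> * (real m ^ m * real (n choose ?v)) * ?r"
          by (rule mult_right_mono) simp
        also have "\<dots> = \<delta> * real m ^ m * (real (n choose m) * real (m choose ?v))"
          unfolding cm' by simp
        also have "\<dots> \<le> \<delta> * real m ^ m * (real (n choose m) * 2 ^ m)"
        proof -
          have "m choose ?v \<le> 2 ^ m" by (rule binomial_le_pow2)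
          then have "real (m choose ?v) \<le> 2 ^ m" by (metis of_nat_le_iff of_nat_numeral of_nat_power)
          then show ?thesis using \<delta> by (intro mult_left_mono) auto
        qed
        also have "\<dots> = \<eta> / (real (card \<F>) + 1) * real (n choose m)"
        proof -
          define \<kappa> where "\<kappa> = real (card \<F>) + 1"
          have "0 < \<kappa>" by (simp add: \<kappa>_def)
          then show ?thesis unfolding \<delta>_def \<kappa>_def[symmetric] using mpos by (simp add: field_simps)
        qed
        finally show "real (card (?S F)) * ?r \<le> \<eta> / (real (card \<F>) + 1) * real (n choose m)" .
      qed
      also have "\<dots> = real (card \<F>) / (real (card \<F>) + 1) * (\<eta> * real (n choose m))" by simp
      also have "\<dots> < 1 * (\<eta> * real (n choose m))"
        using \<eta> n by (intro mult_strict_right_mono) auto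
      finally show False using 2 good_ge by simp
    qed
  qed
qed

end

section \<open>Containers for free collections\<close>

context pattern_graph
begin

text \<open>The hypergraph of copies of \<open>F\<close> satisfies the degree condition of the container lemma with
  \<open>\<tau> = n powr (- eT / m)\<close>; this is what the bound on the \<open>T\<close>-density is for.\<close>

lemma copies_degree_le:
  assumes n: "0 < n" and D: "D \<subseteq> host n" and m: "0 < m"
    and F: "finite F" "\<And>G. G \<in> F \<Longrightarrow> graph_iso T G"
      "\<And>G G'. G \<in> F \<Longrightarrow> G' \<in> F \<Longrightarrow> G \<noteq> G' \<Longrightarrow> edges G \<inter> edges G' = {}"
    and dens: "T_density T F \<le> ennreal m" and A: "A \<subseteq> D" "A \<noteq> {}"
  shows "real (card {E. E \<subseteq> D \<and> A \<subseteq> E \<and> collection_iso F E})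
    \<le> real (type_bound (card (verts (union_graph F)))) * real n powr (real (card (verts (union_graph F))) - real vT)
      * (real n powr (- real eT / m)) ^ (card A - 1)"
proof (cases "{E. E \<subseteq> D \<and> A \<subseteq> E \<and> collection_iso F E} = {}")
  case True
  then show ?thesis by (simp only: card.empty) simp
next
  case False
  let ?u = "card (verts (union_graph F))"
  obtain E where E: "E \<subseteq> D" "A \<subseteq> E" "collection_iso F E" using False by blast
  then obtain f where f: "inj_on f (verts (union_graph F))" "E = graph_image f ` F"
    unfolding collection_iso_def by (elim exE conjE)
  define F' where "F' = {G \<in> F. graph_image f G \<in> A}"
  have A_eq: "A = graph_image f ` F'" using E(2) f(2) by (auto simp: F'_def)
  have F': "F' \<subseteq> F" by (auto simp: F'_def)
  have finF': "finite F'" using F(1) by (simp add: F'_def)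
  have w: "\<And>G. G \<in> F \<Longrightarrow> \<forall>e\<in>edges G. e \<subseteq> verts G"
    using simple_graph_edgeD(1)[OF graph_iso_simple(1)[OF simple_T F(2)]] by blast
  have injF': "inj_on f (verts (union_graph F'))" using F' by (intro inj_on_subset[OF f(1)]) auto
  have w': "\<And>G. G \<in> F' \<Longrightarrow> \<forall>e\<in>edges G. e \<subseteq> verts G" using w F' by blast
  have cA: "card A = card F'" and vA: "card (verts (union_graph A)) = card (verts (union_graph F'))"
    unfolding A_eq using card_union_image[OF injF' w'] by auto
  have isoF': "\<And>G. G \<in> F' \<Longrightarrow> graph_iso T G" using F(2) F' by auto
  note cF' = card_union_iso[OF simple_T finF' isoF']
  have F'ne: "F' \<noteq> {}" using A(2) A_eq by auto
  then obtain G where G: "G \<in> F'" by blast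
  have card1: "1 \<le> card F'" using F'ne finF' by (simp add: Suc_le_eq card_gt_0_iff)
  \<comment> \<open>For two or more copies this is the density bound. \<open>T_density\<close> does
    not look at single copies; for one the left side is 0.\<close>
  have dens': "(real (card F') - 1) * real eT \<le> m * (real (card (verts (union_graph F'))) - real vT)"
  proof (cases "2 \<le> card F'")
    case True
    have e: "card (edges (union_graph F')) = card F' * eT"
      by (rule card_edges_disjoint_union[OF simple_T finF' isoF']) (use F(3) F' in auto)
    have "real (card (edges (union_graph F')) - eT) \<le> m * real (card (verts (union_graph F')) - vT)"
      using dens T_density_le_iff[of m T F] m F' True by auto
    moreover have "real (card (edges (union_graph F')) - eT) = (real (card F') - 1) * real eT"
    proof -
      have "real (card (edges (union_graph F')) - eT) = real (card (edges (union_graph F'))) - real eT"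
        using cF'(4)[OF _ G] by (rule of_nat_diff) simp
      then show ?thesis unfolding e by (simp add: algebra_simps)
    qed
    moreover have "real (card (verts (union_graph F')) - vT) = real (card (verts (union_graph F'))) - real vT"
      using cF'(3)[OF _ G] by (rule of_nat_diff) simp
    ultimately show ?thesis by simp
  next
    case False
    then have "card F' = 1" using card1 by simp
    then show ?thesis using cF'(3)[OF _ G] m by simp
  qed
  have uA: "card (verts (union_graph F')) \<le> ?u"
  proof (rule card_mono)
    show "finite (verts (union_graph F))" by (rule card_union_iso[OF simple_T F(1,2)])
  qed (use F' in auto)
  have "card {E. E \<subseteq> D \<and> A \<subseteq> E \<and> collection_iso F E}
      \<le> card {E. E \<subseteq> D \<and> A \<subseteq> E \<and> card (verts (union_graph E)) = ?u}"
  proof (rule card_mono)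
    show "finite {E. E \<subseteq> D \<and> A \<subseteq> E \<and> card (verts (union_graph E)) = ?u}"
      using finite_subset[OF D finite_host] by simp
    show "{E. E \<subseteq> D \<and> A \<subseteq> E \<and> collection_iso F E} \<subseteq> {E. E \<subseteq> D \<and> A \<subseteq> E \<and> card (verts (union_graph E)) = ?u}"
    proof clarify
      fix E assume "collection_iso F E"
      then obtain f where f: "inj_on f (verts (union_graph F))" "E = graph_image f ` F"
        unfolding collection_iso_def by (elim exE conjE)
      show "card (verts (union_graph E)) = ?u" unfolding f(2) verts_union_image by (rule card_image[OF f(1)])
    qed
  qed
  also have "\<dots> \<le> type_bound ?u * card {..<n} ^ (?u - card (verts (union_graph A)))"
  proof (rule card_collections_le[OF _ A(1)])
    fix G assume "G \<in> D"
    then have "G \<in> host n" using D by blast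
    then show "verts G \<subseteq> {..<n} \<and> (\<forall>e\<in>edges G. e \<subseteq> verts G)" using hostD(2,10) by simp
  qed simp
  finally have "real (card {E. E \<subseteq> D \<and> A \<subseteq> E \<and> collection_iso F E})
      \<le> real (type_bound ?u) * real n ^ (?u - card (verts (union_graph F')))"
    unfolding vA by (simp del: verts_union_graph flip: of_nat_mult of_nat_power)
  also have "real n ^ (?u - card (verts (union_graph F'))) = real n powr (real ?u - real (card (verts (union_graph F'))))"
    using n uA by (simp add: powr_realpow[symmetric] of_nat_diff del: verts_union_graph)
  also have "\<dots> \<le> real n powr (real ?u - real vT - real eT / m * (real (card A) - 1))"
  proof (rule powr_mono)
    have "(real (card F') - 1) * real eT / m \<le> real (card (verts (union_graph F'))) - real vT"
      using dens' m by (simp add: pos_divide_le_eq mult.commute)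
    then show "real ?u - real (card (verts (union_graph F'))) \<le> real ?u - real vT - real eT / m * (real (card A) - 1)"
      unfolding cA by (simp add: mult.commute)
  qed (use n in simp)
  also have "\<dots> = real n powr (real ?u - real vT) * (real n powr (- real eT / m)) ^ (card A - 1)"
  proof -
    have "(real n powr (- real eT / m)) ^ (card A - 1) = real n powr (real (card A - 1) * (- real eT / m))"
      using n by (intro powr_power) simp
    also have "real (card A - 1) = real (card A) - 1" using card1 cA by simp
    finally show ?thesis using n by (simp add: powr_add[symmetric] algebra_simps)
  qed
  finally show ?thesis by (simp add: mult.assoc mult_left_mono)
qed

text \<open>As long as a container exceeds the target size, supersaturation finds one
  \<open>F\<close> with many copies inside it, and the container lemma for the hypergraph of these
  copies removes a constant proportion of \<open>n ^ vT\<close>. So a bounded number of rounds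
  suffices, and the fingerprints of all rounds together keep the order of a single one.\<close>

lemma free_containers:
  assumes fin: "finite \<F>" and \<epsilon>: "0 < \<epsilon>" and m: "real eT / real vT \<le> m"
    and F: "\<And>F. F \<in> \<F> \<Longrightarrow> F \<noteq> {} \<and> finite F \<and> (\<forall>G\<in>F. graph_iso T G) \<and> T_density T F \<le> ennreal m
      \<and> (\<forall>G\<in>F. \<forall>G'\<in>F. G \<noteq> G' \<longrightarrow> edges G \<inter> edges G' = {})"
  obtains C n0 where "0 < C" "\<And>n. n0 \<le> n \<Longrightarrow>
    container_scheme (host n) (collection_free \<F>) (C * real n powr (real vT - real eT / m))
      (real (ex_star n T \<F>) + \<epsilon> * real n ^ vT)"
proof -
  let ?u = "\<lambda>F :: nat ugraph set. card (verts (union_graph F))"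
  have m0: "0 < m" using m vT_ge eT_ge by (smt (verit) divide_pos_pos of_nat_0_less_iff zero_less_numeral less_le_trans)
  have Fc: "F \<noteq> {} \<and> finite F \<and> (\<forall>G\<in>F. graph_iso T G)" if "F \<in> \<F>" for F
    using F[OF that] by (elim conjE) (intro conjI)
  obtain \<delta> n0 where \<delta>: "0 < \<delta>" and
    super: "\<And>n D. n0 \<le> n \<Longrightarrow> D \<subseteq> host n \<Longrightarrow> real (ex_star n T \<F>) + \<epsilon> * real n ^ vT \<le> real (card D) \<Longrightarrow>
      \<exists>F\<in>\<F>. \<delta> * real n ^ ?u F \<le> real (card {E. E \<subseteq> D \<and> collection_iso F E})"
    by (rule supersaturation[OF fin Fc \<epsilon>], assumption, rule that)
  \<comment> \<open>Normalised so that, with the \<open>b\<close> of the degree bound,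
    \<open>d F * N * b\<close> is the number of copies of \<open>F\<close> that supersaturation
    supplies.\<close>
  define d where "d F = \<delta> / real (type_bound (?u F))" for F
  have tb: "0 < real (type_bound k)" for k by (simp add: type_bound_def)
  \<comment> \<open>The container lemma with its two constants exposed, so that they can be chosen
    as functions of \<open>F\<close>.\<close>
  define Q where "Q F C c \<longleftrightarrow> 0 < C \<and> 0 < c \<and> (\<forall>(X :: nat ugraph set) w \<tau> N b.
    finite X \<longrightarrow> real (card X) \<le> N \<longrightarrow> 0 < \<tau> \<longrightarrow> 1 \<le> \<tau> * N \<longrightarrow> 0 < b \<longrightarrow>
    (\<forall>E. 0 \<le> w E) \<longrightarrow> (\<forall>E. w E \<noteq> 0 \<longrightarrow> card E = card F) \<longrightarrow>
    (\<forall>A. A \<subseteq> X \<and> A \<noteq> {} \<longrightarrow> wdeg X w A \<le> b * \<tau> ^ (card A - 1)) \<longrightarrow>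
    d F * N * b \<le> wdeg X w {} \<longrightarrow>
    container_scheme X (\<lambda>I. \<forall>E. E \<subseteq> I \<longrightarrow> w E = 0) (C * \<tau> * N) (real (card X) - c * N))"
    for F :: "nat ugraph set" and C c :: real
  have "\<exists>C c. Q F C c" for F
  proof -
    have "0 < d F" using \<delta> tb by (simp add: d_def)
    from hypergraph_container[OF this, of "card F"] show ?thesis
      unfolding Q_def by (elim exE conjE) (intro exI conjI)
  qed
  then obtain Cf cf where Q: "\<And>F. Q F (Cf F) (cf F)" by metis
  have Cc: "0 < Cf F" "0 < cf F" for F using Q[of F] unfolding Q_def by simp_all
  have cont: "container_scheme X (\<lambda>I. \<forall>E. E \<subseteq> I \<longrightarrow> w E = 0) (Cf F * \<tau> * N) (real (card X) - cf F * N)"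
    if "finite X" "real (card X) \<le> N" "0 < \<tau>" "1 \<le> \<tau> * N" "0 < b"
      "\<forall>E. 0 \<le> w E" "\<forall>E. w E \<noteq> 0 \<longrightarrow> card E = card F"
      "\<forall>A. A \<subseteq> X \<and> A \<noteq> {} \<longrightarrow> wdeg X w A \<le> b * \<tau> ^ (card A - 1)"
      "d F * N * b \<le> wdeg X w {}"
    for F and X :: "nat ugraph set" and w \<tau> N b
    using Q[of F] that unfolding Q_def by simp
  \<comment> \<open>Constants that serve all \<open>F\<close> in the family; the 1 keeps them
    positive for an empty family.\<close>
  define C where "C = 1 + sum Cf \<F>"
  define c where "c = Min (insert 1 (cf ` \<F>))"
  have C: "0 < C" "\<And>F. F \<in> \<F> \<Longrightarrow> Cf F \<le> C"
  proof -
    have "0 \<le> sum Cf \<F>" using Cc by (intro sum_nonneg) (auto intro: less_imp_le)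
    then show "0 < C" by (simp add: C_def)
    fix F assume "F \<in> \<F>"
    then have "Cf F \<le> sum Cf \<F>" using fin Cc by (intro member_le_sum) (auto intro: less_imp_le)
    then show "Cf F \<le> C" by (simp add: C_def)
  qed
  have c: "0 < c" "\<And>F. F \<in> \<F> \<Longrightarrow> c \<le> cf F"
    unfolding c_def using fin Cc by (auto intro: Min_le)
  \<comment> \<open>Each round removes \<open>c * N\<close> copies and there are at most
    \<open>N\<close>, so this many rounds are enough.\<close>
  define r0 where "r0 = nat \<lceil>1 / c\<rceil>"
  show thesis
  proof (rule that[of "(real r0 + 1) * C" "max 1 n0"])
    show "0 < (real r0 + 1) * C" using C by (intro mult_pos_pos) auto
    fix n assume n: "max 1 n0 \<le> n"
    define N where "N = real n ^ vT"
    define \<tau> where "\<tau> = real n powr (- real eT / m)"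
    have npos: "0 < n" using n by simp
    have N: "0 < N" using npos by (simp add: N_def)
    have \<tau>: "0 < \<tau>" using npos by (simp add: \<tau>_def)
    have \<tau>N_eq: "\<tau> * N = real n powr (real vT - real eT / m)"
      using npos by (simp add: \<tau>_def N_def powr_realpow[symmetric] powr_add[symmetric])
    have "real eT / m \<le> real vT"
      using m m0 vT_ge by (simp add: divide_simps mult.commute)
    then have \<tau>N: "1 \<le> \<tau> * N" unfolding \<tau>N_eq using npos by (intro ge_one_powr_ge_zero) auto
    let ?t = "real (ex_star n T \<F>) + \<epsilon> * N"
    have step: "container_scheme D (collection_free \<F>) (C * (\<tau> * N)) (real (card D) - c * N)"
      if D: "D \<subseteq> host n" "?t \<le> real (card D)" for D
    proof -
      have finD: "finite D" by (rule finite_subset[OF D(1) finite_host])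
      obtain F where F': "F \<in> \<F>" and many: "\<delta> * real n ^ ?u F \<le> real (card {E. E \<subseteq> D \<and> collection_iso F E})"
        using super[of n D] n D by (auto simp: N_def)
      note FF = F[OF F']
      define b where "b = real (type_bound (?u F)) * real n powr (real (?u F) - real vT)"
      have b: "0 < b" using npos tb by (simp add: b_def)
      define w where "w E = (of_bool (E \<subseteq> D \<and> collection_iso F E) :: real)" for E
      have wdeg_eq: "wdeg D w A = real (card {E. E \<subseteq> D \<and> A \<subseteq> E \<and> collection_iso F E})" for A
      proof -
        have "wdeg D w A = (\<Sum>E\<in>{E. E \<subseteq> D \<and> A \<subseteq> E \<and> collection_iso F E}. 1)"
          unfolding wdeg_def w_def by (rule sum.mono_neutral_cong_right) (use finD in auto)
        then show ?thesis by simp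
      qed
      have "container_scheme D (\<lambda>I. \<forall>E. E \<subseteq> I \<longrightarrow> w E = 0) (Cf F * \<tau> * N) (real (card D) - cf F * N)"
      proof (rule cont[OF finD _ \<tau> \<tau>N b])
        have "card D \<le> card (host n)" using card_mono[OF finite_host D(1)] .
        then have "card D \<le> n ^ vT" using card_host_le[of n] by simp
        then show "real (card D) \<le> N" unfolding N_def by (metis of_nat_le_iff of_nat_power)
        show "\<forall>E. 0 \<le> w E" by (simp add: w_def)
        show "\<forall>E. w E \<noteq> 0 \<longrightarrow> card E = card F"
        proof (intro allI impI)
          fix E assume "w E \<noteq> 0"
          then have "collection_iso F E" by (simp add: w_def split: if_splits)
          then obtain f where f: "inj_on f (verts (union_graph F))" "E = graph_image f ` F"
            unfolding collection_iso_def by (elim exE conjE)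
          show "card E = card F" unfolding f(2)
            by (rule card_union_image(1)[OF f(1)])
              (use FF simple_graph_edgeD(1)[OF graph_iso_simple(1)[OF simple_T]] in blast)
        qed
        show "\<forall>A. A \<subseteq> D \<and> A \<noteq> {} \<longrightarrow> wdeg D w A \<le> b * \<tau> ^ (card A - 1)"
        proof (intro allI impI; elim conjE)
          fix A assume A: "A \<subseteq> D" "A \<noteq> {}"
          show "wdeg D w A \<le> b * \<tau> ^ (card A - 1)"
            unfolding wdeg_eq b_def \<tau>_def
            by (rule copies_degree_le[OF npos D(1) m0 _ _ _ _ A]) (use FF in auto)
        qed
        have "d F * N * b = \<delta> * real n ^ ?u F"
          using npos tb[of "?u F"]
          by (simp add: d_def b_def N_def powr_diff powr_realpow)
        then show "d F * N * b \<le> wdeg D w {}" using many by (simp add: wdeg_eq)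
      qed
      then show ?thesis
      proof (rule container_scheme_mono)
        fix I assume I: "I \<subseteq> D" "collection_free \<F> I"
        then show "\<forall>E. E \<subseteq> I \<longrightarrow> w E = 0" using F' by (auto simp: w_def collection_free_def)
      next
        have "Cf F * (\<tau> * N) \<le> C * (\<tau> * N)" using C(2)[OF F'] \<tau> N by (intro mult_right_mono) auto
        then show "Cf F * \<tau> * N \<le> C * (\<tau> * N)" by (simp add: mult.assoc)
        show "real (card D) - cf F * N \<le> real (card D) - c * N"
          using c(2)[OF F'] N by (simp add: mult_right_mono)
      qed
    qed
    have iter: "container_scheme D (collection_free \<F>) (real r * (C * (\<tau> * N))) ?t"
      if "D \<subseteq> host n" "real (card D) \<le> ?t + real r * (c * N)" for r D
      using that
    proof (induction r arbitrary: D)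
      case 0
      then show ?case by (intro container_scheme_trivial) auto
    next
      case (Suc r)
      show ?case
      proof (cases "?t \<le> real (card D)")
        case True
        have "container_scheme D (collection_free \<F>) (C * (\<tau> * N) + real r * (C * (\<tau> * N))) ?t"
        proof (rule container_scheme_bind[OF step[OF Suc.prems(1) True]])
          fix E assume E: "E \<subseteq> D" "real (card E) \<le> real (card D) - c * N"
          show "container_scheme E (collection_free \<F>) (real r * (C * (\<tau> * N))) ?t"
            by (rule Suc.IH) (use E Suc.prems in \<open>auto simp: algebra_simps\<close>)
        qed
        then show ?thesis by (simp add: algebra_simps)
      next
        case False
        then show ?thesis using C \<tau>N by (intro container_scheme_trivial) auto
      qed
    qed
    have "container_scheme (host n) (collection_free \<F>) (real r0 * (C * (\<tau> * N))) ?t"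
    proof (rule iter)
      have "real (card (host n)) \<le> N"
        using card_host_le[of n] unfolding N_def by (metis of_nat_le_iff of_nat_power)
      also have "\<dots> \<le> real r0 * (c * N)"
      proof -
        have "1 / c \<le> real r0" unfolding r0_def by linarith
        then have "1 \<le> real r0 * c" using c(1) by (simp add: pos_divide_le_eq)
        then have "1 * N \<le> real r0 * c * N" using N by (intro mult_right_mono) auto
        then show ?thesis by (simp add: mult.assoc)
      qed
      also have "\<dots> \<le> ?t + real r0 * (c * N)" using \<epsilon> N by simp
      finally show "real (card (host n)) \<le> ?t + real r0 * (c * N)" .
    qed simp
    then show "container_scheme (host n) (collection_free \<F>) ((real r0 + 1) * C * real n powr (real vT - real eT / m))
      (real (ex_star n T \<F>) + \<epsilon> * real n ^ vT)"
    proof (rule container_scheme_mono)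
      show "real r0 * (C * (\<tau> * N)) \<le> (real r0 + 1) * C * real n powr (real vT - real eT / m)"
        unfolding \<tau>N_eq[symmetric] using C \<tau>N by (simp add: algebra_simps)
    qed (auto simp: N_def)
  qed
qed

end

section \<open>Free collections in the random graph\<close>

text \<open>Write \<open>A ^ j\<close> as \<open>x ^ j * (A / x) ^ j\<close> and bound
  \<open>x ^ j\<close> by \<open>x powr s\<close>. The left side is a sum over fingerprint sizes;
  for \<open>x\<close> of the order of \<open>A / s\<close> the bound is exponential in
  \<open>s\<close> up to a factor \<open>ln x\<close> in the exponent.\<close>

lemma partial_exp_sum_le:
  fixes A x s :: real
  assumes "0 \<le> A" "1 \<le> x" "real k \<le> s"
  shows "(\<Sum>j\<le>k. A ^ j / fact j) \<le> x powr s * exp (A / x)"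
proof -
  have "(\<Sum>j\<le>k. A ^ j / fact j) \<le> (\<Sum>j\<le>k. x powr s * ((A / x) ^ j / fact j))"
  proof (rule sum_mono)
    fix j assume "j \<in> {..k}"
    then have "x ^ j \<le> x powr s"
      using assms by (simp add: powr_realpow[symmetric] powr_mono)
    then have "x ^ j * ((A / x) ^ j / fact j) \<le> x powr s * ((A / x) ^ j / fact j)"
      using assms by (intro mult_right_mono) auto
    then show "A ^ j / fact j \<le> x powr s * ((A / x) ^ j / fact j)"
      using assms by (simp add: power_divide)
  qed
  also have "\<dots> = x powr s * (\<Sum>j\<le>k. (A / x) ^ j / fact j)" by (simp add: sum_distrib_left)
  also have "(\<Sum>j\<le>k. (A / x) ^ j / fact j) \<le> exp (A / x)"
  proof -
    have "(\<Sum>j\<le>k. (A / x) ^ j / fact j) = (\<Sum>j\<in>{..k}. inverse (fact j) * (A / x) ^ j)"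
      by (simp add: field_simps)
    also have "\<dots> \<le> (\<Sum>j. inverse (fact j) * (A / x) ^ j)"
      using assms by (intro sum_le_suminf summable_exp) auto
    also have "\<dots> = exp (A / x)" by (simp add: exp_def scaleR_conv_of_real field_simps)
    finally show ?thesis .
  qed
  finally show ?thesis by (simp add: mult_left_mono)
qed

lemma types_upto_ge_1: "1 \<le> types_upto k"
proof -
  have "real (type_bound 0) \<le> types_upto k"
    unfolding types_upto_def by (rule member_le_sum) auto
  then show ?thesis by (simp add: type_bound_def)
qed

lemma finite_complete_edges: "finite (edges (complete_graph n))"
  by (rule finite_subset[of _ "Pow {..<n}"]) (auto simp: complete_graph_def)

context pattern_graph
begin

abbreviation present :: "nat \<Rightarrow> nat set set \<Rightarrow> nat ugraph set" where
  "present n R \<equiv> {G \<in> host n. edges G \<subseteq> R}"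

text \<open>Chebyshev's inequality. Edge-disjoint copies are uncorrelated, so the variance is at
  most the sum over overlapping pairs.\<close>

lemma card_present_deviation:
  assumes p: "0 \<le> p" "p \<le> 1" and D: "D \<subseteq> host n" and t: "0 < t"
    and Q: "(\<Sum>a\<in>D. \<Sum>b\<in>D. of_bool (edges a \<inter> edges b \<noteq> {}) * p ^ card (edges a \<union> edges b)) \<le> Q"
  shows "bprob (edges (complete_graph n)) p
    (\<lambda>R. t \<le> \<bar>real (card {G \<in> D. edges G \<subseteq> R}) - real (card D) * p ^ eT\<bar>) \<le> Q / t^2"
proof -
  let ?A = "edges (complete_graph n)"
  let ?Y = "\<lambda>G R. of_bool (edges G \<subseteq> R) - p ^ eT"
  have finA: "finite ?A" by (rule finite_complete_edges)
  have finD: "finite D" by (rule finite_subset[OF D finite_host])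
  have X: "real (card {G \<in> D. edges G \<subseteq> R}) - real (card D) * p ^ eT = (\<Sum>G\<in>D. ?Y G R)" for R
    using finD by (simp add: sum_subtractf Int_def)
  have E1: "bexp ?A p (\<lambda>R. of_bool (B \<subseteq> R)) = p ^ card B" if "B \<subseteq> ?A" for B
    using bprob_superset[OF finA that] by (simp add: bprob_def)
  have cov: "bexp ?A p (\<lambda>R. ?Y a R * ?Y b R)
      \<le> of_bool (edges a \<inter> edges b \<noteq> {}) * p ^ card (edges a \<union> edges b)" if "a \<in> D" "b \<in> D" for a b
  proof -
    have ab: "a \<in> host n" "b \<in> host n" using that D by auto
    note a = hostD[OF ab(1)] and b = hostD[OF ab(2)]
    have "bexp ?A p (\<lambda>R. ?Y a R * ?Y b R) = bexp ?A p (\<lambda>R. of_bool (edges a \<union> edges b \<subseteq> R)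
        - p ^ eT * of_bool (edges a \<subseteq> R) - p ^ eT * of_bool (edges b \<subseteq> R) + p ^ eT * p ^ eT)"
      by (rule bexp_cong) (auto simp: algebra_simps)
    also have "\<dots> = p ^ card (edges a \<union> edges b) - p ^ eT * p ^ eT"
      unfolding bexp_add bexp_diff bexp_cmult bexp_const[OF finA]
      using E1[of "edges a \<union> edges b"] E1[of "edges a"] E1[of "edges b"] a b by simp
    finally have *: "bexp ?A p (\<lambda>R. ?Y a R * ?Y b R) = p ^ card (edges a \<union> edges b) - p ^ eT * p ^ eT" .
    show ?thesis
    proof (cases "edges a \<inter> edges b = {}")
      case True
      then have "card (edges a \<union> edges b) = eT + eT" using a b by (simp add: card_Un_disjoint)
      then show ?thesis unfolding * using True by (simp add: power_add)
    next
      case False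
      then show ?thesis unfolding * using p by simp
    qed
  qed
  have "bprob ?A p (\<lambda>R. t \<le> \<bar>real (card {G \<in> D. edges G \<subseteq> R}) - real (card D) * p ^ eT\<bar>)
      \<le> bprob ?A p (\<lambda>R. t^2 \<le> (\<Sum>G\<in>D. ?Y G R)^2)"
    unfolding X by (rule bprob_mono[OF p]) (use t in \<open>auto simp: abs_le_square_iff[symmetric]\<close>)
  also have "\<dots> \<le> bexp ?A p (\<lambda>R. (\<Sum>G\<in>D. ?Y G R)^2) / t^2"
    by (rule bprob_markov[OF p]) (use t in auto)
  also have "bexp ?A p (\<lambda>R. (\<Sum>G\<in>D. ?Y G R)^2) = (\<Sum>a\<in>D. \<Sum>b\<in>D. bexp ?A p (\<lambda>R. ?Y a R * ?Y b R))"
    unfolding bexp_sum[symmetric] by (rule bexp_cong) (simp only: power2_eq_square sum_product)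
  also have "\<dots> \<le> Q"
    using cov by (intro order_trans[OF sum_mono[OF sum_mono] Q]) auto
  finally show ?thesis using t by (simp add: divide_right_mono)
qed

section \<open>Typical edge sets and the sum over fingerprints\<close>

definition embeddings_into :: "nat \<Rightarrow> 'a set set \<Rightarrow> nat set set \<Rightarrow> ('a \<Rightarrow> nat) set" where
  "embeddings_into n J U = {\<phi> \<in> embeddings n. \<forall>e\<in>J. \<phi> ` e \<in> U}"

text \<open>Every edge set \<open>J\<close> of \<open>T\<close> has at most \<open>K\<close> times
  the expected order of embeddings into \<open>U\<close>. As \<open>U\<close> occurs only in an
  upper bound, the condition passes to subsets.\<close>

definition typical :: "nat \<Rightarrow> real \<Rightarrow> real \<Rightarrow> nat set set \<Rightarrow> bool" where
  "typical n p K U \<longleftrightarrow>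
    (\<forall>J. J \<subseteq> edges T \<longrightarrow> real (card (embeddings_into n J U)) \<le> K * real n ^ vT * p ^ card J)"

lemma finite_embeddings_into: "finite (embeddings_into n J U)"
  using finite_embeddings by (simp add: embeddings_into_def)

lemma typical_mono:
  assumes "typical n p K U'" "U \<subseteq> U'"
  shows "typical n p K U"
  unfolding typical_def
proof (intro allI impI)
  fix J assume J: "J \<subseteq> edges T"
  have "card (embeddings_into n J U) \<le> card (embeddings_into n J U')"
    by (rule card_mono[OF finite_embeddings_into]) (use assms(2) in \<open>auto simp: embeddings_into_def\<close>)
  then show "real (card (embeddings_into n J U)) \<le> K * real n ^ vT * p ^ card J"
    using assms(1)[unfolded typical_def, rule_format, OF J] by linarith
qed

lemma embedding_edges:
  assumes "\<phi> \<in> embeddings n" "J \<subseteq> edges T"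
  shows "card ((\<lambda>e. \<phi> ` e) ` J) = card J" "(\<lambda>e. \<phi> ` e) ` J \<subseteq> edges (complete_graph n)"
    "inj_on (\<lambda>e. \<phi> ` e) (edges T)"
proof -
  have inj: "inj_on \<phi> (verts T)" and im: "\<phi> ` verts T \<subseteq> {..<n}" using assms(1) by (auto simp: embeddings_def)
  show i: "inj_on (\<lambda>e. \<phi> ` e) (edges T)"
    by (rule inj_on_image_sets[OF inj]) (use simple_graph_edgeD[OF simple_T] in auto)
  show "card ((\<lambda>e. \<phi> ` e) ` J) = card J" by (rule card_image[OF inj_on_subset[OF i assms(2)]])
  show "(\<lambda>e. \<phi> ` e) ` J \<subseteq> edges (complete_graph n)"
  proof
    fix e' assume "e' \<in> (\<lambda>e. \<phi> ` e) ` J"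
    then obtain e where e: "e \<in> edges T" "e' = \<phi> ` e" using assms(2) by auto
    note d = simple_graph_edgeD[OF simple_T e(1)]
    have "card e' = 2" unfolding e(2) using card_image[OF inj_on_subset[OF inj d(1)]] d(2) by simp
    moreover have "e' \<subseteq> {..<n}" using e d im by blast
    ultimately show "e' \<in> edges (complete_graph n)" by (simp add: complete_graph_def)
  qed
qed

text \<open>A first moment bound for each of the \<open>2 ^ eT\<close> edge sets \<open>J\<close>.
  Markov's inequality is good enough, since \<open>K\<close> may tend to infinity slowly.\<close>

lemma atypical_prob:
  assumes p: "0 < p" "p \<le> 1" and n: "0 < n" and K: "0 < K"
  shows "bprob (edges (complete_graph n)) p (\<lambda>R. \<not> typical n p K R) \<le> 2 ^ eT / K"
proof -
  let ?A = "edges (complete_graph n)"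
  have finT: "finite (edges T)" using simple_graph_finite[OF simple_T] by simp
  have p': "0 \<le> p" using p by simp
  have "bprob ?A p (\<lambda>R. \<not> typical n p K R)
    \<le> bprob ?A p (\<lambda>R. \<exists>J\<in>Pow (edges T). K * real n ^ vT * p ^ card J \<le> real (card (embeddings_into n J R)))"
    by (rule bprob_mono[OF p' p(2)]) (auto simp: typical_def not_le intro: less_imp_le)
  also have "\<dots> \<le> (\<Sum>J\<in>Pow (edges T). bprob ?A p (\<lambda>R. K * real n ^ vT * p ^ card J \<le> real (card (embeddings_into n J R))))"
    by (rule bprob_Bex[OF p' p(2)]) (use finT in simp)
  also have "\<dots> \<le> (\<Sum>J\<in>Pow (edges T). 1 / K)"
  proof (rule sum_mono)
    fix J assume J: "J \<in> Pow (edges T)"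
    have pos: "0 < K * real n ^ vT * p ^ card J" using K n p by simp
    have "bexp ?A p (\<lambda>R. real (card (embeddings_into n J R)))
      = bexp ?A p (\<lambda>R. \<Sum>\<phi>\<in>embeddings n. of_bool ((\<lambda>e. \<phi> ` e) ` J \<subseteq> R))"
    proof (rule bexp_cong)
      fix R
      have "embeddings_into n J R = embeddings n \<inter> {\<phi>. (\<lambda>e. \<phi> ` e) ` J \<subseteq> R}"
        by (auto simp: embeddings_into_def)
      then show "real (card (embeddings_into n J R)) = (\<Sum>\<phi>\<in>embeddings n. of_bool ((\<lambda>e. \<phi> ` e) ` J \<subseteq> R))"
        using finite_embeddings by simp
    qed
    also have "\<dots> = (\<Sum>\<phi>\<in>embeddings n. p ^ card J)"
      unfolding bexp_sum
    proof (rule sum.cong[OF refl])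
      fix \<phi> assume "\<phi> \<in> embeddings n"
      then show "bexp ?A p (\<lambda>R. of_bool ((\<lambda>e. \<phi> ` e) ` J \<subseteq> R)) = p ^ card J"
        using bprob_superset[OF finite_complete_edges, of "(\<lambda>e. \<phi> ` e) ` J" n p] embedding_edges J
        by (simp add: bprob_def)
    qed
    also have "\<dots> \<le> real n ^ vT * p ^ card J"
    proof -
      have "real (card (embeddings n)) \<le> real n ^ vT"
        using card_embeddings_le by (metis of_nat_le_iff of_nat_power)
      then show ?thesis using p by (simp add: mult_right_mono)
    qed
    finally have "bexp ?A p (\<lambda>R. real (card (embeddings_into n J R))) \<le> real n ^ vT * p ^ card J" .
    then have "bexp ?A p (\<lambda>R. real (card (embeddings_into n J R))) / (K * real n ^ vT * p ^ card J)
      \<le> (real n ^ vT * p ^ card J) / (K * real n ^ vT * p ^ card J)"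
      using pos by (intro divide_right_mono) auto
    also have "\<dots> = 1 / K" using K n p by simp
    finally show "bprob ?A p (\<lambda>R. K * real n ^ vT * p ^ card J \<le> real (card (embeddings_into n J R))) \<le> 1 / K"
      using bprob_markov[OF p' p(2) pos, of ?A "\<lambda>R. real (card (embeddings_into n J R))"] by simp
  qed
  also have "\<dots> = 2 ^ eT / K" using finT by (simp add: card_Pow)
  finally show ?thesis .
qed

text \<open>Classify the embeddings by the set \<open>J\<close> of edges that they map into
  \<open>U\<close>. Only the other edges cost a factor \<open>p\<close>, and typicality supplies the
  missing \<open>p ^ card J\<close> for each class.\<close>

lemma extension_sum:
  assumes p: "0 \<le> p" and U: "typical n p K U"
  shows "(\<Sum>G\<in>host n. p ^ card (edges G - U)) \<le> 2 ^ eT * (K * real n ^ vT * p ^ eT)"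
proof -
  have finT: "finite (edges T)" using simple_graph_finite[OF simple_T] by simp
  have "(\<Sum>G\<in>host n. p ^ card (edges G - U)) \<le> (\<Sum>\<phi>\<in>embeddings n. p ^ card (edges (graph_image \<phi> T) - U))"
    unfolding host_eq_image
    using sum_image_le[of "embeddings n" "\<lambda>G. p ^ card (edges G - U)" "\<lambda>\<phi>. graph_image \<phi> T",
        OF finite_embeddings] p
    by (simp add: o_def)
  also have "\<dots> \<le> (\<Sum>\<phi>\<in>embeddings n. \<Sum>J\<in>Pow (edges T). of_bool (\<phi> \<in> embeddings_into n J U) * p ^ (eT - card J))"
  proof (rule sum_mono)
    fix \<phi> assume \<phi>: "\<phi> \<in> embeddings n"
    define J where "J = {e \<in> edges T. \<phi> ` e \<in> U}"
    have "edges (graph_image \<phi> T) - U = (\<lambda>e. \<phi> ` e) ` (edges T - J)"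
      by (auto simp: J_def)
    then have "card (edges (graph_image \<phi> T) - U) = card (edges T - J)"
      using embedding_edges(1)[OF \<phi>, of "edges T - J"] by simp
    also have "\<dots> = eT - card J" using finT by (subst card_Diff_subset) (auto simp: J_def intro: finite_subset)
    finally have "p ^ card (edges (graph_image \<phi> T) - U)
        = of_bool (\<phi> \<in> embeddings_into n J U) * p ^ (eT - card J)"
      using \<phi> by (simp add: embeddings_into_def J_def)
    also have "\<dots> \<le> (\<Sum>J\<in>Pow (edges T). of_bool (\<phi> \<in> embeddings_into n J U) * p ^ (eT - card J))"
      by (rule member_le_sum) (use finT p in \<open>auto simp: J_def\<close>)
    finally show "p ^ card (edges (graph_image \<phi> T) - U)
      \<le> (\<Sum>J\<in>Pow (edges T). of_bool (\<phi> \<in> embeddings_into n J U) * p ^ (eT - card J))" .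
  qed
  also have "\<dots> = (\<Sum>J\<in>Pow (edges T). \<Sum>\<phi>\<in>embeddings n. of_bool (\<phi> \<in> embeddings_into n J U) * p ^ (eT - card J))"
    by (rule sum.swap)
  also have "\<dots> = (\<Sum>J\<in>Pow (edges T). real (card (embeddings_into n J U)) * p ^ (eT - card J))"
  proof (rule sum.cong[OF refl])
    fix J
    have "(\<Sum>\<phi>\<in>embeddings n. of_bool (\<phi> \<in> embeddings_into n J U) * p ^ (eT - card J))
      = (\<Sum>\<phi>\<in>embeddings_into n J U. p ^ (eT - card J))"
      by (rule sum.mono_neutral_cong_right) (use finite_embeddings in \<open>auto simp: embeddings_into_def\<close>)
    then show "(\<Sum>\<phi>\<in>embeddings n. of_bool (\<phi> \<in> embeddings_into n J U) * p ^ (eT - card J))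
      = real (card (embeddings_into n J U)) * p ^ (eT - card J)" by simp
  qed
  also have "\<dots> \<le> (\<Sum>J\<in>Pow (edges T). K * real n ^ vT * p ^ eT)"
  proof (rule sum_mono)
    fix J assume J: "J \<in> Pow (edges T)"
    then have cJ: "card J \<le> eT" using finT by (auto intro: card_mono)
    have "real (card (embeddings_into n J U)) * p ^ (eT - card J) \<le> K * real n ^ vT * p ^ card J * p ^ (eT - card J)"
      using U J p unfolding typical_def by (intro mult_right_mono) auto
    also have "\<dots> = K * real n ^ vT * p ^ eT" using cJ by (simp add: mult.assoc power_add[symmetric])
    finally show "real (card (embeddings_into n J U)) * p ^ (eT - card J) \<le> K * real n ^ vT * p ^ eT" .
  qed
  also have "\<dots> = 2 ^ eT * (K * real n ^ vT * p ^ eT)" using finT by (simp add: card_Pow)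
  finally show ?thesis .
qed

text \<open>Members are added one at a time; each costs a constant multiple of
  \<open>K * n ^ vT * p ^ eT\<close>, however it overlaps the earlier ones. The factorial removes
  the order in which they are added.\<close>

lemma typical_collections_sum:
  assumes p: "0 \<le> p" and K: "0 \<le> K"
  shows "(\<Sum>S\<in>{S. S \<subseteq> host n \<and> card S = k \<and> typical n p K (edges (union_graph S))}. p ^ card (edges (union_graph S)))
    \<le> (2 ^ eT * (K * real n ^ vT * p ^ eT)) ^ k / fact k"
proof (induction k)
  case 0
  have "{S. S \<subseteq> host n \<and> card S = 0 \<and> typical n p K (edges (union_graph S))} \<subseteq> {{}}"
    using finite_subset[OF _ finite_host] by auto
  then have "{S. S \<subseteq> host n \<and> card S = 0 \<and> typical n p K (edges (union_graph S))} = {} \<or>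
      {S. S \<subseteq> host n \<and> card S = 0 \<and> typical n p K (edges (union_graph S))} = {{}}"
    by (rule subset_singletonD)
  then show ?case by (elim disjE) (simp_all only: sum.empty, simp_all)
next
  case (Suc k)
  let ?A = "2 ^ eT * (K * real n ^ vT * p ^ eT)"
  let ?E = "\<lambda>S. edges (union_graph S)"
  define \<S> where "\<S> k = {S. S \<subseteq> host n \<and> card S = k \<and> typical n p K (?E S)}" for k
  have fin\<S>: "finite (\<S> k)" for k unfolding \<S>_def using finite_host by simp
  have finS: "finite S" if "S \<in> \<S> k" for S k using that finite_subset[OF _ finite_host] by (auto simp: \<S>_def)
  \<comment> \<open>Marking one member \<open>G\<close> of \<open>S\<close> counts each
    \<open>S\<close> exactly \<open>Suc k\<close> times; deleting the marked member leaves a typical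
    collection of size \<open>k\<close>.\<close>
  have "real (Suc k) * (\<Sum>S\<in>\<S> (Suc k). p ^ card (?E S)) = (\<Sum>S\<in>\<S> (Suc k). \<Sum>G\<in>S. p ^ card (?E S))"
    unfolding sum_distrib_left by (rule sum.cong) (auto simp: \<S>_def)
  also have "\<dots> = (\<Sum>(S, G)\<in>(SIGMA S:\<S> (Suc k). S). p ^ card (?E S))"
    by (rule sum.Sigma) (use fin\<S> finS in auto)
  also have "\<dots> = (\<Sum>(S, G)\<in>(\<lambda>(S, G). (S - {G}, G)) ` (SIGMA S:\<S> (Suc k). S). p ^ card (?E (insert G S)))"
  proof -
    have "inj_on (\<lambda>(S, G). (S - {G}, G)) (SIGMA S:\<S> (Suc k). S)" by (auto simp: inj_on_def)
    then show ?thesis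
      by (subst sum.reindex) (auto intro!: sum.cong simp: insert_absorb simp del: edges_union_graph)
  qed
  also have "\<dots> \<le> (\<Sum>(S, G)\<in>\<S> k \<times> host n. p ^ card (?E (insert G S)))"
  proof (rule sum_mono2)
    show "(\<lambda>(S, G). (S - {G}, G)) ` (SIGMA S:\<S> (Suc k). S) \<subseteq> \<S> k \<times> host n"
    proof
      fix x assume "x \<in> (\<lambda>(S, G). (S - {G}, G)) ` (SIGMA S:\<S> (Suc k). S)"
      then obtain S G where S: "S \<in> \<S> (Suc k)" "G \<in> S" and x: "x = (S - {G}, G)" by auto
      then have "typical n p K (?E S)" by (simp add: \<S>_def)
      moreover have "?E (S - {G}) \<subseteq> ?E S" by auto
      ultimately have "typical n p K (?E (S - {G}))" by (rule typical_mono)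
      then have "S - {G} \<in> \<S> k" using S finS[OF S(1)] by (auto simp: \<S>_def)
      moreover have "G \<in> host n" using S by (auto simp: \<S>_def)
      ultimately show "x \<in> \<S> k \<times> host n" by (simp add: x)
    qed
  qed (use fin\<S> finite_host p in auto)
  also have "\<dots> = (\<Sum>S\<in>\<S> k. \<Sum>G\<in>host n. p ^ card (?E (insert G S)))"
    by (rule sum.Sigma[symmetric]) (use fin\<S> finite_host in auto)
  also have "\<dots> \<le> (\<Sum>S\<in>\<S> k. p ^ card (?E S) * ?A)"
  proof (rule sum_mono)
    fix S assume S: "S \<in> \<S> k"
    have finE: "finite (?E S)" using finS[OF S] S hostD(8) by (auto simp: \<S>_def)
    have "(\<Sum>G\<in>host n. p ^ card (?E (insert G S))) = (\<Sum>G\<in>host n. p ^ card (?E S) * p ^ card (edges G - ?E S))"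
    proof (rule sum.cong[OF refl])
      fix G assume G: "G \<in> host n"
      have "?E (insert G S) = ?E S \<union> (edges G - ?E S)" by auto
      then have "card (?E (insert G S)) = card (?E S) + card (edges G - ?E S)"
        using finE hostD(8)[OF G] by (simp only:) (subst card_Un_disjoint; auto)
      then show "p ^ card (?E (insert G S)) = p ^ card (?E S) * p ^ card (edges G - ?E S)"
        by (simp only: power_add)
    qed
    also have "\<dots> \<le> p ^ card (?E S) * ?A"
      unfolding sum_distrib_left[symmetric]
      by (rule mult_left_mono[OF extension_sum[OF p]]) (use S p in \<open>auto simp: \<S>_def\<close>)
    finally show "(\<Sum>G\<in>host n. p ^ card (?E (insert G S))) \<le> p ^ card (?E S) * ?A" .
  qed
  also have "\<dots> = (\<Sum>S\<in>\<S> k. p ^ card (?E S)) * ?A" by (simp only: sum_distrib_right)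
  also have "\<dots> \<le> ?A ^ k / fact k * ?A"
    using Suc.IH p K by (intro mult_right_mono) (auto simp: \<S>_def)
  finally have *: "real (Suc k) * (\<Sum>S\<in>\<S> (Suc k). p ^ card (?E S)) \<le> ?A ^ k / fact k * ?A" .
  have aux: "x \<le> a ^ Suc k / fact (Suc k)" if le: "real (Suc k) * x \<le> a ^ k / fact k * a" for x a :: real
  proof -
    have "x = real (Suc k) * x / real (Suc k)" by (simp del: of_nat_Suc)
    also have "\<dots> \<le> a ^ k / fact k * a / real (Suc k)" by (rule divide_right_mono[OF le]) simp
    also have "\<dots> = a ^ Suc k / fact (Suc k)" by (simp add: fact_Suc mult.commute)
    finally show ?thesis .
  qed
  have "(\<Sum>S\<in>\<S> (Suc k). p ^ card (?E S)) \<le> ?A ^ Suc k / fact (Suc k)"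
    by (rule aux[OF *])
  then show ?case by (simp only: \<S>_def)
qed

text \<open>
  The upper tail of the number of copies inside a container is turned into the lower tail of the number of copies outside of it, which Janson's
  inequality controls; being a decreasing event, it is compatible with the presence of the
  fingerprint.
\<close>

lemma free_collection_prob:
  assumes p: "0 < p" "p \<le> 1" and n: "0 < n" and l: "0 < l" "l \<le> real n ^ vT * p ^ eT"
    and sub: "\<And>(T' :: nat ugraph) V E. graph_iso T T' \<Longrightarrow> V \<subseteq> verts T' \<Longrightarrow> E \<subseteq> edges T' \<Longrightarrow>
      (\<And>e. e \<in> E \<Longrightarrow> e \<subseteq> V) \<Longrightarrow> E \<noteq> {} \<Longrightarrow> l \<le> real n ^ card V * p ^ card E"
    and \<epsilon>: "0 < \<epsilon>" "\<epsilon> \<le> 1" and K: "0 < K" and x: "1 \<le> x" and s: "0 \<le> s"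
    and cs: "container_scheme (host n) (collection_free \<F>) s (real (ex_star n T \<F>) + \<epsilon> / 2 * real n ^ vT)"
  defines "\<kappa> \<equiv> types_upto (2 * vT)"
  shows "bprob (edges (complete_graph n)) p (\<lambda>R. \<exists>I. I \<subseteq> present n R \<and> collection_free \<F> I \<and>
      (real (ex_star n T \<F>) + \<epsilon> * real n ^ vT) * p ^ eT < real (card I))
    \<le> 64 * \<kappa> / (\<epsilon>^2 * l) + 2 ^ eT / K
      + x powr s * exp (2 ^ eT * (K * real n ^ vT * p ^ eT) / x) * exp (- (\<epsilon>^2 * l / (768 * \<kappa>)))"
proof -
  let ?A = "edges (complete_graph n)"
  let ?E = "\<lambda>S. edges (union_graph S)"
  define \<mu> where "\<mu> = real n ^ vT * p ^ eT"
  define ex where "ex = real (ex_star n T \<F>)"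
  \<comment> \<open>A quarter of the slack. The container leaves \<epsilon> / 2 to spare, shared
    equally by the deviation of the total number of copies and the lower tail outside of the
    container.\<close>
  define t where "t = \<epsilon> / 4 * \<mu>"
  define Q where "Q = 4 * \<kappa> * (\<mu>^2 / l)"
  have \<kappa>: "1 \<le> \<kappa>" unfolding \<kappa>_def by (rule types_upto_ge_1)
  have \<mu>: "0 < \<mu>" "l \<le> \<mu>" using p n l by (simp_all add: \<mu>_def)
  have p': "0 \<le> p" using p by simp
  have finA: "finite ?A" by (rule finite_complete_edges)
  have t0: "0 < t" using \<epsilon> \<mu> by (simp add: t_def)
  have Q0: "0 < Q" using \<kappa> \<mu> l by (simp add: Q_def)
  have overlap: "(\<Sum>a\<in>D. \<Sum>b\<in>D. of_bool (edges a \<inter> edges b \<noteq> {}) * p ^ card (edges a \<union> edges b)) \<le> Q"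
    if "D \<subseteq> host n" for D
    unfolding Q_def \<kappa>_def \<mu>_def by (rule overlap_sum[OF n that p' l(1) sub])
  obtain fp ct where "container_fns (host n) (collection_free \<F>) s (ex + \<epsilon> / 2 * real n ^ vT) fp ct"
    using cs unfolding container_scheme_def ex_def by (elim exE)
  note c = container_fnsD[OF this]
  define \<S> where "\<S> = {S. S \<subseteq> host n \<and> real (card S) \<le> s \<and> typical n p K (?E S)}"
  have fin\<S>: "finite \<S>" unfolding \<S>_def using finite_host by simp
  define LT where "LT S R \<longleftrightarrow> real (card {G \<in> host n - ct S. edges G \<subseteq> R})
    \<le> (\<Sum>G\<in>host n - ct S. p ^ card (edges G)) - t" for S R
  \<comment> \<open>The deterministic part: if the total is near its mean and \<open>R\<close> is
    typical, a free \<open>I\<close> that is too large brings about the lower-tail event for its own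
    fingerprint.\<close>
  have bad: "t \<le> \<bar>real (card (present n R)) - real (card (host n)) * p ^ eT\<bar> \<or>
      (\<not> typical n p K R \<or> (\<exists>S\<in>\<S>. ?E S \<subseteq> R \<and> LT S R))"
    if R: "R \<subseteq> ?A" and ex_I: "\<exists>I. I \<subseteq> present n R \<and> collection_free \<F> I \<and>
      (real (ex_star n T \<F>) + \<epsilon> * real n ^ vT) * p ^ eT < real (card I)" for R
  proof (rule ccontr)
    assume "\<not> ?thesis"
    then have dev: "\<bar>real (card (present n R)) - real (card (host n)) * p ^ eT\<bar> < t"
      and typR: "typical n p K R" and no: "\<And>S. S \<in> \<S> \<Longrightarrow> ?E S \<subseteq> R \<Longrightarrow> \<not> LT S R" by auto
    obtain I where I: "I \<subseteq> present n R" "collection_free \<F> I"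
      "(ex + \<epsilon> * real n ^ vT) * p ^ eT < real (card I)" using ex_I unfolding ex_def by blast
    have Ih: "I \<subseteq> host n" using I(1) by auto
    note cI = c(3-7)[OF Ih I(2)]
    define S where "S = fp I"
    \<comment> \<open>The container is recovered from the fingerprint alone, so the union bound may
      run over fingerprints instead of free collections.\<close>
    have ctS: "ct S = ct I" unfolding S_def using c(2)[of I "fp I"] cI(1) by simp
    have ES: "?E S \<subseteq> R" using cI(1) I(1) by (auto simp: S_def)
    have "S \<in> \<S>"
      using cI(1,2) Ih typical_mono[OF typR ES] by (auto simp: \<S>_def S_def)
    then have "\<not> LT S R" using no ES by blast
    moreover have "LT S R"
    proof -
      have split: "present n R = {G \<in> host n - ct S. edges G \<subseteq> R} \<union> (present n R \<inter> ct S)"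
        by auto
      have fin: "finite (present n R)" using finite_host by simp
      have "card (present n R) = card {G \<in> host n - ct S. edges G \<subseteq> R} + card (present n R \<inter> ct S)"
        by (subst split, rule card_Un_disjoint) (use finite_host in auto)
      moreover have "card I \<le> card (present n R \<inter> ct S)"
        using I(1) cI(3) ctS fin by (intro card_mono) auto
      ultimately have 1: "real (card {G \<in> host n - ct S. edges G \<subseteq> R}) \<le> real (card (present n R)) - real (card I)"
        by linarith
      have ctS_sub: "ct S \<subseteq> host n" using cI(4) ctS by simp
      have "(\<Sum>G\<in>host n - ct S. p ^ card (edges G)) = (\<Sum>G\<in>host n - ct S. p ^ eT)"
        by (rule sum.cong) (use hostD(5) in auto)
      also have "\<dots> = real (card (host n - ct S)) * p ^ eT" by simp
      also have "real (card (host n - ct S)) = real (card (host n)) - real (card (ct S))"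
        using ctS_sub finite_host by (simp add: card_Diff_subset[OF finite_subset[OF ctS_sub finite_host]] of_nat_diff card_mono)
      finally have 2: "(\<Sum>G\<in>host n - ct S. p ^ card (edges G)) = (real (card (host n)) - real (card (ct S))) * p ^ eT" .
      have 3: "real (card (ct S)) * p ^ eT \<le> (ex + \<epsilon> / 2 * real n ^ vT) * p ^ eT"
        using cI(5) ctS p' by (intro mult_right_mono) auto
      have 4: "t = \<epsilon> / 4 * (real n ^ vT * p ^ eT)" by (simp add: t_def \<mu>_def)
      have 5: "real (card (present n R)) < real (card (host n)) * p ^ eT + t" using dev by linarith
      have "real (card {G \<in> host n - ct S. edges G \<subseteq> R})
        \<le> real (card (host n)) * p ^ eT + t - (ex + \<epsilon> * real n ^ vT) * p ^ eT"
        using 1 5 I(3) by linarith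
      also have "\<dots> \<le> (real (card (host n)) - real (card (ct S))) * p ^ eT - t"
        using 3 unfolding 4 by (simp add: algebra_simps)
      finally show ?thesis unfolding LT_def 2 .
    qed
    ultimately show False by blast
  qed
  have "bprob ?A p (\<lambda>R. \<exists>I. I \<subseteq> present n R \<and> collection_free \<F> I \<and>
      (real (ex_star n T \<F>) + \<epsilon> * real n ^ vT) * p ^ eT < real (card I))
    \<le> bprob ?A p (\<lambda>R. t \<le> \<bar>real (card (present n R)) - real (card (host n)) * p ^ eT\<bar> \<or>
      (\<not> typical n p K R \<or> (\<exists>S\<in>\<S>. ?E S \<subseteq> R \<and> LT S R)))"
    using bad by (rule bprob_mono[OF p' p(2)])
  also have "\<dots> \<le> bprob ?A p (\<lambda>R. t \<le> \<bar>real (card (present n R)) - real (card (host n)) * p ^ eT\<bar>)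
      + (bprob ?A p (\<lambda>R. \<not> typical n p K R) + bprob ?A p (\<lambda>R. \<exists>S\<in>\<S>. ?E S \<subseteq> R \<and> LT S R))"
    by (rule order_trans[OF bprob_disj[OF p' p(2)] add_left_mono[OF bprob_disj[OF p' p(2)]]])
  also have "\<dots> \<le> 64 * \<kappa> / (\<epsilon>^2 * l) + (2 ^ eT / K +
      x powr s * exp (2 ^ eT * (K * real n ^ vT * p ^ eT) / x) * exp (- (\<epsilon>^2 * l / (768 * \<kappa>))))"
  proof (intro add_mono)
    have "bprob ?A p (\<lambda>R. t \<le> \<bar>real (card (present n R)) - real (card (host n)) * p ^ eT\<bar>) \<le> Q / t^2"
      by (rule card_present_deviation[OF p' p(2) subset_refl t0 overlap]) simp
    also have "\<dots> = 64 * \<kappa> / (\<epsilon>^2 * l)"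
      using \<mu> l \<epsilon> by (simp add: Q_def t_def field_simps power2_eq_square)
    finally show "bprob ?A p (\<lambda>R. t \<le> \<bar>real (card (present n R)) - real (card (host n)) * p ^ eT\<bar>)
      \<le> 64 * \<kappa> / (\<epsilon>^2 * l)" .
    show "bprob ?A p (\<lambda>R. \<not> typical n p K R) \<le> 2 ^ eT / K" by (rule atypical_prob[OF p n K])
    have "bprob ?A p (\<lambda>R. \<exists>S\<in>\<S>. ?E S \<subseteq> R \<and> LT S R) \<le> (\<Sum>S\<in>\<S>. bprob ?A p (\<lambda>R. ?E S \<subseteq> R \<and> LT S R))"
      by (rule bprob_Bex[OF p' p(2) fin\<S>])
    also have "\<dots> \<le> (\<Sum>S\<in>\<S>. p ^ card (?E S) * exp (- (t^2 / (12 * Q))))"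
    proof (rule sum_mono)
      fix S assume S: "S \<in> \<S>"
      have ESA: "?E S \<subseteq> ?A" using S hostD(6) by (auto simp: \<S>_def)
      have "bprob ?A p (\<lambda>R. ?E S \<subseteq> R \<and> LT S R) \<le> p ^ card (?E S) * bprob ?A p (LT S)"
      proof (rule bprob_superset_decreasing[OF finA ESA p' p(2)])
        fix R R' assume *: "R \<subseteq> R'" "LT S R'"
        have "card {G \<in> host n - ct S. edges G \<subseteq> R} \<le> card {G \<in> host n - ct S. edges G \<subseteq> R'}"
          using *(1) finite_host by (intro card_mono) auto
        then show "LT S R" using *(2) unfolding LT_def by linarith
      qed
      also have "bprob ?A p (LT S) \<le> exp (- (t^2 / (12 * Q)))"
        unfolding LT_def
      proof (rule janson_lower_tail[OF finA _ _ p' p(2) overlap Q0])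
        show "finite (host n - ct S)" using finite_host by simp
        show "edges a \<subseteq> ?A \<and> edges a \<noteq> {}" if "a \<in> host n - ct S" for a
          using that hostD(6,9) by auto
        show "0 \<le> t" using t0 by simp
        have "t \<le> 1 * \<mu>" unfolding t_def using \<epsilon> \<mu> by (intro mult_right_mono) auto
        also have "\<dots> \<le> \<mu> * (\<mu> / l)" using \<mu> l by (simp add: pos_le_divide_eq)
        also have "\<dots> \<le> 3 * Q"
          using \<kappa> \<mu> l unfolding Q_def power2_eq_square
          by (simp add: divide_right_mono mult_right_mono)
        finally show "t \<le> 3 * Q" .
      qed auto
      finally show "bprob ?A p (\<lambda>R. ?E S \<subseteq> R \<and> LT S R) \<le> p ^ card (?E S) * exp (- (t^2 / (12 * Q)))"
        using p' by (simp add: mult_left_mono)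
    qed
    also have "\<dots> = (\<Sum>S\<in>\<S>. p ^ card (?E S)) * exp (- (t^2 / (12 * Q)))" by (simp only: sum_distrib_right)
    also have "\<dots> \<le> x powr s * exp (2 ^ eT * (K * real n ^ vT * p ^ eT) / x) * exp (- (t^2 / (12 * Q)))"
    proof (rule mult_right_mono)
      define k where "k = nat \<lfloor>s\<rfloor>"
      have k: "real k \<le> s" "real j \<le> s \<Longrightarrow> j \<le> k" for j
        using s unfolding k_def by (simp_all add: le_nat_floor)
      let ?S = "\<lambda>j. {S. S \<subseteq> host n \<and> card S = j \<and> typical n p K (?E S)}"
      have "\<S> \<subseteq> (\<Union>j\<in>{..k}. ?S j)" using k(2) by (auto simp: \<S>_def)
      then have "(\<Sum>S\<in>\<S>. p ^ card (?E S)) \<le> (\<Sum>S\<in>(\<Union>j\<in>{..k}. ?S j). p ^ card (?E S))"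
        using finite_host p' by (intro sum_mono2) auto
      also have "\<dots> = (\<Sum>j\<le>k. \<Sum>S\<in>?S j. p ^ card (?E S))"
        by (rule sum.UNION_disjoint) (use finite_host in auto)
      also have "\<dots> \<le> (\<Sum>j\<le>k. (2 ^ eT * (K * real n ^ vT * p ^ eT)) ^ j / fact j)"
        by (intro sum_mono typical_collections_sum p') (use K in simp)
      also have "\<dots> \<le> x powr s * exp (2 ^ eT * (K * real n ^ vT * p ^ eT) / x)"
        by (rule partial_exp_sum_le[OF _ x k(1)]) (use K p in simp)
      finally show "(\<Sum>S\<in>\<S>. p ^ card (?E S)) \<le> x powr s * exp (2 ^ eT * (K * real n ^ vT * p ^ eT) / x)" .
    qed simp
    also have "t^2 / (12 * Q) = \<epsilon>^2 * l / (768 * \<kappa>)"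
      using \<mu> l \<kappa> by (simp add: Q_def t_def field_simps power2_eq_square)
    finally show "bprob ?A p (\<lambda>R. \<exists>S\<in>\<S>. ?E S \<subseteq> R \<and> LT S R)
      \<le> x powr s * exp (2 ^ eT * (K * real n ^ vT * p ^ eT) / x) * exp (- (\<epsilon>^2 * l / (768 * \<kappa>)))" .
  qed
  finally show ?thesis by (simp only: add.assoc)
qed

end

section \<open>The upper bound\<close>

lemma random_graph_prob:
  assumes "0 \<le> p" "p \<le> 1"
  shows "measure_pmf.prob (random_graph n p) {G. P G}
    = bprob (edges (complete_graph n)) p (\<lambda>R. P (UGraph {..<n} R))"
proof -
  let ?A = "edges (complete_graph n)"
  have "random_graph n p = map_pmf (UGraph {..<n})
      (map_pmf (\<lambda>f. {e \<in> ?A. f e}) (Pi_pmf ?A False (\<lambda>_. bernoulli_pmf p)))"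
    unfolding random_graph_def map_pmf_comp by simp
  then have "measure_pmf.prob (random_graph n p) {G. P G}
    = measure_pmf.prob (map_pmf (\<lambda>f. {e \<in> ?A. f e}) (Pi_pmf ?A False (\<lambda>_. bernoulli_pmf p))) {R. P (UGraph {..<n} R)}"
    by (simp add: vimage_def)
  then show ?thesis using bernoulli_subset_conv_bprob[OF finite_complete_edges assms] by simp
qed

text \<open>Finds room for the isolated vertices of \<open>H\<close> once the images of the other
  vertices are prescribed.\<close>

lemma inj_extend:
  assumes "finite A" "finite B" "card A \<le> card B" "W \<subseteq> A" "inj_on k W" "k ` W \<subseteq> B"
  obtains g where "inj_on g A" "g ` A \<subseteq> B" "\<And>x. x \<in> W \<Longrightarrow> g x = k x"
proof -
  have finW: "finite W" by (rule finite_subset[OF assms(4,1)])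
  have "card (A - W) \<le> card (B - k ` W)"
    using assms finW by (simp add: card_Diff_subset card_image)
  then obtain f where f: "f ` (A - W) \<subseteq> B - k ` W" "inj_on f (A - W)"
    using card_le_inj[of "A - W" "B - k ` W"] assms(1,2) by auto
  define g where "g x = (if x \<in> W then k x else f x)" for x
  show thesis
  proof (rule that[of g])
    show "inj_on g A"
    proof (rule inj_onI)
      fix x y assume xy: "x \<in> A" "y \<in> A" "g x = g y"
      consider "x \<in> W" "y \<in> W" | "x \<notin> W" "y \<notin> W" | "x \<in> W" "y \<notin> W" | "x \<notin> W" "y \<in> W" by blast
      then show "x = y"
      proof cases
        case 1
        then show ?thesis using xy assms(5) by (auto simp: g_def dest: inj_onD)
      next
        case 2
        then show ?thesis using xy f(2) by (auto simp: g_def dest: inj_onD)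
      next
        case 3
        then have "f y = k x" "f y \<notin> k ` W" using f(1) xy by (auto simp: g_def)
        then show ?thesis using 3 by blast
      next
        case 4
        then have "f x = k y" "f x \<notin> k ` W" using f(1) xy by (auto simp: g_def)
        then show ?thesis using 4 by blast
      qed
    qed
    show "g ` A \<subseteq> B" using f(1) assms(6) by (auto simp: g_def)
  qed (simp add: g_def)
qed

text \<open>The copy of \<open>H\<close> behind \<open>union_contains\<close> may have its isolated
  vertices anywhere. So only the set \<open>W\<close> of non-isolated vertices is transported by the
  isomorphism, and the rest is placed afresh in \<open>{..<n}\<close>; this is where
  \<open>n\<close> has to be at least the number of vertices of \<open>H\<close>.\<close>

lemma covering_image_contains:
  assumes H: "simple_graph H" and F: "union_contains H F" "\<And>G. G \<in> F \<Longrightarrow> simple_graph G"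
    and iso: "collection_iso F D"
    and G': "verts G' = {..<n}" "\<And>e. e \<in> edges G' \<Longrightarrow> e \<subseteq> {..<n}" "edges (union_graph D) \<subseteq> edges G'"
    and n: "card (verts H) \<le> n"
  shows "copies H G' \<noteq> {}"
proof -
  obtain f where f: "inj_on f (verts (union_graph F))" "D = graph_image f ` F"
    using iso unfolding collection_iso_def by (elim exE conjE)
  obtain H' :: "nat ugraph" where H': "edges H' \<subseteq> edges (union_graph F)" "graph_iso H H'"
    using F(1) unfolding union_contains_def copies_def subgraph_def by auto
  obtain h where h: "inj_on h (verts H)" "H' = graph_image h H"
    using H'(2) unfolding graph_iso_def by (elim exE conjE)
  define W where "W = \<Union>(edges H)"
  have W: "W \<subseteq> verts H" using simple_graph_edgeD(1)[OF H] by (auto simp: W_def)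
  have hF: "h ` e \<in> edges (union_graph F)" if "e \<in> edges H" for e
    using that H'(1) h(2) by auto
  have hW: "h ` W \<subseteq> verts (union_graph F)"
  proof
    fix y assume "y \<in> h ` W"
    then obtain e where e: "e \<in> edges H" "y \<in> h ` e" by (auto simp: W_def)
    then obtain G where "G \<in> F" "h ` e \<in> edges G" using hF[OF e(1)] by auto
    then show "y \<in> verts (union_graph F)" using simple_graph_edgeD(1)[OF F(2)] e(2) by fastforce
  qed
  have fh: "f ` h ` e \<in> edges G'" if "e \<in> edges H" for e
  proof -
    have "f ` h ` e \<in> edges (union_graph D)" unfolding f(2) edges_union_image using hF[OF that] by blast
    then show ?thesis using G'(3) by blast
  qed
  have "inj_on (f \<circ> h) W"
    using inj_on_subset[OF h(1) W] inj_on_subset[OF f(1) hW] by (rule comp_inj_on)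
  moreover have "(f \<circ> h) ` W \<subseteq> {..<n}"
  proof
    fix y assume "y \<in> (f \<circ> h) ` W"
    then obtain e where e: "e \<in> edges H" "y \<in> f ` h ` e" by (auto simp: W_def)
    then show "y \<in> {..<n}" using G'(2)[OF fh[OF e(1)]] by blast
  qed
  ultimately obtain g where g: "inj_on g (verts H)" "g ` verts H \<subseteq> {..<n}" "\<And>x. x \<in> W \<Longrightarrow> g x = (f \<circ> h) x"
    using inj_extend[of "verts H" "{..<n}" W "f \<circ> h"] simple_graph_finite(1)[OF H] n W by auto
  have "g ` e = f ` h ` e" if "e \<in> edges H" for e
  proof -
    have "g ` e = (f \<circ> h) ` e" using g(3) that by (intro image_cong) (auto simp: W_def)
    then show ?thesis by (simp add: image_comp)
  qed
  then have "graph_image g H \<in> copies H G'"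
    using g(1,2) fh G'(1) by (auto simp: copies_def subgraph_def graph_iso_def)
  then show ?thesis by blast
qed

context pattern_graph
begin

section \<open>H-free subgraphs of the random graph as edge sets\<close>

lemma copies_eq_present: "copies T (UGraph {..<n} R) = present n R"
  by (auto simp: copies_def subgraph_def host_iff)

definition free_subgraphs :: "'b ugraph \<Rightarrow> nat \<Rightarrow> nat set set \<Rightarrow> nat set set set" where
  "free_subgraphs H n R = {R'. R' \<subseteq> R \<and> H_free H (UGraph {..<n} R')}"

lemma ex_sub_eq:
  "ex_sub (UGraph {..<n} R) T H = Max ((\<lambda>R'. card (present n R')) ` free_subgraphs H n R)"
proof -
  have "{card (copies T G') | G'. subgraph G' (UGraph {..<n} R) \<and> verts G' = verts (UGraph {..<n} R) \<and> H_free H G'}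
    = (\<lambda>R'. card (present n R')) ` free_subgraphs H n R" (is "?L = ?R")
  proof
    show "?L \<subseteq> ?R"
    proof clarify
      fix G' :: "nat ugraph"
      assume G': "subgraph G' (UGraph {..<n} R)" "verts G' = verts (UGraph {..<n} R)" "H_free H G'"
      then have "G' = UGraph {..<n} (edges G')" by (cases G') auto
      then show "card (copies T G') \<in> ?R"
        using G' copies_eq_present[of n "edges G'"] unfolding free_subgraphs_def subgraph_def
        by (intro image_eqI[of _ _ "edges G'"]) auto
    qed
    show "?R \<subseteq> ?L"
    proof clarify
      fix R' assume "R' \<in> free_subgraphs H n R"
      then show "\<exists>G'. card (present n R') = card (copies T G') \<and> subgraph G' (UGraph {..<n} R) \<and>
          verts G' = verts (UGraph {..<n} R) \<and> H_free H G'"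
        by (intro exI[of _ "UGraph {..<n} R'"]) (auto simp: free_subgraphs_def copies_eq_present subgraph_def)
    qed
  qed
  then show ?thesis unfolding ex_sub_def by simp
qed

lemma finite_free_subgraphs: "R \<subseteq> edges (complete_graph n) \<Longrightarrow> finite (free_subgraphs H n R)"
  unfolding free_subgraphs_def using finite_subset[OF _ finite_complete_edges] by simp

lemma ex_sub_ge:
  assumes "R \<subseteq> edges (complete_graph n)" "R' \<in> free_subgraphs H n R"
  shows "card (present n R') \<le> ex_sub (UGraph {..<n} R) T H"
  unfolding ex_sub_eq using finite_free_subgraphs[OF assms(1)] assms(2) by (intro Max_ge) auto

lemma ex_sub_attained:
  assumes "R \<subseteq> edges (complete_graph n)" "2 \<le> card (edges H)"
  obtains R' where "R' \<in> free_subgraphs H n R" "card (present n R') = ex_sub (UGraph {..<n} R) T H"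
proof -
  have "{} \<in> free_subgraphs H n R"
    using assms(2) by (auto simp: free_subgraphs_def H_free_def copies_def subgraph_def graph_iso_def)
  then have "ex_sub (UGraph {..<n} R) T H \<in> (\<lambda>R'. card (present n R')) ` free_subgraphs H n R"
    unfolding ex_sub_eq using finite_free_subgraphs[OF assms(1)] by (intro Max_in) auto
  then show thesis using that by auto
qed

lemma free_subgraph_collection_free:
  assumes H: "simple_graph H" and F: "\<And>F. F \<in> \<F> \<Longrightarrow> union_contains H F \<and> (\<forall>G\<in>F. graph_iso T G)"
    and R: "R \<subseteq> edges (complete_graph n)" "R' \<in> free_subgraphs H n R" and n: "card (verts H) \<le> n"
  shows "collection_free \<F> (present n R')"
  unfolding collection_free_def
proof clarify
  fix D F assume *: "D \<subseteq> present n R'" "F \<in> \<F>" "collection_iso F D"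
  have "copies H (UGraph {..<n} R') \<noteq> {}"
  proof (rule covering_image_contains[OF H _ _ *(3) _ _ _ n])
    show "union_contains H F" using F[OF *(2)] by simp
    show "simple_graph G" if "G \<in> F" for G using F[OF *(2)] that
      by (intro graph_iso_simple(1)[OF simple_T]) blast
    show "e \<subseteq> {..<n}" if "e \<in> edges (UGraph {..<n} R')" for e
      using that R by (auto simp: free_subgraphs_def complete_graph_def)
    show "edges (union_graph D) \<subseteq> edges (UGraph {..<n} R')" using *(1) by auto
  qed simp
  then show False using R(2) by (auto simp: free_subgraphs_def H_free_def)
qed

text \<open>The parameters of \<open>free_collection_prob\<close> become functions of
  \<open>w = p * n powr (1 / m)\<close>, which tends to infinity: \<open>l\<close> is \<sigma> w,
  \<open>K\<close> is \<open>w\<close>, and \<open>x\<close> is \<open>w ^ (eT + 1)\<close>. Its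
  three error terms are then bounded by a function of \<open>w\<close> that tends to 0.\<close>

lemma upper_probability:
  fixes p :: "nat \<Rightarrow> real"
  assumes H: "simple_graph H" "2 \<le> card (edges H)"
    and fin: "finite \<F>" and m: "real eT / real vT \<le> m" "m \<le> m2 T"
    and F: "\<And>F. F \<in> \<F> \<Longrightarrow> T_covering T H F \<and> T_density T F \<le> ennreal m"
    and p: "\<And>n. 0 \<le> p n \<and> p n \<le> 1"
    and \<omega>: "filterlim (\<lambda>n. p n * real n powr (1 / m)) at_top sequentially"
    and \<epsilon>: "0 < \<epsilon>" "\<epsilon> \<le> 1"
  shows "(\<lambda>n. measure_pmf.prob (random_graph n (p n)) {G. real (ex_sub G T H)
    \<le> (real (ex_star n T \<F>) + \<epsilon> * real n ^ vT) * p n ^ eT}) \<longlonglongrightarrow> 1"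
proof -
  have m0: "0 < m"
  proof -
    have "0 < real eT / real vT" using eT_ge vT_ge by (intro divide_pos_pos) auto
    then show ?thesis using m(1) by linarith
  qed
  have F': "F \<noteq> {} \<and> finite F \<and> (\<forall>G\<in>F. graph_iso T G) \<and> T_density T F \<le> ennreal m
      \<and> (\<forall>G\<in>F. \<forall>G'\<in>F. G \<noteq> G' \<longrightarrow> edges G \<inter> edges G' = {})" if "F \<in> \<F>" for F
    using F[OF that] covering_nonempty[of H F] H(2) unfolding T_covering_def by simp
  have F'': "union_contains H F \<and> (\<forall>G\<in>F. graph_iso T G)" if "F \<in> \<F>" for F
    using F[OF that] unfolding T_covering_def by simp
  obtain C n0 where C: "0 < C" and cs: "\<And>n. n0 \<le> n \<Longrightarrow>
    container_scheme (host n) (collection_free \<F>) (C * real n powr (real vT - real eT / m))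
      (real (ex_star n T \<F>) + \<epsilon> / 2 * real n ^ vT)"
    using free_containers[OF fin _ m(1) F', of "\<epsilon> / 2"] \<epsilon> by auto
  define \<kappa> where "\<kappa> = types_upto (2 * vT)"
  have \<kappa>: "1 \<le> \<kappa>" unfolding \<kappa>_def by (rule types_upto_ge_1)
  define c where "c = \<epsilon>^2 / (768 * \<kappa>)"
  have c: "0 < c" using \<epsilon> \<kappa> by (simp add: c_def)
  define B where "B = (2 ^ eT :: real)"
  define L where "L = C * (real eT + 1)"
  \<comment> \<open>The third error term is the exponential of \<sigma> times this: fingerprint
    count against Janson's gain. Once it is nonpositive, \<sigma> \<ge> 1 makes \<sigma> = 1 the
    worst case.\<close>
  define brk where "brk w = L * ln w + B - c * w" for w
  define h where "h w = 64 * \<kappa> / \<epsilon>^2 / w + B / w + exp (brk w)" for w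
  define w where "w n = p n * real n powr (1 / m)" for n
  have "filterlim brk at_bot at_top" unfolding brk_def using c by real_asymp
  then have brk0: "eventually (\<lambda>w. brk w \<le> 0) at_top" unfolding filterlim_at_bot by blast
  have "((\<lambda>w. exp (brk w)) \<longlongrightarrow> 0) at_top"
    using \<open>filterlim brk at_bot at_top\<close> exp_at_bot by (rule filterlim_compose[rotated])
  moreover have "((\<lambda>w. 64 * \<kappa> / \<epsilon>^2 / w + B / w) \<longlongrightarrow> 0) at_top" by real_asymp
  ultimately have "(h \<longlongrightarrow> 0 + 0) at_top" unfolding h_def by (intro tendsto_add) auto
  then have "(h \<longlongrightarrow> 0) at_top" by simp
  then have hw: "(\<lambda>n. h (w n)) \<longlonglongrightarrow> 0" using \<omega> unfolding w_def by (rule filterlim_compose)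
  let ?prob = "\<lambda>n. measure_pmf.prob (random_graph n (p n)) {G. real (ex_sub G T H)
    \<le> (real (ex_star n T \<F>) + \<epsilon> * real n ^ vT) * p n ^ eT}"
  have "eventually (\<lambda>n. 1 - h (w n) \<le> ?prob n) sequentially"
  proof -
    have "eventually (\<lambda>n. brk (w n) \<le> 0) sequentially"
      using \<omega> brk0 unfolding w_def filterlim_iff by blast
    moreover have "eventually (\<lambda>n. 1 \<le> w n) sequentially"
      using \<omega> unfolding w_def filterlim_at_top by blast
    moreover have "eventually (\<lambda>n. max (max 1 n0) (card (verts H)) \<le> n) sequentially"
      by (rule eventually_ge_at_top)
    ultimately show ?thesis
    proof eventually_elim
      case (elim n)
      have n: "0 < n" "n0 \<le> n" "card (verts H) \<le> n" using elim by auto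
      let ?A = "edges (complete_graph n)"
      define \<sigma> where "\<sigma> = real n powr (real vT - real eT / m)"
      have "0 \<le> real vT - real eT / m" using m m0 vT_ge by (simp add: divide_simps mult.commute)
      then have \<sigma>: "1 \<le> \<sigma>" unfolding \<sigma>_def using n by (intro ge_one_powr_ge_zero) auto
      have pw: "p n = w n * real n powr (- (1 / m))"
        using n by (simp add: w_def powr_minus)
      have p1: "0 < p n" "p n \<le> 1"
      proof -
        show "0 < p n" unfolding pw using elim(2) n by (intro mult_pos_pos) auto
        show "p n \<le> 1" using p by simp
      qed
      have Np: "real n ^ vT * p n ^ eT = \<sigma> * w n ^ eT"
        using powr_product_eq[of "real n" vT "w n" "- (1 / m)" eT] n unfolding pw \<sigma>_def by simp
      have sub: "\<sigma> * w n \<le> real n ^ card V * p n ^ card E"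
        if "graph_iso T T'" "V \<subseteq> verts T'" "E \<subseteq> edges T'" "\<And>e. e \<in> E \<Longrightarrow> e \<subseteq> V" "E \<noteq> {}"
        for T' :: "nat ugraph" and V E
        using scaled_powr_bound[OF n(1) m0 m(2) elim(2) that] unfolding pw \<sigma>_def by (simp add: mult.commute)
      have lN: "\<sigma> * w n \<le> real n ^ vT * p n ^ eT"
        unfolding Np using \<sigma> elim(2) eT_ge self_le_power[of "w n" eT] by (intro mult_left_mono) auto
      have l0: "0 < \<sigma> * w n" using \<sigma> elim(2) by simp
      have x1: "1 \<le> w n ^ (eT + 1)" using elim(2) by (intro one_le_power)
      have "1 - ?prob n = bprob ?A (p n) (\<lambda>R. \<not> real (ex_sub (UGraph {..<n} R) T H)
        \<le> (real (ex_star n T \<F>) + \<epsilon> * real n ^ vT) * p n ^ eT)"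
        using p by (simp add: random_graph_prob bprob_not finite_complete_edges)
      also have "\<dots> \<le> bprob ?A (p n) (\<lambda>R. \<exists>I. I \<subseteq> present n R \<and> collection_free \<F> I \<and>
        (real (ex_star n T \<F>) + \<epsilon> * real n ^ vT) * p n ^ eT < real (card I))"
      proof (rule bprob_mono)
        fix R assume R: "R \<subseteq> ?A" and gt: "\<not> real (ex_sub (UGraph {..<n} R) T H)
          \<le> (real (ex_star n T \<F>) + \<epsilon> * real n ^ vT) * p n ^ eT"
        obtain R' where R': "R' \<in> free_subgraphs H n R" "card (present n R') = ex_sub (UGraph {..<n} R) T H"
          by (rule ex_sub_attained[OF R H(2)])
        show "\<exists>I. I \<subseteq> present n R \<and> collection_free \<F> I \<and>
          (real (ex_star n T \<F>) + \<epsilon> * real n ^ vT) * p n ^ eT < real (card I)"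
        proof (intro exI conjI)
          show "present n R' \<subseteq> present n R" using R'(1) by (auto simp: free_subgraphs_def)
          show "collection_free \<F> (present n R')"
            by (rule free_subgraph_collection_free[OF H(1) F'' R R'(1) n(3)])
          show "(real (ex_star n T \<F>) + \<epsilon> * real n ^ vT) * p n ^ eT < real (card (present n R'))"
            using gt R'(2) by simp
        qed
      qed (use p in auto)
      \<comment> \<open>Taking \<open>K = w n\<close> makes atypical graphs unlikely and adds one
        factor \<open>w n\<close> to the sum over fingerprints. Dividing by
        \<open>x = w n ^ (eT + 1)\<close> cancels all powers of \<open>w n\<close> and leaves
        \<sigma> times a constant.\<close>
      also have "\<dots> \<le> 64 * \<kappa> / (\<epsilon>^2 * (\<sigma> * w n)) + 2 ^ eT / w n + (w n ^ (eT + 1)) powr (C * \<sigma>)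
        * exp (2 ^ eT * (w n * real n ^ vT * p n ^ eT) / w n ^ (eT + 1)) * exp (- (\<epsilon>^2 * (\<sigma> * w n) / (768 * \<kappa>)))"
        unfolding \<kappa>_def
        by (rule free_collection_prob[OF p1 n(1) l0 lN sub \<epsilon> _ x1 _ cs[OF n(2), folded \<sigma>_def]])
          (use elim(2) C \<sigma> in auto)
      also have "\<dots> \<le> h (w n)"
      proof -
        have "64 * \<kappa> / (\<epsilon>^2 * (\<sigma> * w n)) \<le> 64 * \<kappa> / \<epsilon>^2 / w n"
        proof -
          have "\<epsilon>^2 * (1 * w n) \<le> \<epsilon>^2 * (\<sigma> * w n)"
            using \<sigma> elim(2) by (intro mult_left_mono mult_right_mono) auto
          moreover have "0 < \<epsilon>^2 * (1 * w n)" using \<epsilon> elim(2) by (intro mult_pos_pos) auto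
          ultimately have "64 * \<kappa> / (\<epsilon>^2 * (\<sigma> * w n)) \<le> 64 * \<kappa> / (\<epsilon>^2 * (1 * w n))"
            using \<kappa> by (intro divide_left_mono) (auto intro: mult_pos_pos)
          then show ?thesis by simp
        qed
        moreover have "(w n ^ (eT + 1)) powr (C * \<sigma>)
          * exp (2 ^ eT * (w n * real n ^ vT * p n ^ eT) / w n ^ (eT + 1)) * exp (- (\<epsilon>^2 * (\<sigma> * w n) / (768 * \<kappa>)))
          \<le> exp (brk (w n))"
        proof -
          have wp: "0 < w n" using elim(2) by simp
          have e1: "(w n ^ (eT + 1)) powr (C * \<sigma>) = exp (\<sigma> * (L * ln (w n)))"
          proof -
            have "ln (w n ^ (eT + 1)) = real (eT + 1) * ln (w n)" by (rule ln_realpow)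
            then show ?thesis using wp by (simp add: powr_def L_def algebra_simps del: power_Suc)
          qed
          have e2: "2 ^ eT * (w n * real n ^ vT * p n ^ eT) / w n ^ (eT + 1) = \<sigma> * B"
          proof -
            have "w n * real n ^ vT * p n ^ eT = w n * (\<sigma> * w n ^ eT)" using Np by (simp add: mult.assoc)
            then show ?thesis using wp by (simp add: B_def)
          qed
          have e3: "\<epsilon>^2 * (\<sigma> * w n) / (768 * \<kappa>) = \<sigma> * (c * w n)" by (simp add: c_def)
          have "(w n ^ (eT + 1)) powr (C * \<sigma>)
            * exp (2 ^ eT * (w n * real n ^ vT * p n ^ eT) / w n ^ (eT + 1)) * exp (- (\<epsilon>^2 * (\<sigma> * w n) / (768 * \<kappa>)))
            = exp (\<sigma> * brk (w n))"
            unfolding e1 e2 e3 exp_add[symmetric] brk_def by (simp add: algebra_simps)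
          also have "\<dots> \<le> exp (brk (w n))"
          proof -
            have "\<sigma> * brk (w n) \<le> 1 * brk (w n)" using \<sigma> elim(1) by (rule mult_right_mono_neg)
            then show ?thesis by simp
          qed
          finally show ?thesis .
        qed
        ultimately show ?thesis unfolding h_def B_def by linarith
      qed
      finally show ?case by linarith
    qed
  qed
  moreover have "(\<lambda>n. 1 - h (w n)) \<longlonglongrightarrow> 1 - 0" using hw by (intro tendsto_diff tendsto_const)
  then have "(\<lambda>n. 1 - h (w n)) \<longlonglongrightarrow> 1" by simp
  moreover have "eventually (\<lambda>n. ?prob n \<le> 1) sequentially" by (simp add: measure_pmf.prob_le_1)
  ultimately show ?thesis
    by (intro tendsto_sandwich[of "\<lambda>n. 1 - h (w n)" ?prob sequentially "\<lambda>_. 1"]) auto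
qed

end

section \<open>The lower bound\<close>

text \<open>Choose one member for each edge of the copy of \<open>H\<close>, then pass to a
  sub-collection of least size that still contains \<open>H\<close>. The first choice gives the
  bound by the number of edges of \<open>H\<close>, so that only clusters of bounded size have to be
  destroyed.\<close>

lemma minimal_covering_subset:
  fixes S :: "nat ugraph set" and H :: "'b ugraph"
  assumes H: "simple_graph H" and S: "copies H (UGraph X (edges (union_graph S))) \<noteq> {}"
  obtains F where "F \<subseteq> S" "finite F" "card F \<le> card (edges H)" "union_contains H F"
    "\<forall>G\<in>F. \<not> union_contains H (F - {G})"
proof -
  obtain H' where H': "edges H' \<subseteq> edges (union_graph S)" "graph_iso H H'"
    using S by (auto simp: copies_def subgraph_def)
  note s = graph_iso_simple[OF H H'(2)]
  have "\<forall>e\<in>edges H'. \<exists>G. G \<in> S \<and> e \<in> edges G" using H'(1) by auto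
  then obtain c where c: "\<And>e. e \<in> edges H' \<Longrightarrow> c e \<in> S \<and> e \<in> edges (c e)" by metis
  define F0 where "F0 = c ` edges H'"
  have finE: "finite (edges H')" using simple_graph_finite[OF s(1)] by simp
  have F0: "F0 \<subseteq> S" "finite F0" using c finE by (auto simp: F0_def)
  have cF0: "card F0 \<le> card (edges H)" unfolding F0_def s(3)[symmetric] by (rule card_image_le[OF finE])
  have "H' \<in> copies H (UGraph UNIV (edges (union_graph F0)))"
    using c H'(2) by (auto simp: copies_def subgraph_def F0_def)
  then have uF0: "union_contains H F0" by (auto simp: union_contains_def)
  let ?P = "\<lambda>F. F \<subseteq> F0 \<and> union_contains H F"
  obtain F where F: "?P F" "\<And>F'. ?P F' \<Longrightarrow> card F \<le> card F'"
    using ex_has_least_nat[of ?P F0 card] uF0 by auto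
  have finF: "finite F" using F(1) F0(2) finite_subset by auto
  show thesis
  proof (rule that[of F])
    show "card F \<le> card (edges H)" using card_mono[OF F0(2), of F] F(1) cF0 by simp
    show "\<forall>G\<in>F. \<not> union_contains H (F - {G})"
    proof (intro ballI notI)
      fix G assume G: "G \<in> F" and "union_contains H (F - {G})"
      then have "card F \<le> card (F - {G})" using F by blast
      moreover have "card (F - {G}) < card F" using G finF by (intro psubset_card_mono) auto
      ultimately show False by simp
    qed
  qed (use F F0 finF in auto)
qed

text \<open>From \<open>N k\<close> on, the slack \<open>1 / (1 + k)\<close> gives a value within
  \<open>1 / (1 + k)\<close> of 1. At \<open>n\<close>, use the largest \<open>k\<close> whose turn
  has come.\<close>

lemma diagonal_sequence:
  fixes Q :: "real \<Rightarrow> nat \<Rightarrow> real"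
  assumes "\<And>\<epsilon>. 0 < \<epsilon> \<Longrightarrow> \<epsilon> \<le> 1 \<Longrightarrow> Q \<epsilon> \<longlonglongrightarrow> 1"
  obtains e where "e \<longlonglongrightarrow> 0" "(\<lambda>n. Q (e n) n) \<longlonglongrightarrow> 1"
proof -
  have "\<forall>k. \<exists>N. \<forall>n\<ge>N. dist (Q (1 / (1 + real k)) n) 1 < 1 / (1 + real k)"
  proof
    fix k
    have "Q (1 / (1 + real k)) \<longlonglongrightarrow> 1" by (rule assms) auto
    moreover have "0 < 1 / (1 + real k)" by simp
    ultimately show "\<exists>N. \<forall>n\<ge>N. dist (Q (1 / (1 + real k)) n) 1 < 1 / (1 + real k)"
      unfolding lim_sequentially by blast
  qed
  then obtain N where N: "\<And>k n. N k \<le> n \<Longrightarrow> dist (Q (1 / (1 + real k)) n) 1 < 1 / (1 + real k)"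
    by metis
  \<comment> \<open>The inserted 0 keeps the maximum defined for small \<open>n\<close>, and
    \<open>k \<le> n\<close> keeps the set finite.\<close>
  define A where "A n = insert 0 {k. k \<le> n \<and> N k \<le> n}" for n
  define k where "k n = Max (A n)" for n
  have fin: "finite (A n)" for n by (simp add: A_def)
  have kA: "k n \<in> A n" for n unfolding k_def by (rule Max_in[OF fin]) (simp add: A_def)
  have kge: "K \<le> k n" if "K \<le> n" "N K \<le> n" for K n
    unfolding k_def by (rule Max_ge[OF fin]) (use that in \<open>simp add: A_def\<close>)
  have klim: "filterlim k at_top sequentially"
    unfolding filterlim_at_top eventually_sequentially
  proof
    fix K
    show "\<exists>M. \<forall>n\<ge>M. K \<le> k n" using kge by (intro exI[of _ "max K (N K)"]) auto
  qed
  define e where "e n = 1 / (1 + real (k n))" for n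
  have "(\<lambda>n. 1 / (1 + real n)) \<longlonglongrightarrow> 0" by real_asymp
  then have e0: "e \<longlonglongrightarrow> 0" unfolding e_def using klim by (rule filterlim_compose)
  have "eventually (\<lambda>n. norm (Q (e n) n - 1) \<le> e n) sequentially"
    using eventually_ge_at_top[of "N 0"]
  proof eventually_elim
    case (elim n)
    have "N (k n) \<le> n" using kA[of n] elim by (auto simp: A_def)
    then show ?case using N[of "k n" n] by (simp add: e_def dist_real_def)
  qed
  then have "(\<lambda>n. Q (e n) n - 1) \<longlonglongrightarrow> 0" using e0 by (rule Lim_null_comparison)
  then have "(\<lambda>n. Q (e n) n) \<longlonglongrightarrow> 1" by (simp add: LIM_zero_iff)
  then show thesis using e0 that by blast
qed

context pattern_graph
begin

text \<open>The collections to be destroyed. Their members may share edges, so overlapping pairs are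
  included. The demand for more than \<open>eT\<close> edges secures at least one factor
  \<open>p * n powr (1 / m)\<close> in the expectation.\<close>

definition dense_clusters :: "nat \<Rightarrow> nat \<Rightarrow> real \<Rightarrow> nat ugraph set set" where
  "dense_clusters n k m = {F. F \<subseteq> host n \<and> 2 \<le> card F \<and> card F \<le> k \<and> eT < card (edges (union_graph F)) \<and>
     m * (real (card (verts (union_graph F))) - real vT) \<le> real (card (edges (union_graph F))) - real eT}"

lemma dense_clusters_finite: "finite (dense_clusters n k m)"
  unfolding dense_clusters_def using finite_host by simp

text \<open>The union exceeds one copy by what the other has outside of the intersection, and by
  2-balancedness this surplus has at least \<open>m2 T\<close> edges per vertex.\<close>

lemma overlapping_pair_dense:
  assumes G: "G \<in> host n" "G' \<in> host n" "G \<noteq> G'" "edges G \<inter> edges G' \<noteq> {}"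
    and m: "m \<le> m2 T" and k: "2 \<le> k"
  shows "{G, G'} \<in> dense_clusters n k m"
proof -
  note a = hostD[OF G(1)] and b = hostD[OF G(2)]
  have vU: "card (verts G \<union> verts G') + card (verts G \<inter> verts G') = 2 * vT"
    using card_Un_Int[of "verts G" "verts G'"] a b by simp
  have eU: "card (edges G \<union> edges G') + card (edges G \<inter> edges G') = 2 * eT"
    using card_Un_Int[of "edges G" "edges G'"] a b by simp
  have sub: "verts G \<inter> verts G' \<subseteq> verts G" "edges G \<inter> edges G' \<subseteq> edges G"
    "\<And>e. e \<in> edges G \<inter> edges G' \<Longrightarrow> e \<subseteq> verts G \<inter> verts G'" using a(10) b(10) by auto
  note bal = sub_balanced[OF a(1) sub G(4)]
  have "m * (real vT - real (card (verts G \<inter> verts G'))) \<le> m2 T * (real vT - real (card (verts G \<inter> verts G')))"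
    using m bal(3) by (intro mult_right_mono) auto
  then have d: "m * (real vT - real (card (verts G \<inter> verts G'))) \<le> real eT - real (card (edges G \<inter> edges G'))"
    using bal(1) by simp
  \<comment> \<open>If all edges were common, the balance inequality would force all vertices to be
    common too, and the copies would coincide.\<close>
  have "card (edges G \<inter> edges G') \<noteq> eT"
  proof
    assume e: "card (edges G \<inter> edges G') = eT"
    then have "m2 T * (real vT - real (card (verts G \<inter> verts G'))) \<le> 0" using bal(1) by simp
    then have "real vT - real (card (verts G \<inter> verts G')) \<le> 0" using m2_T_pos by (simp add: mult_le_0_iff)
    then have v: "card (verts G \<inter> verts G') = vT" using bal(3) by simp
    have "verts G \<inter> verts G' = verts G" "verts G \<inter> verts G' = verts G'"
      by (rule card_subset_eq; use a b v in simp)+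
    moreover have "edges G \<inter> edges G' = edges G" "edges G \<inter> edges G' = edges G'"
      by (rule card_subset_eq; use a b e in simp)+
    ultimately have "verts G = verts G'" "edges G = edges G'" by auto
    then show False using G(3) by (cases G; cases G') auto
  qed
  then have lt: "card (edges G \<inter> edges G') < eT" using bal(4) by simp
  have r: "real (card (verts G \<union> verts G')) = 2 * real vT - real (card (verts G \<inter> verts G'))"
    "real (card (edges G \<union> edges G')) = 2 * real eT - real (card (edges G \<inter> edges G'))"
    using vU eU by linarith+
  have "m * (real (card (verts G \<union> verts G')) - real vT) \<le> real (card (edges G \<union> edges G')) - real eT"
    using d unfolding r by (simp add: algebra_simps)
  moreover have "eT < card (edges G \<union> edges G')" using lt eU by simp
  ultimately show ?thesis using G k by (simp add: dense_clusters_def)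
qed

text \<open>After deleting one copy from every dense cluster the remaining copies are edge-disjoint, and a
  copy of \<open>H\<close> in their union would yield a covering of small density, which must be in \<open>\<F>\<close>.\<close>

lemma ex_sub_lower:
  assumes H: "simple_graph H" "2 \<le> card (edges H)"
    and m: "0 < m" "m \<le> m2 T"
    and cov: "\<And>F. T_covering T H F \<Longrightarrow> (\<exists>F'\<in>\<F>. collection_iso F' F) \<or> ennreal m \<le> T_density T F"
    and C: "C \<subseteq> host n" "collection_free \<F> C" and R: "R \<subseteq> edges (complete_graph n)"
  defines "\<D> \<equiv> dense_clusters n (card (edges H)) m"
  shows "card {G \<in> C. edges G \<subseteq> R} \<le> ex_sub (UGraph {..<n} R) T H + card {F \<in> \<D>. edges (union_graph F) \<subseteq> R}"
proof -
  define P where "P = {G \<in> C. edges G \<subseteq> R}"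
  define \<B> where "\<B> = {F \<in> \<D>. edges (union_graph F) \<subseteq> R}"
  \<comment> \<open>Deleting one representative of each cluster present destroys all of them, at the
    price of at most one copy per cluster.\<close>
  define pick where "pick F = (SOME G. G \<in> F)" for F :: "nat ugraph set"
  have pick: "pick F \<in> F" if "F \<in> \<D>" for F
  proof -
    have "F \<noteq> {}" using that by (auto simp: \<D>_def dense_clusters_def)
    then show ?thesis unfolding pick_def by (simp add: some_in_eq)
  qed
  define S where "S = P - pick ` \<B>"
  have fin\<B>: "finite \<B>" using dense_clusters_finite by (simp add: \<B>_def \<D>_def)
  have S: "S \<subseteq> P" "S \<subseteq> C" "S \<subseteq> host n" using C by (auto simp: S_def P_def)
  have finS: "finite S" by (rule finite_subset[OF S(3) finite_host])
  have no_cluster: "F \<notin> \<D>" if "F \<subseteq> S" for F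
  proof
    assume F: "F \<in> \<D>"
    have "edges (union_graph F) \<subseteq> R" using that S(1) by (auto simp: P_def)
    then have "F \<in> \<B>" using F by (simp add: \<B>_def)
    then have "pick F \<notin> S" by (auto simp: S_def)
    then show False using pick[OF F] that by blast
  qed
  have "H_free H (UGraph {..<n} (edges (union_graph S)))"
    unfolding H_free_def
  proof (rule ccontr)
    assume "copies H (UGraph {..<n} (edges (union_graph S))) \<noteq> {}"
    then obtain F where F: "F \<subseteq> S" "finite F" "card F \<le> card (edges H)" "union_contains H F"
      "\<forall>G\<in>F. \<not> union_contains H (F - {G})"
      by (rule minimal_covering_subset[OF H(1)])
    have iso: "graph_iso T G" if "G \<in> F" for G using that F(1) S(3) hostD(1) by blast
    \<comment> \<open>Two members sharing an edge would be a surviving dense cluster. Hence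
      \<open>F\<close> is edge-disjoint, as a covering has to be.\<close>
    have disj: "edges G \<inter> edges G' = {}" if "G \<in> F" "G' \<in> F" "G \<noteq> G'" for G G'
    proof (rule ccontr)
      assume ne: "edges G \<inter> edges G' \<noteq> {}"
      have "G \<in> host n" "G' \<in> host n" using that F(1) S(3) by auto
      then have "{G, G'} \<in> \<D>" unfolding \<D>_def by (rule overlapping_pair_dense[OF _ _ that(3) ne m(2) H(2)])
      then show False using no_cluster[of "{G, G'}"] that F(1) by auto
    qed
    have "T_covering T H F"
      unfolding T_covering_def using F(2,4,5) iso disj by simp
    then consider F' where "F' \<in> \<F>" "collection_iso F' F" | "ennreal m \<le> T_density T F" using cov by blast
    then show False
    proof cases
      case 1
      then show ?thesis using C(2) F(1) S(2) unfolding collection_free_def by (meson order_trans)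
    next
      case 2
      \<comment> \<open>A sub-collection on which the density is at least \<open>m\<close> is a
        dense cluster of surviving copies, which is impossible.\<close>
      obtain F' where F': "F' \<subseteq> F" "2 \<le> card F'"
        "m * real (card (verts (union_graph F')) - vT) \<le> real (card (edges (union_graph F')) - eT)"
        by (rule T_density_ge_witness[OF 2 m(1) F(2)])
      have finF': "finite F'" by (rule finite_subset[OF F'(1) F(2)])
      have iso': "\<And>G. G \<in> F' \<Longrightarrow> graph_iso T G" using iso F'(1) by auto
      have "F' \<noteq> {}" using F'(2) by auto
      then obtain G where G: "G \<in> F'" by blast
      note c = card_union_iso[OF simple_T finF' iso']
      have e: "card (edges (union_graph F')) = card F' * eT"
        by (rule card_edges_disjoint_union[OF simple_T finF' iso']) (use disj F'(1) in auto)
      have "2 * eT \<le> card F' * eT" using F'(2) by (rule mult_le_mono1)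
      then have e': "eT < card (edges (union_graph F'))" unfolding e using eT_ge by linarith
      have "F' \<in> \<D>"
        unfolding \<D>_def dense_clusters_def
      proof (intro CollectI conjI)
        show "F' \<subseteq> host n" using F'(1) F(1) S(3) by auto
        show "card F' \<le> card (edges H)" using card_mono[OF F(2) F'(1)] F(3) by simp
        have "real (card (verts (union_graph F')) - vT) = real (card (verts (union_graph F'))) - real vT"
          using c(3)[OF _ G] by (rule of_nat_diff) simp
        moreover have "real (card (edges (union_graph F')) - eT) = real (card (edges (union_graph F'))) - real eT"
          using e' by (intro of_nat_diff) simp
        ultimately show "m * (real (card (verts (union_graph F'))) - real vT) \<le> real (card (edges (union_graph F'))) - real eT"
          using F'(3) by (simp only:)
      qed (use F'(2) e' in auto)
      then show ?thesis using no_cluster F'(1) F(1) by blast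
    qed
  qed
  moreover have "edges (union_graph S) \<subseteq> R" using S(1) by (auto simp: P_def)
  ultimately have "edges (union_graph S) \<in> free_subgraphs H n R" by (simp add: free_subgraphs_def)
  then have "card (present n (edges (union_graph S))) \<le> ex_sub (UGraph {..<n} R) T H"
    by (rule ex_sub_ge[OF R])
  moreover have "card S \<le> card (present n (edges (union_graph S)))"
    by (rule card_mono) (use S(3) finite_host in auto)
  moreover have "card P - card (pick ` \<B>) \<le> card S"
    unfolding S_def by (rule diff_card_le_card_Diff) (use fin\<B> in simp)
  moreover have "card (pick ` \<B>) \<le> card \<B>" by (rule card_image_le[OF fin\<B>])
  ultimately show ?thesis unfolding P_def \<B>_def by linarith
qed

text \<open>Compared with a single copy, a cluster with v vertices and e edges contributes an extra
  factor \<open>n ^ (v - vT) * p ^ (e - eT)\<close>. By the density condition it is at most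
  \<open>(p * n powr (1 / m)) ^ (e - eT)\<close>, where the base is at most 1 and the exponent at
  least 1.\<close>

lemma dense_clusters_expectation:
  assumes n: "0 < n" and p: "0 < p" "p \<le> 1" and m: "0 < m"
    and x: "p * real n powr (1 / m) \<le> 1"
  shows "bexp (edges (complete_graph n)) p (\<lambda>R. real (card {F \<in> dense_clusters n k m. edges (union_graph F) \<subseteq> R}))
    \<le> types_upto (k * vT) * (real n ^ vT * p ^ eT * (p * real n powr (1 / m)))"
proof -
  let ?A = "edges (complete_graph n)"
  let ?x = "p * real n powr (1 / m)"
  let ?\<D> = "dense_clusters n k m"
  let ?v = "\<lambda>F :: nat ugraph set. card (verts (union_graph F))" and ?e = "\<lambda>F :: nat ugraph set. card (edges (union_graph F))"
  have x0: "0 < ?x" using p n by simp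
  have "bexp ?A p (\<lambda>R. real (card {F \<in> ?\<D>. edges (union_graph F) \<subseteq> R}))
    = bexp ?A p (\<lambda>R. \<Sum>F\<in>?\<D>. of_bool (edges (union_graph F) \<subseteq> R))"
    using dense_clusters_finite by (intro bexp_cong) (simp add: Int_def)
  also have "\<dots> = (\<Sum>F\<in>?\<D>. p ^ ?e F)"
    unfolding bexp_sum
  proof (rule sum.cong[OF refl])
    fix F assume "F \<in> ?\<D>"
    then have "edges (union_graph F) \<subseteq> ?A" using hostD(6) by (fastforce simp: dense_clusters_def)
    then show "bexp ?A p (\<lambda>R. of_bool (edges (union_graph F) \<subseteq> R)) = p ^ ?e F"
      using bprob_superset[OF finite_complete_edges] unfolding bprob_def by blast
  qed
  also have "\<dots> \<le> types_upto (k * vT) * (real n ^ vT * p ^ eT * ?x)"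
  proof (rule sum_collections_le[of "{..<n}" "host n"])
    fix F assume F: "F \<in> ?\<D>"
    have iso: "\<And>G. G \<in> F \<Longrightarrow> graph_iso T G" using F hostD(1) by (auto simp: dense_clusters_def)
    have finF: "finite F" using F finite_subset[OF _ finite_host] by (auto simp: dense_clusters_def)
    note c = card_union_iso[OF simple_T finF iso]
    have "F \<noteq> {}" using F by (auto simp: dense_clusters_def)
    then obtain G where "G \<in> F" by blast
    have vge: "vT \<le> ?v F" by (rule c(3)[OF _ \<open>G \<in> F\<close>])
    have "?v F \<le> card F * vT" by (rule c(2))
    also have "\<dots> \<le> k * vT" using F by (intro mult_le_mono1) (simp add: dense_clusters_def)
    finally show "?v F \<le> k * vT" .
    have e: "eT < ?e F" and d: "m * (real (?v F) - real vT) \<le> real (?e F) - real eT"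
      using F by (simp_all add: dense_clusters_def del: verts_union_graph edges_union_graph)
    have "real n ^ (?v F - vT) = real n powr (real (?v F) - real vT)"
      using n vge by (simp add: powr_realpow[symmetric] of_nat_diff del: verts_union_graph)
    also have "\<dots> \<le> real n powr (1 / m * real (?e F - eT))"
    proof (rule powr_mono)
      have "real (?v F) - real vT \<le> (real (?e F) - real eT) / m"
        using d m by (simp add: pos_le_divide_eq mult.commute del: verts_union_graph edges_union_graph)
      then show "real (?v F) - real vT \<le> 1 / m * real (?e F - eT)"
        using e by (simp add: of_nat_diff del: verts_union_graph edges_union_graph)
    qed (use n in simp)
    also have "\<dots> = (real n powr (1 / m)) ^ (?e F - eT)"
      using n by (subst powr_power) (auto simp: mult.commute)
    finally have "real n ^ (?v F - vT) * p ^ (?e F - eT) \<le> (real n powr (1 / m)) ^ (?e F - eT) * p ^ (?e F - eT)"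
      using p by (intro mult_right_mono) auto
    also have "\<dots> = ?x ^ (?e F - eT)" by (simp add: power_mult_distrib mult.commute)
    also have "\<dots> \<le> ?x ^ 1"
      by (rule power_decreasing) (use e x x0 in auto)
    finally have "real n ^ vT * p ^ eT * (real n ^ (?v F - vT) * p ^ (?e F - eT)) \<le> real n ^ vT * p ^ eT * ?x"
      using p by (intro mult_left_mono) auto
    moreover have "real n ^ vT * p ^ eT * (real n ^ (?v F - vT) * p ^ (?e F - eT)) = real n ^ ?v F * p ^ ?e F"
    proof -
      have "real n ^ ?v F = real n ^ vT * real n ^ (?v F - vT)" using vge by (simp only: power_add[symmetric] le_add_diff_inverse)
      moreover have "p ^ ?e F = p ^ eT * p ^ (?e F - eT)" using e by (simp only: power_add[symmetric] le_add_diff_inverse less_imp_le)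
      ultimately show ?thesis by (simp only: mult_ac)
    qed
    ultimately show "real (card {..<n}) ^ ?v F * p ^ ?e F \<le> real n ^ vT * p ^ eT * ?x"
      by (simp only: card_lessThan)
  next
    show "verts G \<subseteq> {..<n} \<and> (\<forall>e\<in>edges G. e \<subseteq> verts G)" if "G \<in> host n" for G
      using hostD(2,10)[OF that] by simp
    show "dense_clusters n k m \<subseteq> Pow (host n)" by (auto simp: dense_clusters_def)
    show "0 \<le> real n ^ vT * p ^ eT * ?x" using p x0 by simp
  qed (use n finite_host in auto)
  finally show ?thesis .
qed

text \<open>Two errors: Chebyshev's inequality for the extremal collection, controlled by
  \<open>p * n powr (vT / eT)\<close> tending to infinity, and Markov's inequality for the dense
  clusters, controlled by \<open>p * n powr (1 / m)\<close> tending to 0.\<close>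

lemma lower_probability:
  fixes p :: "nat \<Rightarrow> real"
  assumes H: "simple_graph H" "2 \<le> card (edges H)"
    and m: "0 < m" "m \<le> m2 T" and ne: "{} \<notin> \<F>"
    and cov: "\<And>F. T_covering T H F \<Longrightarrow> (\<exists>F'\<in>\<F>. collection_iso F' F) \<or> ennreal m \<le> T_density T F"
    and p: "\<And>n. 0 \<le> p n \<and> p n \<le> 1"
    and y: "filterlim (\<lambda>n. p n * real n powr (real vT / real eT)) at_top sequentially"
    and x: "(\<lambda>n. p n * real n powr (1 / m)) \<longlonglongrightarrow> 0"
    and \<epsilon>: "0 < \<epsilon>"
  shows "(\<lambda>n. measure_pmf.prob (random_graph n (p n)) {G. real (ex_sub G T H)
    \<ge> (real (ex_star n T \<F>) - \<epsilon> * real n ^ vT) * p n ^ eT}) \<longlonglongrightarrow> 1"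
proof -
  define Y where "Y n = p n * real n powr (real vT / real eT)" for n
  define X where "X n = p n * real n powr (1 / m)" for n
  define k where "k = card (edges H)"
  define \<kappa> where "\<kappa> = types_upto (2 * vT)"
  define \<kappa>' where "\<kappa>' = types_upto (k * vT)"
  define h where "h n = 16 * \<kappa> / \<epsilon>^2 / Y n + 2 * \<kappa>' / \<epsilon> * X n" for n
  let ?prob = "\<lambda>n. measure_pmf.prob (random_graph n (p n)) {G. real (ex_sub G T H)
    \<ge> (real (ex_star n T \<F>) - \<epsilon> * real n ^ vT) * p n ^ eT}"
  have "(\<lambda>n. 16 * \<kappa> / \<epsilon>^2 / Y n) \<longlonglongrightarrow> 0"
    using y unfolding Y_def by (intro tendsto_divide_0[OF tendsto_const] filterlim_at_top_imp_at_infinity)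
  moreover have "(\<lambda>n. 2 * \<kappa>' / \<epsilon> * X n) \<longlonglongrightarrow> 2 * \<kappa>' / \<epsilon> * 0"
    using x unfolding X_def by (intro tendsto_mult tendsto_const)
  ultimately have "h \<longlonglongrightarrow> 0 + 2 * \<kappa>' / \<epsilon> * 0" unfolding h_def by (intro tendsto_add)
  then have h0: "h \<longlonglongrightarrow> 0" by simp
  have "eventually (\<lambda>n. 1 - h n \<le> ?prob n) sequentially"
  proof -
    have "eventually (\<lambda>n. X n < 1) sequentially"
      using x unfolding X_def by (intro order_tendstoD(2)) auto
    moreover have "eventually (\<lambda>n. 1 \<le> Y n) sequentially"
      using y unfolding Y_def filterlim_at_top by blast
    moreover have "eventually (\<lambda>n. 1 \<le> n) sequentially"
      by (rule eventually_ge_at_top)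
    ultimately show ?thesis
    proof eventually_elim
      case (elim n)
      have n: "0 < n" using elim by simp
      let ?A = "edges (complete_graph n)"
      have pY: "p n = Y n * real n powr (- (real vT / real eT))"
        using n by (simp add: Y_def powr_minus)
      have p1: "0 < p n" "p n \<le> 1"
      proof -
        show "0 < p n" unfolding pY using elim(2) n by (intro mult_pos_pos) auto
        show "p n \<le> 1" using p by simp
      qed
      define \<mu> where "\<mu> = real n ^ vT * p n ^ eT"
      have \<mu>: "0 < \<mu>" using p1 n by (simp add: \<mu>_def)
      \<comment> \<open>Half of the slack for each of the two errors.\<close>
      define t where "t = \<epsilon> / 2 * \<mu>"
      have t: "0 < t" using \<epsilon> \<mu> by (simp add: t_def)
      obtain C where C: "C \<subseteq> host n" "collection_free \<F> C" "card C = ex_star n T \<F>"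
        by (rule ex_star_attained[OF ne])
      have sub: "Y n \<le> real n ^ card V * p n ^ card E"
        if "graph_iso T T'" "V \<subseteq> verts T'" "E \<subseteq> edges T'" "\<And>e. e \<in> E \<Longrightarrow> e \<subseteq> V" "E \<noteq> {}"
        for T' :: "nat ugraph" and V E
        using scaled_powr_bound0[OF n elim(2) that] unfolding pY .
      have Y0: "0 < Y n" using elim(2) by simp
      define \<D> where "\<D> = dense_clusters n k m"
      define B where "B R = card {F \<in> \<D>. edges (union_graph F) \<subseteq> R}" for R
      define Z where "Z R = card {G \<in> C. edges G \<subseteq> R}" for R
      have "1 - ?prob n = bprob ?A (p n) (\<lambda>R. \<not> (real (ex_star n T \<F>) - \<epsilon> * real n ^ vT) * p n ^ eT
          \<le> real (ex_sub (UGraph {..<n} R) T H))"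
        using p by (simp add: random_graph_prob bprob_not finite_complete_edges)
      also have "\<dots> \<le> bprob ?A (p n) (\<lambda>R. t \<le> \<bar>real (Z R) - real (card C) * p n ^ eT\<bar> \<or> t \<le> real (B R))"
      proof (rule bprob_mono)
        fix R assume R: "R \<subseteq> ?A" and lt: "\<not> (real (ex_star n T \<F>) - \<epsilon> * real n ^ vT) * p n ^ eT
          \<le> real (ex_sub (UGraph {..<n} R) T H)"
        have "Z R \<le> ex_sub (UGraph {..<n} R) T H + B R"
          unfolding Z_def B_def \<D>_def k_def by (rule ex_sub_lower[OF H m cov C(1,2) R])
        then have 1: "real (Z R) \<le> real (ex_sub (UGraph {..<n} R) T H) + real (B R)" by linarith
        have 2: "(real (ex_star n T \<F>) - \<epsilon> * real n ^ vT) * p n ^ eT = real (card C) * p n ^ eT - 2 * t"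
          by (simp add: C(3) t_def \<mu>_def algebra_simps)
        show "t \<le> \<bar>real (Z R) - real (card C) * p n ^ eT\<bar> \<or> t \<le> real (B R)"
          using 1 lt unfolding 2 by linarith
      qed (use p1 in auto)
      also have "\<dots> \<le> bprob ?A (p n) (\<lambda>R. t \<le> \<bar>real (Z R) - real (card C) * p n ^ eT\<bar>)
          + bprob ?A (p n) (\<lambda>R. t \<le> real (B R))"
        by (rule bprob_disj) (use p1 in auto)
      also have "\<dots> \<le> 16 * \<kappa> / \<epsilon>^2 / Y n + 2 * \<kappa>' / \<epsilon> * X n"
      proof (rule add_mono)
        have "bprob ?A (p n) (\<lambda>R. t \<le> \<bar>real (Z R) - real (card C) * p n ^ eT\<bar>)
          \<le> 4 * types_upto (2 * vT) * ((real n ^ vT * p n ^ eT)^2 / Y n) / t^2"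
          unfolding Z_def
          by (rule card_present_deviation[OF _ p1(2) C(1) t overlap_sum[OF n C(1) _ Y0 sub]]) (use p1 in auto)
        also have "\<dots> = 16 * \<kappa> / \<epsilon>^2 / Y n"
          using \<mu> Y0 \<epsilon> unfolding \<mu>_def[symmetric] \<kappa>_def[symmetric] by (simp add: t_def field_simps power2_eq_square)
        finally show "bprob ?A (p n) (\<lambda>R. t \<le> \<bar>real (Z R) - real (card C) * p n ^ eT\<bar>) \<le> 16 * \<kappa> / \<epsilon>^2 / Y n" .
        have "bprob ?A (p n) (\<lambda>R. t \<le> real (B R)) \<le> bexp ?A (p n) (\<lambda>R. real (B R)) / t"
          by (rule bprob_markov) (use p1 t in auto)
        also have "\<dots> \<le> \<kappa>' * (\<mu> * X n) / t"
        proof (rule divide_right_mono)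
          show "bexp ?A (p n) (\<lambda>R. real (B R)) \<le> \<kappa>' * (\<mu> * X n)"
            unfolding B_def \<D>_def \<kappa>'_def \<mu>_def X_def
            by (rule dense_clusters_expectation[OF n p1 m(1)]) (use elim(1) in \<open>simp add: X_def\<close>)
        qed (use t in simp)
        also have "\<dots> = 2 * \<kappa>' / \<epsilon> * X n" using \<mu> \<epsilon> by (simp add: t_def field_simps)
        finally show "bprob ?A (p n) (\<lambda>R. t \<le> real (B R)) \<le> 2 * \<kappa>' / \<epsilon> * X n" .
      qed
      finally show ?case unfolding h_def by linarith
    qed
  qed
  moreover have "(\<lambda>n. 1 - h n) \<longlonglongrightarrow> 1 - 0" using h0 by (intro tendsto_diff tendsto_const)
  then have "(\<lambda>n. 1 - h n) \<longlonglongrightarrow> 1" by simp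
  moreover have "eventually (\<lambda>n. ?prob n \<le> 1) sequentially" by (simp add: measure_pmf.prob_le_1)
  ultimately show ?thesis
    by (intro tendsto_sandwich[of "\<lambda>n. 1 - h n" ?prob sequentially "\<lambda>_. 1"]) auto
qed

end

section \<open>From thresholds to limits\<close>

lemma smallo_powr_imp_at_top:
  fixes p :: "nat \<Rightarrow> real"
  assumes "(\<lambda>n. real n powr (- a)) \<in> o(p)" "\<And>n. 0 \<le> p n"
  shows "filterlim (\<lambda>n. p n * real n powr a) at_top sequentially"
  unfolding filterlim_at_top_gt[where c = 0]
proof (intro allI impI)
  fix Z :: real assume Z: "0 < Z"
  have "eventually (\<lambda>n. norm (real n powr (- a)) \<le> 1 / Z * norm (p n)) sequentially"
    by (rule landau_o.smallD[OF assms(1)]) (use Z in simp)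
  then show "eventually (\<lambda>n. Z \<le> p n * real n powr a) sequentially"
    using eventually_ge_at_top[of 1]
  proof eventually_elim
    case (elim n)
    define q where "q = real n powr a"
    have q: "0 < q" "real n powr (- a) = 1 / q" using elim(2) by (auto simp: powr_minus_divide q_def)
    have "1 / q \<le> p n / Z" using elim(1) q(1) assms(2)[of n] unfolding q(2) by simp
    then show ?case using q(1) Z unfolding q_def[symmetric] by (simp add: field_simps)
  qed
qed

lemma smallo_powr_imp_tendsto_0:
  fixes p :: "nat \<Rightarrow> real"
  assumes "p \<in> o(\<lambda>n. real n powr (- a))"
  shows "(\<lambda>n. p n * real n powr a) \<longlonglongrightarrow> 0"
  using smalloD_tendsto[OF assms] by (simp add: powr_minus divide_inverse)

lemma tendsto_0_mult_smallo:
  fixes e :: "nat \<Rightarrow> real"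
  assumes "e \<longlonglongrightarrow> 0"
  shows "(\<lambda>n. e n * real n ^ k) \<in> o(\<lambda>n. real n ^ k)"
proof (rule smalloI_tendsto)
  show "eventually (\<lambda>n. real n ^ k \<noteq> 0) sequentially"
    using eventually_gt_at_top[of 0] by eventually_elim simp
  then have "eventually (\<lambda>n. e n = e n * real n ^ k / real n ^ k) sequentially"
    by eventually_elim simp
  then show "(\<lambda>n. e n * real n ^ k / real n ^ k) \<longlonglongrightarrow> 0"
    using assms by (rule Lim_transform_eventually[rotated])
qed

context pattern_graph
begin

lemma collection_iso_singleton:
  assumes "graph_iso T A" "graph_iso T B"
  shows "collection_iso {A} {B}"
proof -
  obtain f g where f: "inj_on f (verts T)" "A = graph_image f T" and g: "inj_on g (verts T)" "B = graph_image g T"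
    using assms unfolding graph_iso_def by (elim exE conjE)
  let ?h = "g \<circ> inv_into (verts T) f"
  have "graph_image ?h A = B"
    unfolding f(2) g(2) graph_image_comp
    by (rule graph_image_cong) (use inv_into_f_f[OF f(1)] simple_graph_edgeD[OF simple_T] in auto)
  moreover have "inj_on ?h (verts A)"
    unfolding f(2) verts_graph_image
    by (rule comp_inj_on[OF inj_on_inv_into]) (use g(1) inv_into_into[of _ f "verts T"] in \<open>auto intro!: inj_on_subset[OF g(1)]\<close>)
  ultimately show ?thesis unfolding collection_iso_def by (intro exI[of _ ?h]) simp
qed

text \<open>If one copy of \<open>T\<close> carries a copy of \<open>H\<close>, then every copy of
  \<open>T\<close> does, once \<open>n\<close> leaves room for isolated vertices. So an
  \<open>H\<close>-free graph contains no copy of \<open>T\<close>, and the probability is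
  eventually equal to 1.\<close>

lemma single_covering_probability:
  fixes p :: "nat \<Rightarrow> real"
  assumes H: "simple_graph H" "2 \<le> card (edges H)"
    and F: "T_covering T H F" "\<not> 2 \<le> card F"
    and p: "\<And>n. 0 \<le> p n \<and> p n \<le> 1"
  shows "(\<lambda>n. measure_pmf.prob (random_graph n (p n)) {G. real (ex_sub G T H)
    \<le> (real (ex_star n T \<F>) + 0) * p n ^ eT}) \<longlonglongrightarrow> 1"
proof -
  have F': "finite F" "union_contains H F" "\<forall>G\<in>F. graph_iso T G" using F(1) unfolding T_covering_def by auto
  have "card F \<noteq> 0" using covering_nonempty[OF F'(2) H(2)] F'(1) by simp
  then have "card F = 1" using F(2) by simp
  then obtain A where A: "F = {A}" by (auto simp: card_1_singleton_iff)
  have "eventually (\<lambda>n. measure_pmf.prob (random_graph n (p n)) {G. real (ex_sub G T H)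
    \<le> (real (ex_star n T \<F>) + 0) * p n ^ eT} = 1) sequentially"
    using eventually_ge_at_top[of "card (verts H)"]
  proof eventually_elim
    case (elim n)
    let ?A = "edges (complete_graph n)"
    have zero: "ex_sub (UGraph {..<n} R) T H = 0" if R: "R \<subseteq> ?A" for R
    proof -
      obtain R' where R': "R' \<in> free_subgraphs H n R" "card (present n R') = ex_sub (UGraph {..<n} R) T H"
        by (rule ex_sub_attained[OF R H(2)])
      have free: "collection_free {F} (present n R')"
        by (rule free_subgraph_collection_free[OF H(1) _ R R'(1) elim]) (use F' in auto)
      have "present n R' = {}"
      proof (rule ccontr)
        assume "present n R' \<noteq> {}"
        then obtain B where B: "B \<in> present n R'" by blast
        then have "graph_iso T B" using hostD(1) by blast
        then have "collection_iso F {B}" unfolding A using F'(3) A by (intro collection_iso_singleton) auto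
        moreover have "{B} \<subseteq> present n R'" using B by simp
        ultimately have "\<exists>D F'. D \<subseteq> present n R' \<and> F' \<in> {F} \<and> collection_iso F' D"
          by (intro exI[of _ "{B}"] exI[of _ F]) simp
        then show False using free unfolding collection_free_def by (rule notE[rotated])
      qed
      then show ?thesis using R'(2) by (simp only: card.empty)
    qed
    have "bprob ?A (p n) (\<lambda>R. real (ex_sub (UGraph {..<n} R) T H) \<le> (real (ex_star n T \<F>) + 0) * p n ^ eT)
        = bexp ?A (p n) (\<lambda>R. 1)"
      unfolding bprob_def by (rule bexp_cong) (use zero p in simp)
    then show ?case using p by (simp add: random_graph_prob bexp_const finite_complete_edges)
  qed
  then show ?thesis by (rule tendsto_eventually)
qed

end

theorem theorem1p9:
  fixes T :: "'a ugraph" and H :: "'b ugraph"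
    and Fe :: "nat ugraph set" and Fs :: "nat ugraph set list"
    and i :: nat and p :: "nat \<Rightarrow> real"
  assumes "simple_graph T" and "simple_graph H"
    and "2 \<le> card (edges H)"
    and "two_balanced T" and "m2 H \<le> m2 T"
    and "edgewise_covering T H Fe" and "T_resolution T H Fe Fs"
    and "i \<in> {1..length Fs}"
    and "\<And>n. 0 \<le> p n \<and> p n \<le> 1"
  shows
    "(threshold0 T \<in> o(p) \<and> p \<in> o(threshold T (Fs ! (i - 1))) \<longrightarrow>
        (\<exists>g :: nat \<Rightarrow> real. g \<in> o(\<lambda>n. real n ^ card (verts T)) \<and>
          (\<lambda>n. measure_pmf.prob (random_graph n (p n))
             {G. real (ex_sub G T H) \<ge>
                 (real (ex_star n T (set (take (i - 1) Fs))) + g n) * p n ^ card (edges T)})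
          \<longlonglongrightarrow> 1)) \<and>
     (threshold T (Fs ! (i - 1)) \<in> o(p) \<longrightarrow>
        (\<exists>g :: nat \<Rightarrow> real. g \<in> o(\<lambda>n. real n ^ card (verts T)) \<and>
          (\<lambda>n. measure_pmf.prob (random_graph n (p n))
             {G. real (ex_sub G T H) \<le>
                 (real (ex_star n T (set (take i Fs))) + g n) * p n ^ card (edges T)})
          \<longlonglongrightarrow> 1))"
proof -
  interpret pattern_graph T using assms by unfold_locales
  note H = assms(2,3) and p = assms(9)
  define F where "F = Fs ! (i - 1)"
  define m where "m = enn2real (T_density T F)"
  have i: "i - 1 < length Fs" using assms(8) by auto
  have res1: "T_covering T H (Fs ! j) \<and> T_density T (Fs ! j) \<le> T_density T Fe" if "j < length Fs" for j
    using assms(7) that unfolding T_resolution_def by simp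
  have res2: "\<exists>j<length Fs. collection_iso F' (Fs ! j)"
    if "T_covering T H F'" "T_density T F' \<le> T_density T Fe" for F'
    using assms(7) that unfolding T_resolution_def by blast
  have sorted: "T_density T (Fs ! j) \<le> T_density T (Fs ! k)" if "j \<le> k" "k < length Fs" for j k
    using assms(7) sorted_nth_mono[of "map (T_density T) Fs" j k] that unfolding T_resolution_def by simp
  have F: "T_covering T H F" "T_density T F \<le> T_density T Fe" using res1[OF i] by (simp_all add: F_def)
  have Fe: "T_density T Fe \<le> ennreal (m2 T)" by (rule edgewise_density_le[OF assms(2,6,5)])
  have "T_density T F \<le> ennreal (m2 T)" using F(2) Fe by (rule order_trans)
  then have dens: "T_density T F = ennreal m" and m_le: "m \<le> m2 T"
  proof -
    assume le: "T_density T F \<le> ennreal (m2 T)"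
    then have "T_density T F < top" using ennreal_less_top by (rule le_less_trans)
    then show *: "T_density T F = ennreal m" unfolding m_def by simp
    show "m \<le> m2 T" using le m2_T_pos unfolding * by (simp add: ennreal_le_iff)
  qed
  \<comment> \<open>With fewer than two members the supremum defining the density is over the empty
    set.\<close>
  have two: "2 \<le> card F" if "T_density T F \<noteq> 0"
  proof (rule ccontr)
    assume n2: "\<not> 2 \<le> card F"
    have "finite F" using F(1) by (simp add: T_covering_def)
    then have "T_density T F \<le> ennreal 0"
      by (subst T_density_le_iff) (use n2 card_mono in \<open>auto dest: card_mono\<close>)
    then show False using that by simp
  qed
  have m_ge: "real eT / real vT \<le> m" if "T_density T F \<noteq> 0"
  proof -
    have "ennreal (real eT / real vT) \<le> ennreal m"
      using covering_density_ge[OF F(1) two[OF that]] unfolding dens .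
    moreover have "0 \<le> m" by (simp add: m_def)
    ultimately show ?thesis by (simp add: ennreal_le_iff)
  qed
  have thr: "threshold T F = (\<lambda>n. real n powr (- (1 / m)))" if "T_density T F \<noteq> 0"
    using that unfolding threshold_def[abs_def] m_def by simp
  have ratio_pos: "0 < real eT / real vT" using eT_ge vT_ge by (intro divide_pos_pos) auto
  show ?thesis
  proof (intro conjI impI; (elim conjE)?)
    assume lo: "threshold0 T \<in> o(p)" and hi: "p \<in> o(threshold T (Fs ! (i - 1)))"
    let ?\<F> = "set (take (i - 1) Fs)"
    have y: "filterlim (\<lambda>n. p n * real n powr (real vT / real eT)) at_top sequentially"
      using smallo_powr_imp_at_top[OF lo[unfolded threshold0_def[abs_def]]] p by blast
    \<comment> \<open>Density 0 would make the threshold 0, so \<open>p\<close> would vanish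
      eventually, against \<open>threshold0 T \<in> o(p)\<close>.\<close>
    have nz: "T_density T F \<noteq> 0"
    proof
      assume "T_density T F = 0"
      then have "threshold T (Fs ! (i - 1)) = (\<lambda>_. 0)" by (simp add: threshold_def[abs_def] F_def)
      then have "eventually (\<lambda>n. norm (p n) \<le> 1 * norm (0 :: real)) sequentially"
        using landau_o.smallD[OF hi, of 1] by simp
      moreover have "eventually (\<lambda>n. 1 \<le> p n * real n powr (real vT / real eT)) sequentially"
        using y unfolding filterlim_at_top by blast
      ultimately have "eventually (\<lambda>n :: nat. False) sequentially" by eventually_elim simp
      then show False by simp
    qed
    have m0: "0 < m" using m_ge[OF nz] ratio_pos by linarith
    have x: "(\<lambda>n. p n * real n powr (1 / m)) \<longlonglongrightarrow> 0"
      using hi thr[OF nz] unfolding F_def by (intro smallo_powr_imp_tendsto_0) simp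
    have mem: "G \<in> ?\<F> \<Longrightarrow> \<exists>j<i - 1. G = Fs ! j" for G
      using i by (auto simp: in_set_conv_nth)
    have ne: "{} \<notin> ?\<F>"
    proof
      assume "{} \<in> ?\<F>"
      then obtain j where "j < i - 1" "{} = Fs ! j" using mem by blast
      then have "union_contains H ({} :: nat ugraph set)" using res1[of j] i by (simp add: T_covering_def)
      then show False using covering_nonempty[OF _ H(2)] by blast
    qed
    \<comment> \<open>A covering beyond the cut-off is denser than \<open>F\<close>. Any other is
      isomorphic to some \<open>Fs ! j\<close>; either \<open>j < i - 1\<close>, or its density is
      at least \<open>m\<close> because the list is sorted.\<close>
    have cov: "(\<exists>F''\<in>?\<F>. collection_iso F'' F') \<or> ennreal m \<le> T_density T F'"
      if F': "T_covering T H F'" for F'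
    proof (cases "T_density T F' \<le> T_density T Fe")
      case False
      then show ?thesis using F(2) unfolding dens by auto
    next
      case True
      obtain j where j: "j < length Fs" "collection_iso F' (Fs ! j)" using res2[OF F' True] by blast
      have w: "\<forall>e\<in>edges G. e \<subseteq> verts G" if "graph_iso T G" for G :: "nat ugraph"
        using simple_graph_edgeD(1)[OF graph_iso_simple(1)[OF simple_T that]] by blast
      have iso: "collection_iso (Fs ! j) F'"
        by (rule collection_iso_sym[OF j(2)]) (use F' w in \<open>auto simp: T_covering_def\<close>)
      show ?thesis
      proof (cases "j < i - 1")
        case True
        then have "Fs ! j \<in> ?\<F>" using j(1) by (auto simp: in_set_conv_nth)
        then show ?thesis using iso by blast
      next
        case False
        have "T_density T F \<le> T_density T (Fs ! j)" unfolding F_def using False j(1) by (intro sorted) auto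
        also have "\<dots> \<le> T_density T F'"
          by (rule T_density_iso_le[OF iso]) (use res1[OF j(1)] w in \<open>auto simp: T_covering_def\<close>)
        finally show ?thesis unfolding dens by blast
      qed
    qed
    obtain e where e: "e \<longlonglongrightarrow> 0" "(\<lambda>n. measure_pmf.prob (random_graph n (p n))
        {G. real (ex_sub G T H) \<ge> (real (ex_star n T ?\<F>) - e n * real n ^ vT) * p n ^ eT}) \<longlonglongrightarrow> 1"
      by (rule diagonal_sequence[of "\<lambda>\<epsilon> n. measure_pmf.prob (random_graph n (p n))
        {G. real (ex_sub G T H) \<ge> (real (ex_star n T ?\<F>) - \<epsilon> * real n ^ vT) * p n ^ eT}"])
        (rule lower_probability[OF H m0 m_le ne cov p y x])
    show "\<exists>g :: nat \<Rightarrow> real. g \<in> o(\<lambda>n. real n ^ vT) \<and>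
          (\<lambda>n. measure_pmf.prob (random_graph n (p n))
             {G. real (ex_sub G T H) \<ge> (real (ex_star n T ?\<F>) + g n) * p n ^ eT}) \<longlonglongrightarrow> 1"
    proof (intro exI conjI)
      have "(\<lambda>n. - e n) \<longlonglongrightarrow> 0" using tendsto_minus[OF e(1)] by simp
      then show "(\<lambda>n. - e n * real n ^ vT) \<in> o(\<lambda>n. real n ^ vT)" by (rule tendsto_0_mult_smallo)
      show "(\<lambda>n. measure_pmf.prob (random_graph n (p n))
             {G. real (ex_sub G T H) \<ge> (real (ex_star n T ?\<F>) + - e n * real n ^ vT) * p n ^ eT}) \<longlonglongrightarrow> 1"
        using e(2) by simp
    qed
  next
    assume hi: "threshold T (Fs ! (i - 1)) \<in> o(p)"
    let ?\<F> = "set (take i Fs)"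
    show "\<exists>g :: nat \<Rightarrow> real. g \<in> o(\<lambda>n. real n ^ vT) \<and>
          (\<lambda>n. measure_pmf.prob (random_graph n (p n))
             {G. real (ex_sub G T H) \<le> (real (ex_star n T ?\<F>) + g n) * p n ^ eT}) \<longlonglongrightarrow> 1"
    proof (cases "T_density T F = 0")
      case True
      \<comment> \<open>Coverings with two or more members have density at least
        \<open>eT / vT\<close>, so here \<open>F\<close> is a single copy and the error term can be
        0.\<close>
      have "\<not> 2 \<le> card F"
      proof
        assume "2 \<le> card F"
        from covering_density_ge[OF F(1) this] True have "ennreal (real eT / real vT) = 0"
          by (simp only: le_zero_eq)
        then show False using ratio_pos by (simp only: ennreal_eq_0_iff)
      qed
      from single_covering_probability[OF H F(1) this p]
      show ?thesis by (intro exI[of _ "\<lambda>_. 0"] conjI) (auto simp: smallo_def)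
    next
      case False
      have \<omega>: "filterlim (\<lambda>n. p n * real n powr (1 / m)) at_top sequentially"
        using smallo_powr_imp_at_top[of "1 / m" p] hi thr[OF False] p unfolding F_def by simp
      have FF: "T_covering T H G \<and> T_density T G \<le> ennreal m" if "G \<in> ?\<F>" for G
      proof -
        obtain j where j: "j < i" "j < length Fs" "G = Fs ! j"
          using \<open>G \<in> ?\<F>\<close> by (auto simp: in_set_conv_nth)
        then have "T_density T G \<le> T_density T F" unfolding F_def j(3) using i by (intro sorted) auto
        then show ?thesis using res1[OF j(2)] j(3) unfolding dens by blast
      qed
      obtain e where e: "e \<longlonglongrightarrow> 0" "(\<lambda>n. measure_pmf.prob (random_graph n (p n))
          {G. real (ex_sub G T H) \<le> (real (ex_star n T ?\<F>) + e n * real n ^ vT) * p n ^ eT}) \<longlonglongrightarrow> 1"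
        by (rule diagonal_sequence[of "\<lambda>\<epsilon> n. measure_pmf.prob (random_graph n (p n))
          {G. real (ex_sub G T H) \<le> (real (ex_star n T ?\<F>) + \<epsilon> * real n ^ vT) * p n ^ eT}"])
          (rule upper_probability[OF H finite_set m_ge[OF False] m_le FF p \<omega>])
      show ?thesis
      proof (intro exI conjI)
        show "(\<lambda>n. e n * real n ^ vT) \<in> o(\<lambda>n. real n ^ vT)" by (rule tendsto_0_mult_smallo[OF e(1)])
      qed (rule e(2))
    qed
  qed
qed

end
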